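(* For every continuous factorization $\bigl((\Omega,\mathcal F,P),(\mathcal F_{s,t})_{s\le t}\bigr)$ there exists a sub-$\sigma$-field $\mathcal F_{\mathrm{stable}}$ of $\mathcal F$ such that for all $f\in L_2(\Omega,\mathcal F,P)$: (i) $f$ is stable if and only if $f$ is $\mathcal F_{\mathrm{stable}}$-measurable; (ii) $f$ is sensitive if and only if $\mathbb E(f\mid\mathcal F_{\mathrm{stable}})=0$.
   Context: All probability spaces are Lebesgue–Rokhlin spaces; sub-$\sigma$-fields are understood mod 0 (they contain all null sets). For sub-$\sigma$-fields, $\mathcal A=\mathcal B\otimes\mathcal D$ means that $\mathcal B,\mathcal D$ are independent and together generate $\mathcal A$. A continuous factorization consists of a probability space $(\Omega,\mathcal F,P)$ and a family $(\mathcal F_{s,t})_{s\le t}$ ($s,t\in\mathbb R$) of sub-$\sigma$-fields of $\mathcal F$ such that (a) $\mathcal F_{r,t}=\mathcal F_{r,s}\otimes\mathcal F_{s,t}$ for $r\le s\le t$; (b) $\bigcup_{\varepsilon>0}\mathcal F_{s+\varepsilon,t-\varepsilon}$ generates $\mathcal F_{s,t}$ for $s<t$; (c) $\bigcup_n\mathcal F_{-n,n}$ generates $\mathcal F$. Put $\mathcal F_{-\infty,t}=\sigma(\bigcup_{s\le t}\mathcal F_{s,t})$, $\mathcal F_{s,\infty}=\sigma(\bigcup_{t\ge s}\mathcal F_{s,t})$, $\mathcal F_{-\infty,\infty}=\mathcal F$. An elementary set $E\subset\mathbb R$ is a finite union of (possibly unbounded) intervals, treated modulo finite sets; if $E=(s_1,t_1)\cup\dots\cup(s_n,t_n)$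 (disjoint) modulo a finite set, then $\mathcal F_E=\mathcal F_{s_1,t_1}\otimes\dots\otimes\mathcal F_{s_n,t_n}$. $\mathcal C$ is the space of all compact subsets of $\mathbb R$ (including $\emptyset$) with the Hausdorff metric (and $\mathrm{dist}(\emptyset,M)=1$ for $M\ne\emptyset$). The spectral measure $\mu_f$ of $f\in L_2(\Omega,\mathcal F,P)$ is the unique finite positive Borel measure on $\mathcal C$ such that $\mu_f(\{M\in\mathcal C:M\subset E\})=\|\mathbb E(f\mid\mathcal F_E)\|^2$ for all elementary $E$; it exists and satisfies $\mu_f(\{M:M\ni t\})=0$ for every $t\in\mathbb R$. $f$ is called stable if $\mu_f$ is concentrated on $\{M\in\mathcal C:|M|<\infty\}$, and sensitive if $\mu_f$ is concentrated on $\{M\in\mathcal C:|M|=\infty\}$, where $|M|$ is the number of elements of $M$. *)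

theory Defs
  imports "HOL-Probability.Probability"
begin

section \<open>Lebesgue--Rokhlin spaces\<close>

definition isomorphic_mod0 :: "'a measure \<Rightarrow> 'b measure \<Rightarrow> bool" where
  "isomorphic_mod0 M N \<longleftrightarrow>
     (\<exists>A\<in>null_sets M. \<exists>B\<in>null_sets N. \<exists>T.
        bij_betw T (space M - A) (space N - B) \<and>
        (\<forall>S. S \<subseteq> space M - A \<longrightarrow> (S \<in> sets M \<longleftrightarrow> T ` S \<in> sets N)) \<and>
        (\<forall>S\<in>sets M. S \<subseteq> space M - A \<longrightarrow> emeasure N (T ` S) = emeasure M S))"

text \<open>
  The model space: Lebesgue measure on the interval \<open>[0, c]\<close> together with atoms of mass
  \<open>p n\<close>, placed at the points \<open>-(n + 1)\<close> in order to be disjoint from the interval.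
  The cases \<open>c = 0\<close> and \<open>p = 0\<close> are the purely atomic and the purely nonatomic one, and
  \<open>p n = 0\<close> from some \<open>n\<close> on means finitely many atoms.
\<close>

definition interval_with_atoms :: "real \<Rightarrow> (nat \<Rightarrow> ennreal) \<Rightarrow> real measure" where
  "interval_with_atoms c p =
     completion (measure_of UNIV (sets borel)
       (\<lambda>A. emeasure lborel (A \<inter> {0..c}) + (\<Sum>n. p n * indicator A (- real (Suc n)))))"

locale lebesgue_rokhlin_space = prob_space M + complete_measure M for M :: "'a measure" +
  assumes isomorphic_model: "\<exists>c p. 0 \<le> c \<and> isomorphic_mod0 M (interval_with_atoms c p)"


section \<open>Sub-sigma-fields mod 0\<close>

text \<open>
  A sub-sigma-field is given as a measure, following the convention of
  \<^const>\<open>subalgebra\<close> and \<^const>\<open>real_cond_exp\<close>; only its \<^const>\<open>space\<close> and \<^const>\<open>sets\<close> matter.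
\<close>

definition subfield :: "'a measure \<Rightarrow> 'a measure \<Rightarrow> bool" where
  "subfield M G \<longleftrightarrow> subalgebra M G \<and> null_sets M \<subseteq> sets G"

definition generated_field :: "'a measure \<Rightarrow> 'a set set \<Rightarrow> 'a measure" where
  "generated_field M \<G> = sigma (space M) (null_sets M \<union> \<G>)"

definition is_tensor_product ::
  "'a measure \<Rightarrow> 'a measure \<Rightarrow> 'a measure \<Rightarrow> 'a measure \<Rightarrow> bool" where
  "is_tensor_product M A B D \<longleftrightarrow>
     prob_space.indep_set M (sets B) (sets D) \<and>
     sets A = sets (generated_field M (sets B \<union> sets D))"


section \<open>Continuous factorizations\<close>

text \<open>The values \<open>F s t\<close> for \<open>s > t\<close> are irrelevant.\<close>

locale continuous_factorization = lebesgue_rokhlin_space M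
  for M :: "'a measure" and F :: "real \<Rightarrow> real \<Rightarrow> 'a measure" +
  assumes subfield_F: "\<And>s t. s \<le> t \<Longrightarrow> subfield M (F s t)"
    and factorization:
      "\<And>r s t. r \<le> s \<Longrightarrow> s \<le> t \<Longrightarrow> is_tensor_product M (F r t) (F r s) (F s t)"
    and inner_continuity:
      "\<And>s t. s < t \<Longrightarrow>
        sets (F s t) =
        sets (generated_field M (\<Union>e\<in>{e. 0 < e \<and> s + e \<le> t - e}. sets (F (s + e) (t - e))))"
    and exhaustion:
      "sets M = sets (generated_field M (\<Union>n::nat. sets (F (- real n) (real n))))"

text \<open>The extension of the family to infinite end points; it is only used for \<open>s < t\<close>.\<close>

definition extended_field ::
  "'a measure \<Rightarrow> (real \<Rightarrow> real \<Rightarrow> 'a measure) \<Rightarrow> ereal \<Rightarrow> ereal \<Rightarrow> 'a measure" where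
  "extended_field M F s t =
     (if s = -\<infinity> \<and> t = \<infinity> then M
      else if s = -\<infinity> then
        generated_field M (\<Union>r\<in>{..real_of_ereal t}. sets (F r (real_of_ereal t)))
      else if t = \<infinity> then
        generated_field M (\<Union>r\<in>{real_of_ereal s..}. sets (F (real_of_ereal s) r))
      else F (real_of_ereal s) (real_of_ereal t))"


section \<open>Elementary sets\<close>

definition elementary_set :: "real set \<Rightarrow> bool" where
  "elementary_set E \<longleftrightarrow> (\<exists>\<J>. finite \<J> \<and> (\<forall>J\<in>\<J>. is_interval J) \<and> E = \<Union>\<J>)"

definition open_interval :: "ereal \<times> ereal \<Rightarrow> real set" where
  "open_interval = (\<lambda>(s, t). {x. s < ereal x \<and> ereal x < t})"

text \<open>\<open>E\<close> is, modulo a finite set, the disjoint union of the open intervals \<open>(s, t)\<close>, \<open>(s, t) \<in> I\<close>.\<close>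

definition decomposes_into :: "real set \<Rightarrow> (ereal \<times> ereal) set \<Rightarrow> bool" where
  "decomposes_into E I \<longleftrightarrow>
     finite I \<and> (\<forall>(s, t)\<in>I. s < t) \<and> disjoint_family_on open_interval I \<and>
     finite (sym_diff E (\<Union>(open_interval ` I)))"

text \<open>
  The sigma-field of an elementary set decomposed into \<open>I\<close>. By the factorization property
  the fields of the disjoint intervals are independent, so that the field they generate is their
  tensor product. For empty \<open>I\<close> this is the trivial sigma-field.
\<close>

definition elementary_field ::
  "'a measure \<Rightarrow> (real \<Rightarrow> real \<Rightarrow> 'a measure) \<Rightarrow> (ereal \<times> ereal) set \<Rightarrow> 'a measure" where
  "elementary_field M F I = generated_field M (\<Union>(s, t)\<in>I. sets (extended_field M F s t))"


section \<open>The space of compact subsets of the line\<close>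

definition compacts :: "real set set" where
  "compacts = {K. compact K}"

definition hausdorff_dist :: "real set \<Rightarrow> real set \<Rightarrow> real" where
  "hausdorff_dist K L =
     (if K = {} \<and> L = {} then 0
      else if K = {} \<or> L = {} then 1
      else max (SUP x\<in>K. infdist x L) (SUP y\<in>L. infdist y K))"

text \<open>
  With the value 1 for the distance from the empty set the triangle inequality can fail at large
  distances, so no metric space is formed; the open sets are those of the (genuine)
  metric obtained by truncating \<^const>\<open>hausdorff_dist\<close> at 1.
\<close>

definition hausdorff_open :: "real set set \<Rightarrow> bool" where
  "hausdorff_open U \<longleftrightarrow>
     U \<subseteq> compacts \<and>
     (\<forall>K\<in>U. \<exists>e>0. \<forall>L\<in>compacts. hausdorff_dist K L < e \<longrightarrow> L \<in> U)"

definition compacts_borel :: "real set measure" where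
  "compacts_borel = sigma compacts (Collect hausdorff_open)"


section \<open>Spectral measures, stability and sensitivity\<close>

definition L2 :: "'a measure \<Rightarrow> ('a \<Rightarrow> real) set" where
  "L2 M = {f \<in> borel_measurable M. integrable M (\<lambda>x. (f x)\<^sup>2)}"

text \<open>
  Elementary sets are not identified here when they differ by a finite set: the condition is
  imposed on every representative \<open>E\<close>, which forces \<open>{K. t \<in> K}\<close> to be a null set for each \<open>t\<close>.
\<close>

definition is_spectral_measure ::
  "'a measure \<Rightarrow> (real \<Rightarrow> real \<Rightarrow> 'a measure) \<Rightarrow> ('a \<Rightarrow> real) \<Rightarrow> real set measure \<Rightarrow> bool" where
  "is_spectral_measure M F f \<mu> \<longleftrightarrow>
     finite_measure \<mu> \<and> space \<mu> = compacts \<and> sets \<mu> = sets compacts_borel \<and>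
     (\<forall>E I. elementary_set E \<and> decomposes_into E I \<longrightarrow>
        measure \<mu> {K \<in> compacts. K \<subseteq> E} =
        (\<integral>x. (real_cond_exp M (elementary_field M F I) f x)\<^sup>2 \<partial>M))"

definition spectral_measure ::
  "'a measure \<Rightarrow> (real \<Rightarrow> real \<Rightarrow> 'a measure) \<Rightarrow> ('a \<Rightarrow> real) \<Rightarrow> real set measure" where
  "spectral_measure M F f = (THE \<mu>. is_spectral_measure M F f \<mu>)"

definition stable_rv ::
  "'a measure \<Rightarrow> (real \<Rightarrow> real \<Rightarrow> 'a measure) \<Rightarrow> ('a \<Rightarrow> real) \<Rightarrow> bool" where
  "stable_rv M F f \<longleftrightarrow> (AE K in spectral_measure M F f. finite K)"

definition sensitive_rv ::
  "'a measure \<Rightarrow> (real \<Rightarrow> real \<Rightarrow> 'a measure) \<Rightarrow> ('a \<Rightarrow> real) \<Rightarrow> bool" where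
  "sensitive_rv M F f \<longleftrightarrow> (AE K in spectral_measure M F f. infinite K)"

end

theory Submission
  imports Defs
begin

text \<open>
  The projections \<open>f \<mapsto> E(f | F_E)\<close> commute and multiply like the intersections of the sets \<open>E\<close>.
  Splitting \<open>f\<close> successively along them gives nonnegative weights for the hitting patterns of finitely
  many elementary sets; Kolmogorov's theorem makes them a process, and the spectral measure is the
  law of the compact set which the process cuts out of the nested dyadic cells. Inner continuity
  identifies the mass of \<open>{K. K \<subseteq> E}\<close> with the energy \<open>\<parallel>E(f | F_E)\<parallel>\<^sup>2\<close>, and downward continuity at
  points is automatic, as the energies of \<open>\<real>\<close> and \<open>\<real> - {t}\<close> agree.

  For every Borel set \<open>S\<close> of compact sets, the mass \<open>\<mu>_f(S)\<close> is a nonnegative quadratic form in \<open>f\<close>, bounded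
  by \<open>\<parallel>f\<parallel>\<^sup>2\<close>. Hence the stable functions form a closed linear space, orthogonal to the sensitive
  ones, and the spectral projection of a function to the finite sets is stable. Since
  \<open>\<bar>E(f | F_E)\<bar> \<le> E(\<bar>f\<bar> | F_E)\<close>, the energy of \<open>\<bar>f\<bar>\<close> dominates that of \<open>f\<close>. Averaging over a random \<open>E\<close> which
  keeps each small dyadic cell with probability \<open>\<rho>\<close>, and refining the cells, yields the inequality
  \<open>\<integral> \<rho>^|K| d\<mu>_f \<le> \<integral> \<rho>^|K| d\<mu>_|f|\<close>; as \<open>\<rho> \<rightarrow> 1\<close>, stability of \<open>f\<close> passes to \<open>\<bar>f\<bar>\<close>. A closed linear
  sublattice containing the constants consists of the square integrable functions that are
  measurable for a sub-sigma-field.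
\<close>

section \<open>Square integrable functions\<close>

text \<open>The obstacle is that only energies can be compared between \<open>f\<close> and its
  absolute value, while stability concerns the mass of the class of finite sets, and
  inclusion-exclusion expresses masses through energies with both signs. The function
  \<open>\<rho> ^ card K\<close> is chosen because it is a limit of averages of containment
  indicators with nonnegative weights, so that the comparison survives. It shows that the absolute
  value has at least as much mass on the finite sets; as both functions have the same norm, hence
  the same total mass, a stable \<open>f\<close> leaves no mass for the infinite sets.

  Linearity is handled through masses alone: the parallelogram identity takes the place of a
  bilinear form, and orthogonality is read off from the additivity of norms. For the second
  equivalence orthogonality gives only one direction. Conversely, a function with vanishing
  conditional expectation must be shown to have no stable part; the spectral projection supplies
  this part as an actual function, which turns out to be orthogonal to itself.\<close>

lemma integrable_mult_of_squares:
  fixes f g :: "'a \<Rightarrow> real"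
  assumes [measurable]: "f \<in> borel_measurable M" "g \<in> borel_measurable M"
    and "integrable M (\<lambda>x. (f x)\<^sup>2)" "integrable M (\<lambda>x. (g x)\<^sup>2)"
  shows "integrable M (\<lambda>x. f x * g x)"
proof (rule Bochner_Integration.integrable_bound)
  show "integrable M (\<lambda>x. (f x)\<^sup>2 + (g x)\<^sup>2)"
    using assms by simp
  show "AE x in M. norm (f x * g x) \<le> norm ((f x)\<^sup>2 + (g x)\<^sup>2)"
  proof (intro AE_I2)
    fix x
    have "0 \<le> (\<bar>f x\<bar> - \<bar>g x\<bar>)\<^sup>2" by simp
    then have "2 * \<bar>f x * g x\<bar> \<le> (f x)\<^sup>2 + (g x)\<^sup>2"
      by (simp add: power2_diff abs_mult)
    moreover have "0 \<le> \<bar>f x * g x\<bar>" by simp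
    ultimately show "norm (f x * g x) \<le> norm ((f x)\<^sup>2 + (g x)\<^sup>2)"
      by simp
  qed
qed simp

lemma L2_measurable [measurable_dest]: "f \<in> L2 M \<Longrightarrow> f \<in> borel_measurable M"
  by (simp add: L2_def)

lemma L2_square_integrable: "f \<in> L2 M \<Longrightarrow> integrable M (\<lambda>x. (f x)\<^sup>2)"
  by (simp add: L2_def)

lemma L2_mult_integrable: "f \<in> L2 M \<Longrightarrow> g \<in> L2 M \<Longrightarrow> integrable M (\<lambda>x. f x * g x)"
  by (auto simp: L2_def intro: integrable_mult_of_squares)

lemma L2_add:
  assumes "f \<in> L2 M" "g \<in> L2 M"
  shows "(\<lambda>x. f x + g x) \<in> L2 M"
proof -
  have "integrable M (\<lambda>x. (f x)\<^sup>2 + (g x)\<^sup>2 + 2 * (f x * g x))"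
    using assms L2_mult_integrable[OF assms] by (auto simp: L2_def)
  then show ?thesis
    using assms by (auto simp: L2_def power2_sum algebra_simps)
qed

lemma L2_cmult: "f \<in> L2 M \<Longrightarrow> (\<lambda>x. c * f x) \<in> L2 M" for c :: real
  by (auto simp: L2_def power_mult_distrib)

lemma L2_diff:
  assumes "f \<in> L2 M" "g \<in> L2 M"
  shows "(\<lambda>x. f x - g x) \<in> L2 M"
  using L2_add[OF assms(1) L2_cmult[OF assms(2), of "-1"]] by simp

lemma L2_abs: "f \<in> L2 M \<Longrightarrow> (\<lambda>x. \<bar>f x\<bar>) \<in> L2 M"
  by (auto simp: L2_def)

lemma L2_sum:
  assumes "\<And>i. i \<in> I \<Longrightarrow> f i \<in> L2 M"
  shows "(\<lambda>x. \<Sum>i\<in>I. f i x) \<in> L2 M"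
  using assms
proof (induction I rule: infinite_finite_induct)
  case (insert i I)
  then show ?case using L2_add[of "f i" M "\<lambda>x. \<Sum>i\<in>I. f i x"] by simp
qed (auto simp: L2_def)

lemma L2_bounded_by:
  assumes "g \<in> L2 M" and [measurable]: "f \<in> borel_measurable M"
    and "\<And>x. x \<in> space M \<Longrightarrow> \<bar>f x\<bar> \<le> \<bar>g x\<bar>"
  shows "f \<in> L2 M"
proof -
  have "integrable M (\<lambda>x. (f x)\<^sup>2)"
  proof (rule Bochner_Integration.integrable_bound)
    show "integrable M (\<lambda>x. (g x)\<^sup>2)" using assms by (simp add: L2_def)
    show "AE x in M. norm ((f x)\<^sup>2) \<le> norm ((g x)\<^sup>2)"
      using assms(3) by (intro AE_I2) (auto simp: abs_le_square_iff)
  qed simp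
  then show ?thesis by (simp add: L2_def)
qed

lemma L2_Cauchy_Schwarz:
  assumes f: "f \<in> L2 M" and g: "g \<in> L2 M"
  shows "(\<integral>x. f x * g x \<partial>M)\<^sup>2 \<le> (\<integral>x. (f x)\<^sup>2 \<partial>M) * (\<integral>x. (g x)\<^sup>2 \<partial>M)"
proof -
  let ?a = "\<integral>x. (f x)\<^sup>2 \<partial>M" and ?b = "\<integral>x. f x * g x \<partial>M" and ?c = "\<integral>x. (g x)\<^sup>2 \<partial>M"
  have quad: "0 \<le> s\<^sup>2 * ?a + 2 * s * t * ?b + t\<^sup>2 * ?c" for s t :: real
  proof -
    have "0 \<le> (\<integral>x. (s * f x + t * g x)\<^sup>2 \<partial>M)" by simp
    also have "\<dots> = (\<integral>x. s\<^sup>2 * (f x)\<^sup>2 + 2 * s * t * (f x * g x) + t\<^sup>2 * (g x)\<^sup>2 \<partial>M)"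
      by (intro Bochner_Integration.integral_cong) (auto simp: power2_eq_square algebra_simps)
    also have "\<dots> = s\<^sup>2 * ?a + 2 * s * t * ?b + t\<^sup>2 * ?c"
      using L2_square_integrable[OF f] L2_square_integrable[OF g] L2_mult_integrable[OF f g] by simp
    finally show ?thesis .
  qed
  have c0: "0 \<le> ?c" by simp
  show ?thesis
  proof (cases "?c = 0")
    case True
    have "?b = 0"
    proof (rule ccontr)
      assume b: "?b \<noteq> 0"
      \<comment> \<open>The second argument of the form is chosen to give it the value
        \<open>-1\<close>.\<close>
      show False
        using quad[of 1 "- (?a + 1) / (2 * ?b)"] True b by (simp add: field_simps)
    qed
    then show ?thesis using True by simp
  next
    case False
    \<comment> \<open>The form is evaluated in its minimising direction, scaled by \<open>?c\<close>
      to avoid quotients.\<close>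
    have "0 \<le> ?c * (?a * ?c - ?b\<^sup>2)"
      using quad[of "?c" "- ?b"] by (simp add: power2_eq_square algebra_simps)
    then have "0 \<le> ?a * ?c - ?b\<^sup>2"
      using False c0 by (simp add: zero_le_mult_iff)
    then show ?thesis by simp
  qed
qed

context prob_space
begin

lemma L2_integrable: "f \<in> L2 M \<Longrightarrow> integrable M f"
  by (auto simp: L2_def intro: square_integrable_imp_integrable)

lemma L2_const: "(\<lambda>_. c) \<in> L2 M"
  by (simp add: L2_def)

lemma L2_indicator: "A \<in> sets M \<Longrightarrow> indicator A \<in> L2 M"
  by (rule L2_bounded_by[OF L2_const[of 1]]) (auto simp: indicator_def)

lemma L2_integral_abs_le:
  assumes "f \<in> L2 M"
  shows "(\<integral>x. \<bar>f x\<bar> \<partial>M) \<le> sqrt (\<integral>x. (f x)\<^sup>2 \<partial>M)"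
  using L2_Cauchy_Schwarz[OF L2_abs[OF assms] L2_const[of 1]] real_le_rsqrt
  by (simp add: prob_space)

text \<open>Riesz--Fischer; the limit is measurable for \<open>G\<close> since it is the pointwise limit of a subsequence.\<close>

lemma L2_complete:
  assumes G: "subalgebra M G"
    and H: "\<And>n. H n \<in> L2 M" and HG: "\<And>n. H n \<in> borel_measurable G"
    and Cauchy: "\<And>e. 0 < e \<Longrightarrow> \<exists>N. \<forall>m\<ge>N. \<forall>n\<ge>N. (\<integral>x. (H m x - H n x)\<^sup>2 \<partial>M) < e"
  obtains h where "h \<in> L2 M" "h \<in> borel_measurable G" "(\<lambda>n. \<integral>x. (H n x - h x)\<^sup>2 \<partial>M) \<longlonglongrightarrow> 0"
proof -
  have [measurable]: "H n \<in> borel_measurable M" for n using H by (rule L2_measurable)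
  have "\<exists>N. \<forall>k. (\<forall>m\<ge>N k. \<forall>n\<ge>N k. (\<integral>x. (H m x - H n x)\<^sup>2 \<partial>M) < (1/4::real)^k)"
    using Cauchy[of "(1/4)^k" for k] by (intro choice allI) simp
  then obtain N where N: "\<And>k m n. m \<ge> N k \<Longrightarrow> n \<ge> N k \<Longrightarrow> (\<integral>x. (H m x - H n x)\<^sup>2 \<partial>M) < (1/4::real)^k"
    by blast
  \<comment> \<open>\<open>r\<close> is nondecreasing, dominates \<open>N\<close> and, because of
    the summand \<open>k\<close>, tends to infinity.\<close>
  define r where "r k = k + (\<Sum>i\<le>k. N i)" for k
  have r: "N k \<le> r k" "r k \<le> r (Suc k)" "k \<le> r k" for k
    unfolding r_def using member_le_sum[of k "{..k}" N] by auto
  define d where "d k x = \<bar>H (r (Suc k)) x - H (r k) x\<bar>" for k x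
  have dL2: "(\<lambda>x. H (r (Suc k)) x - H (r k) x) \<in> L2 M" for k
    using H by (intro L2_diff)
  have d_meas[measurable]: "d k \<in> borel_measurable M" for k unfolding d_def by measurable
  have "(\<integral>\<^sup>+x. ennreal (d k x) \<partial>M) \<le> ennreal ((1/2)^k)" for k
  proof -
    have "(\<integral>\<^sup>+x. ennreal (d k x) \<partial>M) = ennreal (\<integral>x. d k x \<partial>M)"
      unfolding d_def using L2_integrable[OF L2_abs[OF dL2[of k]]]
      by (intro nn_integral_eq_integral) auto
    also have "(\<integral>x. d k x \<partial>M) \<le> sqrt (\<integral>x. (H (r (Suc k)) x - H (r k) x)\<^sup>2 \<partial>M)"
      unfolding d_def by (rule L2_integral_abs_le[OF dL2])
    also have "\<dots> \<le> sqrt ((1/4)^k)"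
      using N[of k "r (Suc k)" "r k"] r[of k] by (intro real_sqrt_le_mono) auto
    also have "\<dots> = (1/2)^k"
      by (simp add: real_sqrt_power real_sqrt_divide)
    finally show ?thesis by (simp add: ennreal_leI)
  qed
  then have "(\<integral>\<^sup>+x. (\<Sum>k. ennreal (d k x)) \<partial>M) \<le> (\<Sum>k. ennreal ((1/2)^k))"
    by (subst nn_integral_suminf) (auto intro: suminf_le)
  also have "\<dots> < \<infinity>"
    by (subst suminf_ennreal2) (auto intro: summable_geometric)
  finally have "AE x in M. (\<Sum>k. ennreal (d k x)) \<noteq> \<infinity>"
    by (intro nn_integral_PInf_AE) auto
  then have conv: "AE x in M. convergent (\<lambda>k. H (r k) x)"
  proof eventually_elim
    case (elim x)
    then have "summable (\<lambda>k. d k x)"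
      by (intro summable_suminf_not_top) (auto simp: d_def)
    then have "summable (\<lambda>k. H (r (Suc k)) x - H (r k) x)"
      unfolding d_def by (rule summable_rabs_cancel)
    then have "convergent (\<lambda>n. \<Sum>k<n. H (r (Suc k)) x - H (r k) x)"
      by (simp add: summable_iff_convergent)
    then have "convergent (\<lambda>n. H (r n) x - H (r 0) x)"
      by (simp add: sum_lessThan_telescope[of "\<lambda>k. H (r k) x"])
    then have "convergent (\<lambda>n. (H (r n) x - H (r 0) x) + H (r 0) x)"
      by (intro convergent_add convergent_const)
    then show ?case by simp
  qed
  define h where "h x = lim (\<lambda>k. H (r k) x)" for x
  have hG[measurable]: "h \<in> borel_measurable G"
    unfolding h_def using HG by (intro borel_measurable_lim_metric) auto
  have hM[measurable]: "h \<in> borel_measurable M" by (rule measurable_from_subalg[OF G hG])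
  have lim_h: "AE x in M. (\<lambda>k. H (r k) x) \<longlonglongrightarrow> h x"
    using conv unfolding h_def by eventually_elim (simp add: convergent_LIMSEQ_iff)
  \<comment> \<open>With \<open>n\<close> fixed, Fatou's lemma runs along the subsequence; hence the
    whole sequence, and not only the subsequence, comes close to \<open>h\<close>.\<close>
  have fatou: "(\<integral>\<^sup>+x. ennreal ((H n x - h x)\<^sup>2) \<partial>M) \<le> ennreal ((1/4)^k)" if n: "n \<ge> N k" for n k
  proof -
    have "(\<integral>\<^sup>+x. ennreal ((H n x - h x)\<^sup>2) \<partial>M) =
        (\<integral>\<^sup>+x. liminf (\<lambda>j. ennreal ((H n x - H (r j) x)\<^sup>2)) \<partial>M)"
      using lim_h
    proof (intro nn_integral_cong_AE, eventually_elim)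
      case (elim x)
      then have "(\<lambda>j. ennreal ((H n x - H (r j) x)\<^sup>2)) \<longlonglongrightarrow> ennreal ((H n x - h x)\<^sup>2)"
        by (intro tendsto_intros)
      then show ?case by (intro lim_imp_Liminf[symmetric]) auto
    qed
    also have "\<dots> \<le> liminf (\<lambda>j. \<integral>\<^sup>+x. ennreal ((H n x - H (r j) x)\<^sup>2) \<partial>M)"
      by (intro nn_integral_liminf) measurable
    also have "\<dots> \<le> ennreal ((1/4)^k)"
    proof (rule Liminf_le)
      show "\<forall>\<^sub>F j in sequentially. (\<integral>\<^sup>+x. ennreal ((H n x - H (r j) x)\<^sup>2) \<partial>M) \<le> ennreal ((1/4)^k)"
        using eventually_ge_at_top[of "N k"]
      proof eventually_elim
        case (elim j)
        have "(\<integral>\<^sup>+x. ennreal ((H n x - H (r j) x)\<^sup>2) \<partial>M) = ennreal (\<integral>x. (H n x - H (r j) x)\<^sup>2 \<partial>M)"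
          using L2_square_integrable[OF L2_diff[OF H H]] by (intro nn_integral_eq_integral) auto
        also have "\<dots> \<le> ennreal ((1/4)^k)"
          using N[OF n, of "r j"] elim r(3)[of j] by (intro ennreal_leI) linarith
        finally show ?case .
      qed
    qed simp
    finally show ?thesis .
  qed
  have diff: "(\<lambda>x. H n x - h x) \<in> L2 M \<and> (\<integral>x. (H n x - h x)\<^sup>2 \<partial>M) \<le> (1/4)^k" if n: "n \<ge> N k" for n k
  proof -
    have "(\<integral>\<^sup>+x. ennreal ((H n x - h x)\<^sup>2) \<partial>M) < \<infinity>"
      using fatou[OF n] by (auto intro: le_less_trans)
    then have int: "integrable M (\<lambda>x. (H n x - h x)\<^sup>2)"
      by (intro integrableI_nonneg) auto
    moreover have "ennreal (\<integral>x. (H n x - h x)\<^sup>2 \<partial>M) \<le> ennreal ((1/4)^k)"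
      using fatou[OF n] nn_integral_eq_integral[OF int] by simp
    ultimately show ?thesis by (simp add: L2_def)
  qed
  have "(\<lambda>x. H (N 0) x - (H (N 0) x - h x)) \<in> L2 M"
    using diff[of 0 "N 0"] by (intro L2_diff[OF H, of "\<lambda>x. H (N 0) x - h x" "N 0"]) auto
  then have "h \<in> L2 M" by simp
  moreover have "(\<lambda>n. \<integral>x. (H n x - h x)\<^sup>2 \<partial>M) \<longlonglongrightarrow> 0"
  proof (rule LIMSEQ_I)
    fix e :: real assume "0 < e"
    then obtain k where k: "(1/4::real)^k < e"
      using real_arch_pow_inv[of e "1/4"] by auto
    show "\<exists>no. \<forall>n\<ge>no. norm ((\<integral>x. (H n x - h x)\<^sup>2 \<partial>M) - 0) < e"
      using diff[of k] k by (intro exI[of _ "N k"]) (auto intro: le_less_trans)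
  qed
  ultimately show ?thesis using that hG by blast
qed

section \<open>Conditional expectations of square integrable functions\<close>

context
  fixes G assumes G: "subalgebra M G"
begin

interpretation finite_measure_subalgebra M G
  using G by unfold_locales

lemma cond_exp_L2:
  assumes "f \<in> L2 M"
  shows "real_cond_exp M G f \<in> L2 M"
    and "(\<integral>x. (real_cond_exp M G f x)\<^sup>2 \<partial>M) \<le> (\<integral>x. (f x)\<^sup>2 \<partial>M)"
proof -
  have conv: "convex_on UNIV (\<lambda>x::real. x\<^sup>2)"
    using convex_power2 by blast
  have le: "AE x in M. (real_cond_exp M G f x)\<^sup>2 \<le> real_cond_exp M G (\<lambda>x. (f x)\<^sup>2) x"
    using assms by (intro real_cond_exp_jensens_inequality(2)[where I=UNIV])
      (auto simp: L2_integrable L2_square_integrable conv)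
  have int: "integrable M (real_cond_exp M G (\<lambda>x. (f x)\<^sup>2))"
    "(\<integral>x. real_cond_exp M G (\<lambda>x. (f x)\<^sup>2) x \<partial>M) = (\<integral>x. (f x)\<^sup>2 \<partial>M)"
    using assms by (auto simp: L2_square_integrable intro: real_cond_exp_int)
  have int2: "integrable M (\<lambda>x. (real_cond_exp M G f x)\<^sup>2)"
    using le by (intro Bochner_Integration.integrable_bound[OF int(1)]) (auto elim!: eventually_mono)
  then show "real_cond_exp M G f \<in> L2 M" by (simp add: L2_def)
  show "(\<integral>x. (real_cond_exp M G f x)\<^sup>2 \<partial>M) \<le> (\<integral>x. (f x)\<^sup>2 \<partial>M)"
    using integral_mono_AE[OF int2 int(1) le] int(2) by simp
qed

lemma cond_exp_inner:
  assumes "f \<in> L2 M" "g \<in> L2 M" "g \<in> borel_measurable G"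
  shows "(\<integral>x. g x * real_cond_exp M G f x \<partial>M) = (\<integral>x. g x * f x \<partial>M)"
  using assms by (intro real_cond_exp_intg(2) L2_mult_integrable) auto

lemma cond_exp_inner_cond_exp:
  assumes "f \<in> L2 M" "g \<in> L2 M"
  shows "(\<integral>x. real_cond_exp M G g x * f x \<partial>M) = (\<integral>x. real_cond_exp M G g x * real_cond_exp M G f x \<partial>M)"
  using assms cond_exp_inner[OF assms(1) cond_exp_L2(1)[OF assms(2)]] by simp

lemma cond_exp_square_diff:
  assumes "f \<in> L2 M"
  shows "(\<integral>x. (f x - real_cond_exp M G f x)\<^sup>2 \<partial>M) =
    (\<integral>x. (f x)\<^sup>2 \<partial>M) - (\<integral>x. (real_cond_exp M G f x)\<^sup>2 \<partial>M)"
proof -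
  let ?p = "real_cond_exp M G f"
  have p: "?p \<in> L2 M" by (rule cond_exp_L2(1)[OF assms])
  have "(\<integral>x. (f x - ?p x)\<^sup>2 \<partial>M) = (\<integral>x. (f x)\<^sup>2 + (?p x)\<^sup>2 - 2 * (?p x * f x) \<partial>M)"
    by (intro Bochner_Integration.integral_cong) (auto simp: power2_eq_square algebra_simps)
  also have "\<dots> = (\<integral>x. (f x)\<^sup>2 \<partial>M) + (\<integral>x. (?p x)\<^sup>2 \<partial>M) - 2 * (\<integral>x. ?p x * f x \<partial>M)"
    using assms p L2_mult_integrable[OF p assms] by (simp add: L2_square_integrable)
  also have "(\<integral>x. ?p x * f x \<partial>M) = (\<integral>x. (?p x)\<^sup>2 \<partial>M)"
    using cond_exp_inner_cond_exp[OF assms assms] by (simp add: power2_eq_square)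
  finally show ?thesis by simp
qed

lemma cond_exp_abs_square_le:
  assumes "f \<in> L2 M"
  shows "(\<integral>x. (real_cond_exp M G f x)\<^sup>2 \<partial>M) \<le> (\<integral>x. (real_cond_exp M G (\<lambda>x. \<bar>f x\<bar>) x)\<^sup>2 \<partial>M)"
proof (rule integral_mono_AE)
  have i: "integrable M f" "integrable M (\<lambda>x. \<bar>f x\<bar>)" "integrable M (\<lambda>x. - f x)"
    using L2_integrable[OF assms] by auto
  have "AE x in M. real_cond_exp M G f x \<le> real_cond_exp M G (\<lambda>x. \<bar>f x\<bar>) x"
    using i by (intro real_cond_exp_mono) auto
  moreover have "AE x in M. real_cond_exp M G (\<lambda>x. - f x) x \<le> real_cond_exp M G (\<lambda>x. \<bar>f x\<bar>) x"
    using i by (intro real_cond_exp_mono) auto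
  moreover have "AE x in M. real_cond_exp M G (\<lambda>x. -1 * f x) x = -1 * real_cond_exp M G f x"
    using i by (intro real_cond_exp_cmult)
  ultimately show "AE x in M. (real_cond_exp M G f x)\<^sup>2 \<le> (real_cond_exp M G (\<lambda>x. \<bar>f x\<bar>) x)\<^sup>2"
    by eventually_elim (auto simp: abs_le_square_iff[symmetric])
qed (use cond_exp_L2(1)[OF assms] cond_exp_L2(1)[OF L2_abs[OF assms]] in \<open>auto simp: L2_def\<close>)

lemma cond_exp_square_cong:
  assumes "AE x in M. f x = g x" "f \<in> borel_measurable M" "g \<in> borel_measurable M"
  shows "(\<integral>x. (real_cond_exp M G f x)\<^sup>2 \<partial>M) = (\<integral>x. (real_cond_exp M G g x)\<^sup>2 \<partial>M)"
proof (rule integral_cong_AE)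
  show "AE x in M. (real_cond_exp M G f x)\<^sup>2 = (real_cond_exp M G g x)\<^sup>2"
    using real_cond_exp_cong[OF assms] by auto
qed simp_all

text \<open>The case \<open>c = 1\<close> is the parallelogram law. The weight \<open>c\<close> is kept free because letting it tend to
  infinity shows that a summand of spectral mass zero does not change the spectral mass.\<close>

lemma cond_exp_parallelogram:
  fixes c :: real
  assumes f: "f \<in> L2 M" and g: "g \<in> L2 M" and c: "c \<noteq> 0"
  shows "(\<integral>x. (real_cond_exp M G (\<lambda>x. f x + g x) x)\<^sup>2 \<partial>M) +
      (\<integral>x. (real_cond_exp M G (\<lambda>x. c * f x - g x / c) x)\<^sup>2 \<partial>M) =
    (1 + c\<^sup>2) * (\<integral>x. (real_cond_exp M G f x)\<^sup>2 \<partial>M) +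
    (1 + 1 / c\<^sup>2) * (\<integral>x. (real_cond_exp M G g x)\<^sup>2 \<partial>M)"
proof -
  let ?E = "real_cond_exp M G"
  have i: "integrable M f" "integrable M g" "integrable M (\<lambda>x. c * f x)" "integrable M (\<lambda>x. g x / c)"
    using L2_integrable[OF f] L2_integrable[OF g] by auto
  have "AE x in M. ?E (\<lambda>x. f x + g x) x = ?E f x + ?E g x"
    using i by (intro real_cond_exp_add)
  moreover have "AE x in M. ?E (\<lambda>x. c * f x - g x / c) x = ?E (\<lambda>x. c * f x) x - ?E (\<lambda>x. g x / c) x"
    using i by (intro real_cond_exp_diff)
  moreover have "AE x in M. ?E (\<lambda>x. c * f x) x = c * ?E f x"
    using i by (intro real_cond_exp_cmult)
  moreover have "AE x in M. ?E (\<lambda>x. g x / c) x = ?E g x / c"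
    using i by (intro real_cond_exp_cdiv)
  ultimately have *: "AE x in M. (?E (\<lambda>x. f x + g x) x)\<^sup>2 + (?E (\<lambda>x. c * f x - g x / c) x)\<^sup>2 =
      (1 + c\<^sup>2) * (?E f x)\<^sup>2 + (1 + 1 / c\<^sup>2) * (?E g x)\<^sup>2"
  proof eventually_elim
    case (elim x)
    have "(a + b)\<^sup>2 + (c * a - b / c)\<^sup>2 = (1 + c\<^sup>2) * a\<^sup>2 + (1 + 1 / c\<^sup>2) * b\<^sup>2" for a b
      using c by (simp add: power2_eq_square field_simps)
    with elim show ?case by simp
  qed
  have L: "?E f \<in> L2 M" "?E g \<in> L2 M" "?E (\<lambda>x. f x + g x) \<in> L2 M" "?E (\<lambda>x. c * f x - g x / c) \<in> L2 M"
    using f g L2_diff[OF L2_cmult[OF f, of c] L2_cmult[OF g, of "1 / c"]]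
    by (auto intro!: cond_exp_L2 L2_add)
  have "(\<integral>x. (?E (\<lambda>x. f x + g x) x)\<^sup>2 + (?E (\<lambda>x. c * f x - g x / c) x)\<^sup>2 \<partial>M) =
      (\<integral>x. (1 + c\<^sup>2) * (?E f x)\<^sup>2 + (1 + 1 / c\<^sup>2) * (?E g x)\<^sup>2 \<partial>M)"
    using * by (rule integral_cong_AE[rotated 2]) simp_all
  then show ?thesis
    using L by (simp add: L2_square_integrable)
qed

end

end

section \<open>The fields of intervals with end points in the extended line\<close>

lemma open_interval_mem [simp]: "x \<in> open_interval (s, t) \<longleftrightarrow> s < ereal x \<and> ereal x < t"
  by (simp add: open_interval_def)

lemma open_interval_subset_iff:
  assumes "s < t"
  shows "open_interval (s, t) \<subseteq> open_interval (s', t') \<longleftrightarrow> s' \<le> s \<and> t \<le> t'"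
proof
  assume sub: "open_interval (s, t) \<subseteq> open_interval (s', t')"
  show "s' \<le> s \<and> t \<le> t'"
  proof (rule ccontr)
    assume "\<not> ?thesis"
    then have "s < min s' t \<or> max s t' < t" using assms by (auto simp: not_le)
    then obtain x where "s < ereal x" "ereal x < t" "ereal x < s' \<or> t' < ereal x"
      using ereal_dense2[of s "min s' t"] ereal_dense2[of "max s t'" t] by auto
    then show False using sub[THEN subsetD, of x] by auto
  qed
qed auto

lemma open_interval_eq_empty_iff: "open_interval (s, t) = {} \<longleftrightarrow> t \<le> s"
proof (cases "s < t")
  case True
  then show ?thesis using ereal_dense2[of s t] by (auto simp: open_interval_def)
qed (auto simp: open_interval_def)

lemma open_open_interval: "open (open_interval p)"
proof -
  obtain s t where p: "p = (s, t)" by force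
  have "open {x. s < ereal x}" "open {x. ereal x < t}"
    by (intro open_Collect_less continuous_intros continuous_on_ereal)+
  then show ?thesis
    unfolding p open_interval_def by (auto intro: open_Collect_conj)
qed

lemma connected_open_interval: "connected (open_interval p)"
proof -
  obtain s t where p: "p = (s, t)" by force
  have "is_interval (open_interval p)"
    unfolding is_interval_1 p by (auto intro: less_le_trans order.strict_trans1[of "ereal _" "ereal _"])
  then show ?thesis by (rule is_interval_connected)
qed

lemma space_generated_field [simp]: "space (generated_field M X) = space M"
  by (simp add: generated_field_def space_measure_of_conv)

lemma generated_field_eqI:
  assumes "sets (generated_field M X) = sets (generated_field M Y)"
  shows "generated_field M X = generated_field M Y"
  using assms by (intro measure_eqI) (auto simp: generated_field_def emeasure_sigma)

lemma subfield_subalgebra: "subfield M G \<Longrightarrow> subalgebra M G"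
  by (simp add: subfield_def)

lemma subfield_sets: "subfield M G \<Longrightarrow> sets G \<subseteq> sets M"
  by (simp add: subfield_def subalgebra_def)

lemma subfield_space: "subfield M G \<Longrightarrow> space G = space M"
  by (simp add: subfield_def subalgebra_def)

lemma subfield_null_sets: "subfield M G \<Longrightarrow> null_sets M \<subseteq> sets G"
  by (simp add: subfield_def)

lemma null_sets_Pow: "null_sets M \<subseteq> Pow (space M)"
  using sets.sets_into_space by fastforce

context
  fixes M :: "'a measure" and X
  assumes X: "X \<subseteq> sets M"
begin

lemma sets_generated_field: "sets (generated_field M X) = sigma_sets (space M) (null_sets M \<union> X)"
  unfolding generated_field_def
  using X null_sets_Pow[of M] sets.space_closed[of M] by (intro sets_measure_of) auto

lemma generated_field_upper: "X \<subseteq> sets (generated_field M X)"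
  unfolding sets_generated_field by auto

lemma subfield_generated_field: "subfield M (generated_field M X)"
proof -
  have "sigma_sets (space M) (null_sets M \<union> X) \<subseteq> sets M"
    using X by (intro sets.sigma_sets_subset) auto
  then show ?thesis
    by (auto simp: subfield_def subalgebra_def sets_generated_field)
qed

lemma generated_field_subset:
  assumes "subfield M G" "X \<subseteq> sets G"
  shows "sets (generated_field M X) \<subseteq> sets G"
  unfolding sets_generated_field
  using assms subfield_null_sets[OF assms(1)] subfield_space[OF assms(1)]
  by (metis Un_least sets.sigma_sets_subset)

end

lemma generated_field_mono:
  assumes "X \<subseteq> Y" "Y \<subseteq> sets M"
  shows "sets (generated_field M X) \<subseteq> sets (generated_field M Y)"
  using assms generated_field_upper[of Y M]
  by (intro generated_field_subset subfield_generated_field) auto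

context continuous_factorization
begin

section \<open>Monotonicity and independence of the interval fields\<close>

lemma F_sets: "s \<le> t \<Longrightarrow> sets (F s t) \<subseteq> sets M"
  using subfield_F subfield_sets by blast

lemma F_indep: "r \<le> s \<Longrightarrow> s \<le> t \<Longrightarrow> indep_set (sets (F r s)) (sets (F s t))"
  using factorization[of r s t] by (simp only: is_tensor_product_def)

lemma F_gen: "r \<le> s \<Longrightarrow> s \<le> t \<Longrightarrow> sets (F r t) = sets (generated_field M (sets (F r s) \<union> sets (F s t)))"
  using factorization[of r s t] by (simp only: is_tensor_product_def)

lemma F_mono:
  assumes "r \<le> s" "s \<le> t" "t \<le> u"
  shows "sets (F s t) \<subseteq> sets (F r u)"
proof -
  have "sets (F s t) \<subseteq> sets (F r t)"
    using assms F_gen[of r s t] generated_field_upper[of "sets (F r s) \<union> sets (F s t)" M] F_sets by auto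
  also have "\<dots> \<subseteq> sets (F r u)"
    using assms F_gen[of r t u] generated_field_upper[of "sets (F r t) \<union> sets (F t u)" M] F_sets by auto
  finally show ?thesis .
qed

text \<open>An intersection-stable generator that treats finite and infinite end points alike: inner
  continuity and exhaustion say that it generates, and the strict inequalities leave room between an
  event and the end points.\<close>

definition inner_events :: "ereal \<Rightarrow> ereal \<Rightarrow> 'a set set" where
  "inner_events r t = (\<Union>(a, b)\<in>{(a, b). a \<le> b \<and> r < ereal a \<and> ereal b < t}. sets (F a b))"

lemma inner_eventsI: "a \<le> b \<Longrightarrow> r < ereal a \<Longrightarrow> ereal b < t \<Longrightarrow> A \<in> sets (F a b) \<Longrightarrow> A \<in> inner_events r t"
  unfolding inner_events_def by auto

lemma inner_eventsE:
  assumes "A \<in> inner_events r t"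
  obtains a b where "a < b" "r < ereal a" "ereal b < t" "A \<in> sets (F a b)"
proof -
  obtain a b where ab: "a \<le> b" "r < ereal a" "ereal b < t" "A \<in> sets (F a b)"
    using assms unfolding inner_events_def by auto
  \<comment> \<open>A degenerate interval \<open>a = b\<close> is widened to the left, which is
    possible because \<open>r\<close> lies strictly below \<open>a\<close>.\<close>
  obtain a' where a': "r < ereal a'" "ereal a' < ereal a" using ereal_dense2[OF ab(2)] by auto
  then show ?thesis
    using F_mono[of a' a b b] ab by (intro that[of a' b]) auto
qed

lemma inner_events_sets: "inner_events r t \<subseteq> sets M"
  using F_sets unfolding inner_events_def by auto

lemma Int_stable_inner_events: "Int_stable (inner_events r t)"
proof (rule Int_stableI)
  fix A A' assume A: "A \<in> inner_events r t" "A' \<in> inner_events r t"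
  obtain a b where 1: "a < b" "r < ereal a" "ereal b < t" "A \<in> sets (F a b)"
    by (rule inner_eventsE[OF A(1)])
  obtain a' b' where 2: "a' < b'" "r < ereal a'" "ereal b' < t" "A' \<in> sets (F a' b')"
    by (rule inner_eventsE[OF A(2)])
  note * = 1 2
  let ?a = "min a a'" and ?b = "max b b'"
  have "A \<in> sets (F ?a ?b)" "A' \<in> sets (F ?a ?b)"
    using * F_mono[of ?a a b ?b] F_mono[of ?a a' b' ?b] by (auto simp: subset_iff)
  then show "A \<inter> A' \<in> inner_events r t"
    using * by (intro inner_eventsI[of ?a ?b]) (auto simp: min_def max_def)
qed

lemma inner_events_null_sets:
  assumes "r < t"
  shows "null_sets M \<subseteq> inner_events r t"
proof -
  obtain a where "r < ereal a" "ereal a < t" using ereal_dense2[OF assms] by auto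
  then show ?thesis
    using subfield_null_sets[OF subfield_F[of a a]] by (auto intro!: inner_eventsI[of a a])
qed

lemma inner_events_mono: "r' \<le> r \<Longrightarrow> t \<le> t' \<Longrightarrow> inner_events r t \<subseteq> inner_events r' t'"
  unfolding inner_events_def by (fastforce intro: le_less_trans less_le_trans)

lemma sigma_inner_events:
  assumes "r < t"
  shows "sets (generated_field M (inner_events r t)) = sigma_sets (space M) (inner_events r t)"
  using inner_events_null_sets[OF assms] by (simp add: sets_generated_field inner_events_sets Un_absorb1)

lemma F_inner:
  assumes "s < t"
  shows "sets (F s t) = sets (generated_field M (inner_events s t))"
proof
  let ?X = "\<Union>e\<in>{e. 0 < e \<and> s + e \<le> t - e}. sets (F (s + e) (t - e))"
  have "?X \<subseteq> inner_events s t"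
  proof clarify
    fix e A assume "0 < e" "s + e \<le> t - e" "A \<in> sets (F (s + e) (t - e))"
    then show "A \<in> inner_events (ereal s) (ereal t)"
      by (intro inner_eventsI[of "s + e" "t - e"]) auto
  qed
  then show "sets (F s t) \<subseteq> sets (generated_field M (inner_events s t))"
    unfolding inner_continuity[OF assms] by (intro generated_field_mono inner_events_sets)
  show "sets (generated_field M (inner_events s t)) \<subseteq> sets (F s t)"
    using assms by (intro generated_field_subset inner_events_sets subfield_F)
      (auto elim!: inner_eventsE dest!: F_mono[of s _ _ t, THEN subsetD, rotated 3])
qed

text \<open>This unites the four cases of \<open>extended_field\<close>. On a half-line the finite
  end point belongs to the generating intervals, and inner continuity pushes them inside. The last
  condition of \<open>incl\<close> excludes the degenerate field located at \<open>s\<close> itself,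
  which has no interior to be pushed into.\<close>

lemma extended_field_eq:
  assumes "s < t"
  shows "sets (extended_field M F s t) = sets (generated_field M (inner_events s t))"
proof -
  have incl: "sets (F a b) \<subseteq> sets (generated_field M (inner_events s t))"
    if "a \<le> b" "s \<le> ereal a" "ereal b \<le> t" "a < b \<or> s < ereal a" for a b
  proof (cases "a < b")
    case True
    then show ?thesis
      unfolding F_inner[OF True] using that
      by (intro generated_field_mono inner_events_mono inner_events_sets) auto
  next
    case False
    with that obtain a' where a': "s < ereal a'" "a' < a" "a = b"
      using ereal_dense2[of s a] by auto
    have "sets (F a b) \<subseteq> sets (F a' b)" using F_mono[of a' a b b] a' by auto
    also have "\<dots> \<subseteq> sets (generated_field M (inner_events s t))"
      unfolding F_inner[OF a'(2)[unfolded a'(3)]] using that a'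
      by (intro generated_field_mono inner_events_mono inner_events_sets) auto
    finally show ?thesis .
  qed
  consider "s = -\<infinity>" "t = \<infinity>" | b where "s = -\<infinity>" "t = ereal b" | a where "s = ereal a" "t = \<infinity>"
    | a b where "s = ereal a" "t = ereal b" "a < b"
    using assms by (cases s; cases t) auto
  then show ?thesis
  proof cases
    case 1
    let ?X = "\<Union>n::nat. sets (F (- real n) (real n))"
    have X: "?X \<subseteq> inner_events s t"
    proof clarify
      fix A and n :: nat assume "A \<in> sets (F (- real n) (real n))"
      then show "A \<in> inner_events s t" using 1 by (intro inner_eventsI[of "- real n" "real n"]) auto
    qed
    have "sets M \<subseteq> sets (generated_field M (inner_events s t))"
      unfolding exhaustion by (intro generated_field_mono X inner_events_sets)
    moreover have "sets (generated_field M (inner_events s t)) \<subseteq> sets M"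
      by (intro subfield_sets subfield_generated_field inner_events_sets)
    ultimately show ?thesis using 1 by (simp add: extended_field_def)
  next
    case 2
    let ?X = "\<Union>r\<in>{..b}. sets (F r b)"
    have X: "?X \<subseteq> sets M" using F_sets by auto
    have "sets (generated_field M ?X) = sets (generated_field M (inner_events s t))"
    proof (intro subset_antisym generated_field_subset X subfield_generated_field inner_events_sets)
      show "?X \<subseteq> sets (generated_field M (inner_events s t))"
        using incl[of _ b] 2 by auto
      have "inner_events s t \<subseteq> ?X"
      proof
        fix A assume "A \<in> inner_events s t"
        then obtain a' b' where "a' < b'" "ereal b' < t" "A \<in> sets (F a' b')" by (elim inner_eventsE)
        then have "a' \<le> b" "A \<in> sets (F a' b)" using 2 F_mono[of a' a' b' b] by auto
        then show "A \<in> ?X" by auto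
      qed
      then show "inner_events s t \<subseteq> sets (generated_field M ?X)"
        using generated_field_upper[OF X] by auto
    qed
    then show ?thesis using 2 by (simp add: extended_field_def)
  next
    case 3
    let ?X = "\<Union>r\<in>{a..}. sets (F a r)"
    have X: "?X \<subseteq> sets M" using F_sets by auto
    have "sets (generated_field M ?X) = sets (generated_field M (inner_events s t))"
    proof (intro subset_antisym generated_field_subset X subfield_generated_field inner_events_sets)
      \<comment> \<open>For \<open>r = a\<close> the field sits at the end point; enlarging the
        interval to \<open>r + 1\<close> brings it into the scope of \<open>incl\<close>.\<close>
      have "sets (F a r) \<subseteq> sets (generated_field M (inner_events s t))" if "a \<le> r" for r
        using incl[of a "r + 1"] 3 that F_mono[of a a r "r + 1"] by auto
      then show "?X \<subseteq> sets (generated_field M (inner_events s t))" by auto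
      have "inner_events s t \<subseteq> ?X"
      proof
        fix A assume "A \<in> inner_events s t"
        then obtain a' b' where "a' < b'" "s < ereal a'" "A \<in> sets (F a' b')" by (elim inner_eventsE)
        then have "a \<le> b'" "A \<in> sets (F a b')" using 3 F_mono[of a a' b' b'] by auto
        then show "A \<in> ?X" by auto
      qed
      then show "inner_events s t \<subseteq> sets (generated_field M ?X)"
        using generated_field_upper[OF X] by auto
    qed
    then show ?thesis using 3 by (simp add: extended_field_def)
  next
    case 4
    then show ?thesis using F_inner by (simp add: extended_field_def)
  qed
qed

lemma extended_field_F: "a < b \<Longrightarrow> extended_field M F (ereal a) (ereal b) = F a b"
  by (simp add: extended_field_def)

lemma sets_extended_field: "s < t \<Longrightarrow> sets (extended_field M F s t) = sigma_sets (space M) (inner_events s t)"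
  by (simp add: extended_field_eq sigma_inner_events)

lemma extended_field_sets: "s < t \<Longrightarrow> sets (extended_field M F s t) \<subseteq> sets M"
  by (simp add: extended_field_eq subfield_generated_field inner_events_sets subfield_sets)

lemma extended_field_mono:
  assumes "r \<le> s" "s < t" "t \<le> u"
  shows "sets (extended_field M F s t) \<subseteq> sets (extended_field M F r u)"
  using assms by (simp add: extended_field_eq generated_field_mono inner_events_mono inner_events_sets)

text \<open>Two inner events leave a cutting point between them even when \<open>s = s'\<close>, so
  the product rule follows from the factorization there. It then passes from intersection-stable
  generators to the generated fields.\<close>

lemma extended_field_indep:
  assumes "r < s" "s \<le> s'" "s' < t"
  shows "indep_set (sets (extended_field M F r s)) (sets (extended_field M F s' t))"
proof -
  have "indep_set (inner_events r s) (inner_events s' t)"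
  proof (rule indep_setI)
    fix A A' assume A: "A \<in> inner_events r s" "A' \<in> inner_events s' t"
    obtain a b where 1: "a < b" "r < ereal a" "ereal b < s" "A \<in> sets (F a b)"
      by (rule inner_eventsE[OF A(1)])
    obtain a' b' where 2: "a' < b'" "s' < ereal a'" "ereal b' < t" "A' \<in> sets (F a' b')"
      by (rule inner_eventsE[OF A(2)])
    note * = 1 2
    have "ereal b < s'" using 1(3) assms(2) by (rule less_le_trans)
    then have "ereal b < ereal a'" using 2(2) by (rule less_trans)
    then have "A' \<in> sets (F b b')" using * F_mono[of b a' b' b'] by auto
    then show "prob (A \<inter> A') = prob A * prob A'"
      using indep_setD[OF F_indep[of a b b']] * \<open>ereal b < ereal a'\<close> by auto
  qed (rule inner_events_sets)+
  then show ?thesis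
    using assms by (simp add: sets_extended_field indep_set_sigma_sets Int_stable_inner_events)
qed

lemma extended_field_split:
  assumes "r < s" "s < t"
  shows "sets (extended_field M F r t) \<subseteq>
    sets (generated_field M (sets (extended_field M F r s) \<union> sets (extended_field M F s t)))"
    (is "_ \<subseteq> sets (generated_field M ?X)")
proof -
  have X: "?X \<subseteq> sets M" using assms extended_field_sets by auto
  have rt: "r < t" using assms by simp
  obtain c where c: "s = ereal c" using assms by (cases s) auto
  have "inner_events r t \<subseteq> sets (generated_field M ?X)"
  proof
    fix A assume "A \<in> inner_events r t"
    then obtain a b where ab: "a < b" "r < ereal a" "ereal b < t" "A \<in> sets (F a b)"
      by (elim inner_eventsE)
    \<comment> \<open>The interval is widened until it contains \<open>c\<close>, where it can be
      factorized.\<close>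
    obtain a' where a': "r < ereal a'" "a' < min a c" using ereal_dense2[of r "min (ereal a) (ereal c)"] ab assms c by auto
    obtain b' where b': "ereal b' < t" "max b c < b'" using ereal_dense2[of "max (ereal b) (ereal c)" t] ab assms c by auto
    have "A \<in> sets (F a' b')" using ab a' b' F_mono[of a' a b b'] by auto
    also have "sets (F a' b') = sets (generated_field M (sets (F a' c) \<union> sets (F c b')))"
      using a' b' by (intro F_gen) auto
    also have "\<dots> \<subseteq> sets (generated_field M ?X)"
    proof (intro generated_field_mono X Un_mono)
      show "sets (F a' c) \<subseteq> sets (extended_field M F r s)"
        using extended_field_mono[of r a' c s] a' c by (simp add: extended_field_F)
      show "sets (F c b') \<subseteq> sets (extended_field M F s t)"
        using extended_field_mono[of s c b' t] b' c by (simp add: extended_field_F)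
    qed
    finally show "A \<in> sets (generated_field M ?X)" .
  qed
  then show ?thesis
    unfolding extended_field_eq[OF rt]
    by (intro generated_field_subset inner_events_sets subfield_generated_field X)
qed

end

section \<open>The fields of subsets of the line\<close>

definition gaps :: "ereal set \<Rightarrow> ereal \<Rightarrow> ereal \<Rightarrow> (ereal \<times> ereal) set" where
  "gaps D s t = {(a, b). s \<le> a \<and> a < b \<and> b \<le> t \<and> D \<inter> {a<..<b} = {}}"

definition cells :: "ereal set \<Rightarrow> (ereal \<times> ereal) set" where
  "cells C = {(a, b). a \<in> C \<and> b \<in> C \<and> a < b \<and> C \<inter> {a<..<b} = {}}"

lemma finite_cells: "finite C \<Longrightarrow> finite (cells C)"
  by (rule finite_subset[of _ "C \<times> C"]) (auto simp: cells_def)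

lemma gap_in_cell:
  assumes C: "finite C" "-\<infinity> \<in> C" "\<infinity> \<in> C" and ab: "a < b" "C \<inter> {a<..<b} = {}"
  obtains a' b' where "(a', b') \<in> cells C" "a' \<le> a" "b \<le> b'"
proof -
  let ?a = "Max {c \<in> C. c \<le> a}" and ?b = "Min {c \<in> C. b \<le> c}"
  have a: "?a \<in> {c \<in> C. c \<le> a}" using C by (intro Max_in) auto
  have b: "?b \<in> {c \<in> C. b \<le> c}" using C by (intro Min_in) auto
  have "C \<inter> {?a<..<?b} = {}"
  proof (rule ccontr)
    assume "C \<inter> {?a<..<?b} \<noteq> {}"
    then obtain c where c: "c \<in> C" "?a < c" "c < ?b" by auto
    have "\<not> c \<le> a"
    proof
      assume "c \<le> a"
      then have "c \<le> ?a" using C c(1) by (intro Max_ge) auto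
      then show False using c(2) by simp
    qed
    moreover have "\<not> b \<le> c"
    proof
      assume "b \<le> c"
      then have "?b \<le> c" using C c(1) by (intro Min_le) auto
      then show False using c(3) by simp
    qed
    ultimately have "c \<in> C \<inter> {a<..<b}" using c(1) by (simp add: not_le)
    then show False using ab(2) by blast
  qed
  moreover have "?a < ?b" using a b ab by (auto intro: order.strict_trans1 order.strict_trans2)
  ultimately show ?thesis using a b that[of ?a ?b] by (auto simp: cells_def)
qed

lemma cells_disjoint:
  assumes "(a, b) \<in> cells C" "(a', b') \<in> cells C" "a < a'"
  shows "b \<le> a'"
  using assms by (auto simp: cells_def not_less[symmetric])

lemma cells_inj_fst:
  assumes "(a, b) \<in> cells C" "(a, b') \<in> cells C"
  shows "b = b'"
  using assms by (auto simp: cells_def) (metis disjoint_iff greaterThanLessThan_iff linorder_neqE)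

lemma open_interval_frontier_cases:
  assumes "open_interval p \<inter> frontier E = {}"
  shows "open_interval p \<subseteq> E \<or> open_interval p \<inter> E = {}"
  using connected_Int_frontier[OF connected_open_interval, of p E] assms by blast

context continuous_factorization
begin

text \<open>Using all open intervals inside \<open>E\<close> instead of a chosen decomposition makes
  the field defined and monotone for arbitrary sets. Agreement with \<open>elementary_field\<close>,
  for every decomposition, is \<open>elementary_field_eq_region_field\<close>.\<close>

definition region_field :: "real set \<Rightarrow> 'a measure" where
  "region_field E = generated_field M
    (\<Union>(s, t)\<in>{(s, t). s < t \<and> open_interval (s, t) \<subseteq> E}. sets (extended_field M F s t))"

lemma UN_extended_field_sets:
  assumes "\<And>s t. (s, t) \<in> I \<Longrightarrow> s < t"
  shows "(\<Union>(s, t)\<in>I. sets (extended_field M F s t)) \<subseteq> sets M"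
  using assms extended_field_sets by blast

lemma subfield_region_field: "subfield M (region_field E)"
  unfolding region_field_def by (intro subfield_generated_field UN_extended_field_sets) auto

lemma subalgebra_region_field: "subalgebra M (region_field E)"
  by (rule subfield_subalgebra[OF subfield_region_field])

lemma region_field_sets: "sets (region_field E) \<subseteq> sets M"
  by (rule subfield_sets[OF subfield_region_field])

lemma space_region_field [simp]: "space (region_field E) = space M"
  by (rule subfield_space[OF subfield_region_field])

lemma extended_field_region_field:
  assumes "s < t" "open_interval (s, t) \<subseteq> E"
  shows "sets (extended_field M F s t) \<subseteq> sets (region_field E)"
proof -
  have "sets (extended_field M F s t) \<subseteq>
      (\<Union>(s, t)\<in>{(s, t). s < t \<and> open_interval (s, t) \<subseteq> E}. sets (extended_field M F s t))"
    using assms by auto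
  also have "\<dots> \<subseteq> sets (region_field E)"
    unfolding region_field_def by (intro generated_field_upper UN_extended_field_sets) auto
  finally show ?thesis .
qed

lemma region_field_subsetI:
  assumes "subfield M G"
    and "\<And>s t. s < t \<Longrightarrow> open_interval (s, t) \<subseteq> E \<Longrightarrow> sets (extended_field M F s t) \<subseteq> sets G"
  shows "sets (region_field E) \<subseteq> sets G"
  unfolding region_field_def using assms
  by (intro generated_field_subset UN_extended_field_sets) auto

lemma region_field_mono: "E \<subseteq> E' \<Longrightarrow> sets (region_field E) \<subseteq> sets (region_field E')"
  by (intro region_field_subsetI subfield_region_field extended_field_region_field) auto

lemma region_field_eqI:
  assumes "sets (region_field E) = sets (region_field E')"
  shows "region_field E = region_field E'"
  using assms unfolding region_field_def by (rule generated_field_eqI)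

lemma sets_region_field_UNIV: "sets (region_field UNIV) = sets M"
  using extended_field_region_field[of "-\<infinity>" "\<infinity>" UNIV] region_field_sets
  by (auto simp: extended_field_def)

text \<open>A point of \<open>D\<close> inside the interval cuts it in two, by
  \<open>extended_field_split\<close>, and both halves contain fewer points of
  \<open>D\<close>.\<close>

lemma extended_field_gaps:
  assumes "finite D" "s < t"
  shows "sets (extended_field M F s t) \<subseteq>
    sets (generated_field M (\<Union>(a, b)\<in>gaps D s t. sets (extended_field M F a b)))"
  using assms(2)
proof (induction "card (D \<inter> {s<..<t})" arbitrary: s t rule: less_induct)
  case less
  let ?X = "\<lambda>s t. \<Union>(a, b)\<in>gaps D s t. sets (extended_field M F a b)"
  have X: "?X s t \<subseteq> sets M" for s t
    by (intro UN_extended_field_sets) (auto simp: gaps_def)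
  show ?case
  proof (cases "D \<inter> {s<..<t} = {}")
    case True
    then have "(s, t) \<in> gaps D s t" using less.prems by (simp add: gaps_def)
    then have "sets (extended_field M F s t) \<subseteq> ?X s t" by blast
    then show ?thesis using generated_field_upper[OF X] by (rule order_trans)
  next
    case False
    then obtain d where d: "d \<in> D" "s < d" "d < t" by auto
    have "card (D \<inter> {s<..<d}) < card (D \<inter> {s<..<t})" "card (D \<inter> {d<..<t}) < card (D \<inter> {s<..<t})"
      using d assms(1) by (auto intro!: psubset_card_mono)
    then have IH: "sets (extended_field M F s d) \<subseteq> sets (generated_field M (?X s d))"
      "sets (extended_field M F d t) \<subseteq> sets (generated_field M (?X d t))"
      using less.hyps d by auto
    have "gaps D s d \<subseteq> gaps D s t" "gaps D d t \<subseteq> gaps D s t"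
      using d by (auto simp: gaps_def)
    then have sub: "?X s d \<subseteq> ?X s t" "?X d t \<subseteq> ?X s t" by blast+
    have "sets (generated_field M (?X s d)) \<subseteq> sets (generated_field M (?X s t))"
      "sets (generated_field M (?X d t)) \<subseteq> sets (generated_field M (?X s t))"
      using sub by (intro generated_field_mono X; simp)+
    then have "sets (generated_field M (sets (extended_field M F s d) \<union> sets (extended_field M F d t))) \<subseteq>
        sets (generated_field M (?X s t))"
      using IH d extended_field_sets by (intro generated_field_subset subfield_generated_field X) auto
    then show ?thesis
      by (rule order_trans[OF extended_field_split[OF d(2,3)]])
  qed
qed

text \<open>Inclusions need only be tested on intervals missing a finite set. With \<open>D\<close>
  a set of removed points this shows that finite sets do not matter; with \<open>D\<close> a
  frontier it makes every interval lie inside or outside the set in question.\<close>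

lemma region_field_subset_gapsI:
  assumes "finite D" "subfield M G"
    and "\<And>a b. a < b \<Longrightarrow> open_interval (a, b) \<subseteq> E \<Longrightarrow> open_interval (a, b) \<inter> D = {} \<Longrightarrow>
      sets (extended_field M F a b) \<subseteq> sets G"
  shows "sets (region_field E) \<subseteq> sets G"
proof (rule region_field_subsetI[OF assms(2)])
  fix s t assume st: "s < t" "open_interval (s, t) \<subseteq> E"
  have "sets (extended_field M F s t) \<subseteq>
    sets (generated_field M (\<Union>(a, b)\<in>gaps (ereal ` D) s t. sets (extended_field M F a b)))"
    using assms(1) st by (intro extended_field_gaps) auto
  also have "\<dots> \<subseteq> sets G"
  proof (intro generated_field_subset assms(2) UN_extended_field_sets)
    show "(\<Union>(a, b)\<in>gaps (ereal ` D) s t. sets (extended_field M F a b)) \<subseteq> sets G"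
    proof clarify
      fix a b A assume ab: "(a, b) \<in> gaps (ereal ` D) s t" "A \<in> sets (extended_field M F a b)"
      have "open_interval (a, b) \<subseteq> open_interval (s, t)"
        using ab(1) by (subst open_interval_subset_iff) (auto simp: gaps_def)
      then have "open_interval (a, b) \<subseteq> E" using st(2) by simp
      moreover have "open_interval (a, b) \<inter> D = {}" "a < b"
        using ab(1) by (auto simp: gaps_def)
      ultimately show "A \<in> sets G" using assms(3)[of a b] ab(2) by blast
    qed
  qed (auto simp: gaps_def)
  finally show "sets (extended_field M F s t) \<subseteq> sets G" .
qed

lemma region_field_Diff_finite:
  assumes "finite D"
  shows "region_field (E - D) = region_field E"
proof (rule region_field_eqI, rule subset_antisym)
  show "sets (region_field E) \<subseteq> sets (region_field (E - D))"
    using assms by (rule region_field_subset_gapsI)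
      (auto intro!: subfield_region_field extended_field_region_field[THEN subsetD])
qed (intro region_field_mono Diff_subset)

lemma region_field_cong_finite:
  assumes "finite (sym_diff E E')"
  shows "region_field E = region_field E'"
proof -
  have "E - (E - E') = E' - (E' - E)" by auto
  then show ?thesis
    using region_field_Diff_finite[of "E - E'" E] region_field_Diff_finite[of "E' - E" E'] assms by simp
qed

lemma region_field_Un:
  assumes "finite (frontier E)"
  shows "sets (region_field (E \<union> E')) =
    sets (generated_field M (sets (region_field E) \<union> sets (region_field E')))" (is "_ = sets ?G")
proof
  have X: "sets (region_field E) \<union> sets (region_field E') \<subseteq> sets M"
    using region_field_sets by auto
  note G = subfield_generated_field[OF X]
  show "sets (region_field (E \<union> E')) \<subseteq> sets ?G"
  proof (rule region_field_subset_gapsI[OF assms G])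
    fix a b assume ab: "a < b" "open_interval (a, b) \<subseteq> E \<union> E'" "open_interval (a, b) \<inter> frontier E = {}"
    then have "open_interval (a, b) \<subseteq> E \<or> open_interval (a, b) \<subseteq> E'"
      using open_interval_frontier_cases by blast
    then have "sets (extended_field M F a b) \<subseteq> sets (region_field E) \<union> sets (region_field E')"
      using extended_field_region_field[OF ab(1)] by blast
    then show "sets (extended_field M F a b) \<subseteq> sets ?G"
      using generated_field_upper[OF X] by blast
  qed
  show "sets ?G \<subseteq> sets (region_field (E \<union> E'))"
    using region_field_mono[of E "E \<union> E'"] region_field_mono[of E' "E \<union> E'"]
    by (intro generated_field_subset[OF X] subfield_region_field) auto
qed

text \<open>By connectedness an open interval inside the disjoint union lies in a single member of
  \<open>I\<close>, so the many generators of \<open>region_field\<close> contribute nothing beyond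
  the members themselves.\<close>

lemma elementary_field_eq_region_field:
  assumes "decomposes_into E I"
  shows "elementary_field M F I = region_field E"
proof -
  let ?U = "\<Union>(open_interval ` I)"
  have I: "\<And>s t. (s, t) \<in> I \<Longrightarrow> s < t" and disj: "disjoint_family_on open_interval I"
    using assms by (auto simp: decomposes_into_def)
  have X: "(\<Union>(s, t)\<in>I. sets (extended_field M F s t)) \<subseteq> sets M"
    using I by (rule UN_extended_field_sets)
  have "sets (region_field ?U) = sets (elementary_field M F I)"
    unfolding elementary_field_def
  proof (intro subset_antisym region_field_subsetI generated_field_subset subfield_generated_field X subfield_region_field)
    fix s t assume st: "s < t" "open_interval (s, t) \<subseteq> ?U"
    then have "open_interval (s, t) \<noteq> {}" by (auto simp: open_interval_eq_empty_iff)
    then obtain x p where x: "x \<in> open_interval (s, t)" "x \<in> open_interval p" "p \<in> I"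
      using st(2) by blast
    let ?V = "\<Union>q\<in>I - {p}. open_interval q"
    have "open_interval p \<inter> ?V = {}"
      using disj x(3) by (auto simp: disjoint_family_on_def)
    then have "open_interval p \<inter> open_interval (s, t) = {} \<or> ?V \<inter> open_interval (s, t) = {}"
      using connected_open_interval[of "(s, t)"] st(2) x(3)
      by (intro connectedD) (auto intro!: open_open_interval)
    then have "open_interval (s, t) \<subseteq> open_interval p"
      using x st(2) by blast
    moreover obtain a b where p: "p = (a, b)" by force
    ultimately have "a \<le> s" "t \<le> b" using open_interval_subset_iff[OF st(1)] by auto
    then have "sets (extended_field M F s t) \<subseteq> sets (extended_field M F a b)"
      using st(1) by (intro extended_field_mono)
    then have "sets (extended_field M F s t) \<subseteq> (\<Union>(s, t)\<in>I. sets (extended_field M F s t))"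
      using x(3) p by blast
    then show "sets (extended_field M F s t) \<subseteq>
        sets (generated_field M (\<Union>(s, t)\<in>I. sets (extended_field M F s t)))"
      using generated_field_upper[OF X] by blast
  next
    show "(\<Union>(s, t)\<in>I. sets (extended_field M F s t)) \<subseteq> sets (region_field ?U)"
      using I by (auto intro!: extended_field_region_field[THEN subsetD])
  qed
  then have "elementary_field M F I = region_field ?U"
    unfolding elementary_field_def region_field_def by (intro generated_field_eqI) simp
  also have "\<dots> = region_field E"
    using assms by (intro region_field_cong_finite[symmetric]) (simp add: decomposes_into_def)
  finally show ?thesis .
qed

subsection \<open>Independence\<close>

text \<open>Mutual independence is built up in the order of the left end points: everything decided
  by the earlier cells belongs to the field of the half-line ending where the next cell
  begins.\<close>

lemma indep_cells: "indep_sets (\<lambda>(a, b). sets (extended_field M F a b)) (cells C)"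
proof (rule indep_setsI)
  fix p assume "p \<in> cells C"
  then show "(case p of (a, b) \<Rightarrow> sets (extended_field M F a b)) \<subseteq> events"
    using extended_field_sets by (auto simp: cells_def)
next
  fix A J assume "J \<noteq> {}" "J \<subseteq> cells C" "finite J"
    and "\<forall>p\<in>J. A p \<in> (case p of (a, b) \<Rightarrow> sets (extended_field M F a b))"
  then have A: "\<And>p. p \<in> J \<Longrightarrow> A p \<in> sets (extended_field M F (fst p) (snd p))" by auto
  from \<open>finite J\<close> \<open>J \<noteq> {}\<close> \<open>J \<subseteq> cells C\<close> A show "prob (\<Inter>p\<in>J. A p) = (\<Prod>p\<in>J. prob (A p))"
  proof (induction J rule: finite_ranking_induct[where f=fst])
    case (insert p J)
    show ?case
    \<comment> \<open>The ranking induction does not exclude that \<open>p\<close> already belongs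
      to \<open>J\<close>.\<close>
    proof (cases "J = {} \<or> p \<in> J")
      case True
      then show ?thesis
      proof
        assume "p \<in> J"
        then have "insert p J = J" "J \<noteq> {}" by auto
        then show ?thesis using insert.IH insert.prems by simp
      qed simp
    next
      case False
      obtain a b where p: "p = (a, b)" by force
      have ab: "a < b" using insert.prems p by (auto simp: cells_def)
      have *: "fst q < snd q \<and> snd q \<le> a" if q: "q \<in> J" for q
      proof -
        obtain a' b' where q': "q = (a', b')" by force
        have "(a', b') \<in> cells C" "(a, b) \<in> cells C" using insert.prems q p q' by auto
        moreover have "a' \<noteq> a" using cells_inj_fst calculation q q' p False by blast
        moreover have "a' \<le> a" using insert.hyps(2)[OF q] p q' by simp
        ultimately have "b' \<le> a" by (intro cells_disjoint) auto
        then show ?thesis using \<open>(a', b') \<in> cells C\<close> q' by (auto simp: cells_def)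
      qed
      obtain q where "q \<in> J" using False by auto
      \<comment> \<open>An earlier cell lies to the left of \<open>a\<close>, so the half-line
        ending at \<open>a\<close> is nonempty.\<close>
      then have a: "-\<infinity> < a" using *[of q] by (cases a; cases "fst q"; cases "snd q") auto
      have "A q \<in> sets (extended_field M F (-\<infinity>) a)" if "q \<in> J" for q
        using *[OF that] insert.prems(3)[of q] that
          extended_field_mono[of "-\<infinity>" "fst q" "snd q" a] by auto
      then have "(\<Inter>q\<in>J. A q) \<in> sets (extended_field M F (-\<infinity>) a)"
        using insert.hyps(1) False by (intro sets.finite_INT) auto
      then have "prob ((\<Inter>q\<in>J. A q) \<inter> A p) = prob (\<Inter>q\<in>J. A q) * prob (A p)"
        using insert.prems(3)[of p] p ab a
        by (intro indep_setD[OF extended_field_indep[of "-\<infinity>" a a b]]) auto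
      moreover have "prob (\<Inter>q\<in>J. A q) = (\<Prod>q\<in>J. prob (A q))"
        using insert.prems False by (intro insert.IH) auto
      ultimately show ?thesis
        using insert.hyps(1) False by (simp add: Int_commute mult.commute)
    qed
  qed simp
qed

text \<open>For a region that contains no cell, the generators reduce to the null sets. Independence
  then comes from this zero-one property.\<close>

lemma null_sets_field_prob:
  assumes "A \<in> sigma_sets (space M) (null_sets M)"
  shows "prob A = 0 \<or> prob A = 1"
proof -
  have "A \<in> sets M \<and> (prob A = 0 \<or> prob A = 1)"
    using assms
  proof induction
    case (Basic A)
    then show ?case by (auto simp: null_sets_def measure_def)
  next
    case (Compl A)
    then show ?case by (auto simp: prob_compl)
  next
    case (Union A)
    then have [measurable]: "\<And>i. A i \<in> sets M" by auto
    show ?case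
    proof (cases "\<exists>i. prob (A i) = 1")
      case True
      then obtain i where "prob (A i) = 1" ..
      then have "prob (\<Union>i. A i) \<ge> 1" using finite_measure_mono[of "A i" "\<Union>i. A i"] by auto
      moreover have "prob (\<Union>i. A i) \<le> 1" by (rule prob_le_1)
      ultimately have "prob (\<Union>i. A i) = 1" by (rule antisym[rotated])
      then show ?thesis by auto
    next
      case False
      then have "\<And>i. A i \<in> null_sets M" using Union by (auto simp: null_sets_def emeasure_eq_measure)
      then have "(\<Union>i. A i) \<in> null_sets M" by auto
      then show ?thesis by (auto simp: null_sets_def measure_def)
    qed
  qed auto
  then show ?thesis ..
qed

lemma prob_Int_trivial:
  assumes "prob A = 0 \<or> prob A = 1" "A \<in> events" "A' \<in> events"
  shows "prob (A \<inter> A') = prob A * prob A'"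
  using assms(1)
proof
  assume "prob A = 0"
  moreover have "prob (A \<inter> A') \<le> prob A" using assms by (intro finite_measure_mono) auto
  ultimately show ?thesis using measure_nonneg[of M "A \<inter> A'"] by (simp del: measure_nonneg)
next
  assume 1: "prob A = 1"
  then have "prob (A' - A) \<le> 0"
    using finite_measure_mono[of "A' - A" "space M - A"] prob_compl[of A] assms sets.sets_into_space[of A' M] by auto
  then have "prob (A' - A) = 0" using measure_nonneg[of M "A' - A"] by linarith
  then show ?thesis using finite_measure_Diff'[of A' A] assms 1 by (simp add: Int_commute)
qed

text \<open>The line is cut at both frontiers. Every resulting cell lies inside or outside each of
  the two sets, and no cell lies in both; so the fields come from disjoint groups of independent
  cells.\<close>

lemma indep_region_field:
  assumes "finite (frontier E)" "finite (frontier E')" "E \<inter> E' = {}"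
  shows "indep_set (sets (region_field E)) (sets (region_field E'))"
proof -
  define C where "C = {-\<infinity>, \<infinity>} \<union> ereal ` (frontier E \<union> frontier E')"
  have C: "finite C" "-\<infinity> \<in> C" "\<infinity> \<in> C" using assms by (auto simp: C_def)
  define K where "K E = {p \<in> cells C. open_interval p \<subseteq> E}" for E
  have Ksub: "(\<Union>(a, b)\<in>K E. sets (extended_field M F a b)) \<subseteq> sets M" for E
    by (intro UN_extended_field_sets) (auto simp: K_def cells_def)
  \<comment> \<open>Each cell field already contains the null sets, so these disappear from the
    generators as soon as there is a cell.\<close>
  have null: "null_sets M \<subseteq> (\<Union>(a, b)\<in>K E. sets (extended_field M F a b))" if "K E \<noteq> {}" for E
  proof -
    obtain a b where ab: "(a, b) \<in> K E" using \<open>K E \<noteq> {}\<close> by auto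
    then have "a < b" by (auto simp: K_def cells_def)
    then have "null_sets M \<subseteq> sets (extended_field M F a b)"
      by (simp add: extended_field_eq subfield_null_sets subfield_generated_field inner_events_sets)
    then show ?thesis using ab by blast
  qed
  have gen: "sets (region_field E'') \<subseteq>
      sigma_sets (space M) (null_sets M \<union> (\<Union>(a, b)\<in>K E''. sets (extended_field M F a b)))"
    if E'': "frontier E'' \<subseteq> frontier E \<union> frontier E'" for E''
    unfolding sets_generated_field[OF Ksub, symmetric]
  proof (rule region_field_subset_gapsI[of "frontier E \<union> frontier E'"])
    fix a b assume ab: "a < b" "open_interval (a, b) \<subseteq> E''"
      "open_interval (a, b) \<inter> (frontier E \<union> frontier E') = {}"
    have "C \<inter> {a<..<b} = {}" using ab(3) by (auto simp: C_def)
    then obtain a' b' where c: "(a', b') \<in> cells C" "a' \<le> a" "b \<le> b'"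
      using gap_in_cell[OF C ab(1)] by blast
    have "open_interval (a', b') \<inter> (frontier E \<union> frontier E') = {}"
      using c(1) by (fastforce simp: cells_def C_def)
    then have "open_interval (a', b') \<subseteq> E'' \<or> open_interval (a', b') \<inter> E'' = {}"
      using E'' by (intro open_interval_frontier_cases) blast
    moreover have "open_interval (a, b) \<noteq> {}" "open_interval (a, b) \<subseteq> open_interval (a', b')"
      using ab(1) c by (auto simp: open_interval_eq_empty_iff open_interval_subset_iff simp del: open_interval_mem)
    ultimately have "(a', b') \<in> K E''" using c(1) ab(2) by (auto simp: K_def simp del: open_interval_mem)
    moreover have "sets (extended_field M F a b) \<subseteq> sets (extended_field M F a' b')"
      using ab(1) c by (intro extended_field_mono)
    ultimately have "sets (extended_field M F a b) \<subseteq> (\<Union>(a, b)\<in>K E''. sets (extended_field M F a b))"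
      by blast
    then show "sets (extended_field M F a b) \<subseteq>
        sets (generated_field M (\<Union>(a, b)\<in>K E''. sets (extended_field M F a b)))"
      using generated_field_upper[OF Ksub] by blast
  qed (use assms subfield_generated_field[OF Ksub] in auto)
  show ?thesis
  proof (rule indep_setI)
    fix A A' assume A: "A \<in> sets (region_field E)" "A' \<in> sets (region_field E')"
    have ev: "A \<in> events" "A' \<in> events" using A region_field_sets by auto
    show "prob (A \<inter> A') = prob A * prob A'"
    proof (cases "K E = {} \<or> K E' = {}")
      case True
      then have "A \<in> sigma_sets (space M) (null_sets M) \<or> A' \<in> sigma_sets (space M) (null_sets M)"
        using gen[of E] gen[of E'] A by auto
      then show ?thesis
        using prob_Int_trivial[OF null_sets_field_prob ev]
          prob_Int_trivial[OF null_sets_field_prob ev(2,1)] by (auto simp: Int_commute)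
    next
      case False
      have "indep_sets (\<lambda>j. sigma_sets (space M) (\<Union>p\<in>K j. case p of (a, b) \<Rightarrow> sets (extended_field M F a b))) {E, E'}"
      proof (rule indep_sets_collect_sigma)
        show "indep_sets (\<lambda>(a, b). sets (extended_field M F a b)) (\<Union>j\<in>{E, E'}. K j)"
          by (rule indep_sets_mono_index[OF _ indep_cells[of C]]) (auto simp: K_def)
        show "Int_stable (case p of (a, b) \<Rightarrow> sets (extended_field M F a b))" for p
          by (auto split: prod.split intro!: Int_stableI)
        show "disjoint_family_on K {E, E'}"
        proof -
          have "K E \<inter> K E' = {}"
          proof (rule ccontr)
            assume "K E \<inter> K E' \<noteq> {}"
            then obtain a b where "(a, b) \<in> K E" "(a, b) \<in> K E'" by auto
            then have "open_interval (a, b) = {}" "a < b"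
              using assms(3) by (auto simp: K_def cells_def simp del: open_interval_mem)
            then show False by (simp add: open_interval_eq_empty_iff)
          qed
          then show ?thesis by (auto simp: disjoint_family_on_def)
        qed
      qed
      note ind = this
      have A': "A \<in> sigma_sets (space M) (\<Union>p\<in>K E. case p of (a, b) \<Rightarrow> sets (extended_field M F a b))"
        "A' \<in> sigma_sets (space M) (\<Union>p\<in>K E'. case p of (a, b) \<Rightarrow> sets (extended_field M F a b))"
        using A gen[of E] gen[of E'] null False by (auto simp: Un_absorb1)
      \<comment> \<open>The independence of the groups is indexed by \<open>{E, E'}\<close>, which
        must really have two elements. Two equal disjoint sets would be empty and contain no
        cell.\<close>
      have ne: "E \<noteq> E'" using False assms(3)
        by (auto simp: K_def cells_def open_interval_eq_empty_iff simp del: open_interval_mem)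
      have "prob (\<Inter>j\<in>{E, E'}. if j = E then A else A') = (\<Prod>j\<in>{E, E'}. prob (if j = E then A else A'))"
        using A' by (intro indep_setsD[OF ind]) auto
      then show ?thesis using ne by (simp add: if_distrib Int_commute)
    qed
  qed (rule region_field_sets)+
qed

end

section \<open>The energy of a square integrable function on a subset of the line\<close>

text \<open>A finite frontier is the working form of \<open>elementary_set\<close> (see
  \<open>elementary_set_iff\<close>): its stability under the set operations is immediate from that
  of frontiers.\<close>

lemma finite_frontier_Un: "finite (frontier A) \<Longrightarrow> finite (frontier B) \<Longrightarrow> finite (frontier (A \<union> B))"
  using frontier_Un_subset[of A B] by (auto intro: finite_subset)

lemma finite_frontier_Int: "finite (frontier A) \<Longrightarrow> finite (frontier B) \<Longrightarrow> finite (frontier (A \<inter> B))"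
  using frontier_Int_subset[of A B] by (auto intro: finite_subset)

lemma finite_frontier_Diff: "finite (frontier A) \<Longrightarrow> finite (frontier B) \<Longrightarrow> finite (frontier (A - B))"
  using finite_frontier_Int[of A "- B"] by (simp add: Diff_eq frontier_complement)

lemma finite_frontier_Union:
  "finite \<A> \<Longrightarrow> (\<And>A. A \<in> \<A> \<Longrightarrow> finite (frontier A)) \<Longrightarrow> finite (frontier (\<Union>\<A>))"
  by (induction \<A> rule: finite_induct) (auto intro: finite_frontier_Un)

lemma set_integral_eq_on_sigma_sets:
  fixes g k :: "'a \<Rightarrow> real"
  assumes P: "Int_stable P" "P \<subseteq> sets M" "space M \<in> P"
    and int: "integrable M g" "integrable M k"
    and eq: "\<And>A. A \<in> P \<Longrightarrow> (\<integral>x\<in>A. g x \<partial>M) = (\<integral>x\<in>A. k x \<partial>M)"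
    and A: "A \<in> sigma_sets (space M) P"
  shows "(\<integral>x\<in>A. g x \<partial>M) = (\<integral>x\<in>A. k x \<partial>M)"
proof -
  have sub: "sigma_sets (space M) P \<subseteq> sets M" using P by (intro sets.sigma_sets_subset)
  have si: "set_integrable M A f" if "A \<in> sets M" "integrable M f" for A and f :: "'a \<Rightarrow> real"
    unfolding set_integrable_def using that by (rule integrable_mult_indicator)
  have PP: "P \<subseteq> Pow (space M)" using P(2) sets.space_closed by blast
  from P(1) PP A show ?thesis
  proof (induction rule: sigma_sets_induct_disjoint)
    case (basic A)
    then show ?case by (rule eq)
  next
    case empty
    then show ?case by (simp add: set_lebesgue_integral_def)
  next
    case (compl A)
    then have A: "A \<in> sets M" using sub by auto
    have *: "(\<integral>x\<in>space M - A. f x \<partial>M) = (\<integral>x\<in>space M. f x \<partial>M) - (\<integral>x\<in>A. f x \<partial>M)"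
      if "integrable M f" for f :: "'a \<Rightarrow> real"
    proof -
      have "set_integrable M A f" "set_integrable M (space M - A) f"
        using that A by (auto intro: si)
      then have "(\<integral>x\<in>A \<union> (space M - A). f x \<partial>M) = (\<integral>x\<in>A. f x \<partial>M) + (\<integral>x\<in>space M - A. f x \<partial>M)"
        by (intro set_integral_Un) auto
      moreover have "A \<union> (space M - A) = space M" using sets.sets_into_space[OF A] by auto
      ultimately show ?thesis by simp
    qed
    show ?case using *[OF int(1)] *[OF int(2)] compl eq[OF P(3)] by simp
  next
    case (union A)
    then have A: "\<And>i. A i \<in> sets M" "disjoint_family A" using sub by auto
    have "(\<integral>x\<in>(\<Union>i. A i). g x \<partial>M) = (\<Sum>i. \<integral>x\<in>A i. g x \<partial>M)"
      using A by (intro lebesgue_integral_countable_add si int) (auto simp: disjoint_family_on_def)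
    also have "\<dots> = (\<Sum>i. \<integral>x\<in>A i. k x \<partial>M)" using union by simp
    also have "\<dots> = (\<integral>x\<in>(\<Union>i. A i). k x \<partial>M)"
      using A by (intro lebesgue_integral_countable_add[symmetric] si int) (auto simp: disjoint_family_on_def)
    finally show ?case .
  qed
qed

lemma (in prob_space) indep_set_integral_mult:
  fixes X Y :: "'a \<Rightarrow> real"
  assumes ind: "indep_set (sets G) (sets H)" and G: "subalgebra M G" and H: "subalgebra M H"
    and X: "X \<in> borel_measurable G" "integrable M X" and Y: "Y \<in> borel_measurable H" "integrable M Y"
  shows "(\<integral>x. X x * Y x \<partial>M) = (\<integral>x. X x \<partial>M) * (\<integral>x. Y x \<partial>M)"
proof (rule indep_var_lebesgue_integral)
  have *: "sigma_sets (space M) {X -` A \<inter> space M |A. A \<in> sets borel} \<subseteq> sets G"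
    if "X \<in> borel_measurable G" "subalgebra M G" for X :: "'a \<Rightarrow> real" and G
  proof -
    have "space G = space M" using that by (simp add: subalgebra_def)
    moreover have "sigma_sets (space G) {X -` A \<inter> space G |A. A \<in> sets borel} \<subseteq> sets G"
      using that by (intro sets.sigma_sets_subset) (auto intro: measurable_sets)
    ultimately show ?thesis by simp
  qed
  show "indep_var borel X borel Y"
    unfolding indep_var_eq
  proof (intro conjI)
    show "X \<in> borel_measurable M" "Y \<in> borel_measurable M" using X Y by auto
    show "indep_set (sigma_sets (space M) {X -` A \<inter> space M |A. A \<in> sets borel})
        (sigma_sets (space M) {Y -` A \<inter> space M |A. A \<in> sets borel})"
      using ind *[OF X(1) G] *[OF Y(1) H] unfolding indep_sets2_eq by blast
  qed
qed (use X Y in auto)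

context continuous_factorization
begin

section \<open>The commuting projections of the regions\<close>

abbreviation region_exp :: "real set \<Rightarrow> ('a \<Rightarrow> real) \<Rightarrow> 'a \<Rightarrow> real" where
  "region_exp E \<equiv> real_cond_exp M (region_field E)"

lemma finite_measure_subalgebra_region_field: "finite_measure_subalgebra M (region_field E)"
  by unfold_locales (rule subalgebra_region_field)

lemma sigma_finite_subalgebra_region_field: "sigma_finite_subalgebra M (region_field E)"
  by (rule finite_measure_subalgebra_is_sigma_finite[OF finite_measure_subalgebra_region_field])

lemma region_exp_L2: "f \<in> L2 M \<Longrightarrow> region_exp E f \<in> L2 M"
  by (rule cond_exp_L2(1)[OF subalgebra_region_field])

lemma region_exp_measurable_mono:
  assumes "E \<subseteq> E'"
  shows "region_exp E f \<in> borel_measurable (region_field E')"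
proof -
  have "subalgebra (region_field E') (region_field E)"
    using region_field_mono[OF assms] by (simp add: subalgebra_def)
  then show ?thesis by (rule measurable_from_subalg) simp
qed

lemma region_exp_set_integral:
  assumes "f \<in> L2 M" "A \<in> sets (region_field E)"
  shows "(\<integral>x\<in>A. region_exp E f x \<partial>M) = (\<integral>x\<in>A. f x \<partial>M)"
  using sigma_finite_subalgebra.real_cond_exp_intA[OF sigma_finite_subalgebra_region_field
      L2_integrable[OF assms(1)] assms(2)] by simp

text \<open>By independence of the fields of \<open>E\<close> and \<open>E' - E\<close>, both sides have the same integrals over the
  sets \<open>a \<inter> h\<close> with \<open>a\<close> in the field of \<open>E \<inter> E'\<close> and \<open>h\<close> in the field of \<open>E' - E\<close>.\<close>

lemma region_exp_region_exp:
  assumes f: "f \<in> L2 M" and fin: "finite (frontier E)" "finite (frontier E')"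
  shows "AE x in M. region_exp E' (region_exp E f) x = region_exp (E \<inter> E') f x"
proof (rule sigma_finite_subalgebra.real_cond_exp_charact[OF sigma_finite_subalgebra_region_field])
  let ?g = "region_exp E f" and ?k = "region_exp (E \<inter> E') f"
  let ?D = "E' - E"
  define P where "P = {a \<inter> h |a h. a \<in> sets (region_field (E \<inter> E')) \<and> h \<in> sets (region_field ?D)}"
  have fin': "finite (frontier (E \<inter> E'))" "finite (frontier ?D)"
    using fin by (auto intro: finite_frontier_Int finite_frontier_Diff)
  have int: "integrable M ?g" "integrable M ?k" using f by (auto intro!: L2_integrable region_exp_L2)
  show "integrable M ?g" "integrable M ?k" by fact+
  show "?k \<in> borel_measurable (region_field E')" by (rule region_exp_measurable_mono) simp
  fix A assume A: "A \<in> sets (region_field E')"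
  show "(\<integral>x\<in>A. ?g x \<partial>M) = (\<integral>x\<in>A. ?k x \<partial>M)"
  proof (rule set_integral_eq_on_sigma_sets[OF _ _ _ int])
    show PM: "P \<subseteq> sets M" using region_field_sets by (auto simp: P_def)
    show "Int_stable P"
    proof (rule Int_stableI)
      fix A B assume "A \<in> P" "B \<in> P"
      then obtain a h a' h' where "A = a \<inter> h" "B = a' \<inter> h'" "a \<in> sets (region_field (E \<inter> E'))"
        "h \<in> sets (region_field ?D)" "a' \<in> sets (region_field (E \<inter> E'))" "h' \<in> sets (region_field ?D)"
        by (auto simp: P_def)
      then show "A \<inter> B \<in> P" unfolding P_def
        by (intro CollectI exI[of _ "a \<inter> a'"] exI[of _ "h \<inter> h'"]) auto
    qed
    have spc: "space M \<in> sets (region_field S)" for S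
      using sets.top[of "region_field S"] by simp
    then show "space M \<in> P" unfolding P_def by (intro CollectI exI[of _ "space M"]) auto
    have aP: "sets (region_field (E \<inter> E')) \<subseteq> P" "sets (region_field ?D) \<subseteq> P"
    proof -
      show "sets (region_field (E \<inter> E')) \<subseteq> P"
      proof
        fix a assume a: "a \<in> sets (region_field (E \<inter> E'))"
        then have "a = a \<inter> space M" using sets.sets_into_space[OF a] by auto
        then show "a \<in> P" using a spc unfolding P_def by blast
      qed
      show "sets (region_field ?D) \<subseteq> P"
      proof
        fix h assume h: "h \<in> sets (region_field ?D)"
        then have "h = space M \<inter> h" using sets.sets_into_space[OF h] by auto
        then show "h \<in> P" using h spc unfolding P_def by blast
      qed
    qed
    have "(E \<inter> E') \<union> ?D = E'" by auto
    then have "sets (region_field E') =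
        sets (generated_field M (sets (region_field (E \<inter> E')) \<union> sets (region_field ?D)))"
      using region_field_Un[OF fin'(1), of ?D] by simp
    also have "\<dots> = sigma_sets (space M)
        (null_sets M \<union> (sets (region_field (E \<inter> E')) \<union> sets (region_field ?D)))"
      using region_field_sets by (intro sets_generated_field) auto
    also have "\<dots> \<subseteq> sigma_sets (space M) P"
      using aP subfield_null_sets[OF subfield_region_field[of ?D]] by (intro sigma_sets_mono') auto
    finally show "A \<in> sigma_sets (space M) P" using A by auto
    fix B assume "B \<in> P"
    then obtain a h where B: "B = a \<inter> h" and a: "a \<in> sets (region_field (E \<inter> E'))"
      and h: "h \<in> sets (region_field ?D)" by (auto simp: P_def)
    have aE: "a \<in> sets (region_field E)" using a region_field_mono[of "E \<inter> E'" E] by auto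
    have hM: "h \<in> sets M" and aM: "a \<in> sets M" using a h region_field_sets by auto
    have ind: "indep_set (sets (region_field E)) (sets (region_field ?D))"
      using fin fin' by (intro indep_region_field) auto
    \<comment> \<open>The event \<open>h\<close> is independent of everything measurable for
      \<open>E\<close>, so it contributes only its probability.\<close>
    have split: "(\<integral>x\<in>B. u x \<partial>M) = (\<integral>x\<in>a. u x \<partial>M) * prob h"
      if u: "u \<in> borel_measurable (region_field E)" "integrable M u" for u :: "'a \<Rightarrow> real"
    proof -
      have "(\<integral>x\<in>B. u x \<partial>M) = (\<integral>x. (indicator a x * u x) * indicator h x \<partial>M)"
        unfolding set_lebesgue_integral_def B
        by (intro Bochner_Integration.integral_cong) (auto simp: indicator_def)
      also have "\<dots> = (\<integral>x. indicator a x * u x \<partial>M) * (\<integral>x. indicator h x \<partial>M)"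
      proof (rule indep_set_integral_mult[OF ind subalgebra_region_field subalgebra_region_field])
        show "(\<lambda>x. indicator a x * u x) \<in> borel_measurable (region_field E)"
          using aE u by measurable
        show "integrable M (\<lambda>x. indicator a x * u x)"
          using integrable_mult_indicator[OF aM u(2)] by simp
      qed (use h hM in \<open>auto intro: L2_integrable L2_indicator\<close>)
      finally show ?thesis using hM by (simp add: set_lebesgue_integral_def)
    qed
    have "(\<integral>x\<in>a. ?g x \<partial>M) = (\<integral>x\<in>a. ?k x \<partial>M)"
      using region_exp_set_integral[OF f a] region_exp_set_integral[OF f aE] by simp
    then show "(\<integral>x\<in>B. ?g x \<partial>M) = (\<integral>x\<in>B. ?k x \<partial>M)"
      using split[of ?g] split[of ?k] int region_exp_measurable_mono[of "E \<inter> E'" E f] by simp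
  qed
qed

section \<open>Energies as squared norms of the projections\<close>

definition energy :: "('a \<Rightarrow> real) \<Rightarrow> real set \<Rightarrow> real" where
  "energy f E = (\<integral>x. (region_exp E f x)\<^sup>2 \<partial>M)"

lemma energy_nonneg [simp]: "0 \<le> energy f E"
  by (simp add: energy_def)

lemma energy_le: "f \<in> L2 M \<Longrightarrow> energy f E \<le> (\<integral>x. (f x)\<^sup>2 \<partial>M)"
  unfolding energy_def by (rule cond_exp_L2(2)[OF subalgebra_region_field])

lemma energy_UNIV:
  assumes "f \<in> L2 M"
  shows "energy f UNIV = (\<integral>x. (f x)\<^sup>2 \<partial>M)"
  unfolding energy_def
proof (rule integral_cong_AE)
  have "f \<in> borel_measurable (region_field UNIV)"
    using L2_measurable[OF assms] measurable_cong_sets[OF sets_region_field_UNIV refl] by blast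
  then show "AE x in M. (region_exp UNIV f x)\<^sup>2 = (f x)\<^sup>2"
    using sigma_finite_subalgebra.real_cond_exp_F_meas[OF sigma_finite_subalgebra_region_field
        L2_integrable[OF assms]] by fastforce
qed (use assms in auto)

lemma energy_cong_finite: "finite (sym_diff E E') \<Longrightarrow> energy f E = energy f E'"
  unfolding energy_def by (simp add: region_field_cong_finite)

lemma energy_region_exp:
  assumes "f \<in> L2 M" "finite (frontier E)" "finite (frontier E')"
  shows "energy (region_exp E f) E' = energy f (E \<inter> E')"
  unfolding energy_def
  by (rule integral_cong_AE) (use region_exp_region_exp[OF assms] in auto)

text \<open>Pythagoras for nested projections. It gives monotonicity at once, and later turns
  bounded monotone energies into Cauchy sequences of functions.\<close>

lemma energy_increment:
  assumes f: "f \<in> L2 M" and fin: "finite (frontier E)" "finite (frontier E')" and sub: "E \<subseteq> E'"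
  shows "(\<integral>x. (region_exp E' f x - region_exp E f x)\<^sup>2 \<partial>M) = energy f E' - energy f E"
proof -
  let ?g = "region_exp E' f"
  have AE: "AE x in M. region_exp E ?g x = region_exp E f x"
    using region_exp_region_exp[OF f fin(2,1)] sub by (simp add: Int_absorb1)
  have "(\<integral>x. (?g x - region_exp E f x)\<^sup>2 \<partial>M) = (\<integral>x. (?g x - region_exp E ?g x)\<^sup>2 \<partial>M)"
    by (rule integral_cong_AE) (use AE in auto)
  also have "\<dots> = energy f E' - (\<integral>x. (region_exp E ?g x)\<^sup>2 \<partial>M)"
    unfolding energy_def by (intro cond_exp_square_diff subalgebra_region_field region_exp_L2 f)
  also have "(\<integral>x. (region_exp E ?g x)\<^sup>2 \<partial>M) = energy f E"
    unfolding energy_def by (rule integral_cong_AE) (use AE in auto)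
  finally show ?thesis .
qed

lemma energy_mono:
  assumes "f \<in> L2 M" "finite (frontier E)" "finite (frontier E')" "E \<subseteq> E'"
  shows "energy f E \<le> energy f E'"
proof -
  have "0 \<le> (\<integral>x. (region_exp E' f x - region_exp E f x)\<^sup>2 \<partial>M)" by simp
  then show ?thesis using energy_increment[OF assms] by simp
qed

text \<open>Subtracting the projection for \<open>E\<close> leaves the part of \<open>f\<close>
  whose spectral sets are not contained in \<open>E\<close>; the right-hand side is the mass of
  those among them that lie in \<open>E'\<close>.\<close>

lemma energy_diff_region_exp:
  assumes f: "f \<in> L2 M" and fin: "finite (frontier E)" "finite (frontier E')"
  shows "energy (\<lambda>x. f x - region_exp E f x) E' = energy f E' - energy f (E \<inter> E')"
proof -
  interpret sigma_finite_subalgebra M "region_field E'" by (rule sigma_finite_subalgebra_region_field)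
  have fin': "finite (frontier (E \<inter> E'))"
    using fin by (rule finite_frontier_Int)
  have "AE x in M. region_exp E' (\<lambda>x. f x - region_exp E f x) x =
      region_exp E' f x - region_exp E' (region_exp E f) x"
    using f by (intro real_cond_exp_diff L2_integrable region_exp_L2)
  then have AE: "AE x in M. region_exp E' (\<lambda>x. f x - region_exp E f x) x =
      region_exp E' f x - region_exp (E \<inter> E') f x"
    using region_exp_region_exp[OF f fin] by eventually_elim simp
  have "energy (\<lambda>x. f x - region_exp E f x) E' = (\<integral>x. (region_exp E' f x - region_exp (E \<inter> E') f x)\<^sup>2 \<partial>M)"
    unfolding energy_def by (rule integral_cong_AE) (use AE f in auto)
  also have "\<dots> = energy f E' - energy f (E \<inter> E')"
    by (rule energy_increment[OF f fin' fin(2)]) simp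
  finally show ?thesis .
qed

lemma energy_const: "energy (\<lambda>_. c) E = c\<^sup>2"
proof -
  interpret sigma_finite_subalgebra M "region_field E" by (rule sigma_finite_subalgebra_region_field)
  have "AE x in M. region_exp E (\<lambda>_. c) x = c" by (rule real_cond_exp_F_meas) auto
  then have "AE x in M. (region_exp E (\<lambda>_. c) x)\<^sup>2 = c\<^sup>2" by eventually_elim simp
  then have "energy (\<lambda>_. c) E = (\<integral>x. c\<^sup>2 \<partial>M)"
    unfolding energy_def by (rule integral_cong_AE[rotated 2]) auto
  then show ?thesis by (simp add: prob_space)
qed

lemma energy_abs: "f \<in> L2 M \<Longrightarrow> energy f E \<le> energy (\<lambda>x. \<bar>f x\<bar>) E"
  unfolding energy_def by (rule cond_exp_abs_square_le[OF subalgebra_region_field])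

lemma energy_parallelogram:
  assumes "f \<in> L2 M" "g \<in> L2 M" "c \<noteq> 0"
  shows "energy (\<lambda>x. f x + g x) E + energy (\<lambda>x. c * f x - g x / c) E =
    (1 + c\<^sup>2) * energy f E + (1 + 1 / c\<^sup>2) * energy g E"
  unfolding energy_def using assms by (rule cond_exp_parallelogram[OF subalgebra_region_field])

text \<open>This is convergence of an L2-bounded martingale. The projections are Cauchy since their
  energies converge, and the limit is recognised on the union of the fields, an intersection-stable
  generator.\<close>

lemma energy_tendsto:
  assumes f: "f \<in> L2 M"
    and fin: "\<And>n. finite (frontier (W n))" "finite (frontier E)"
    and inc: "incseq W" and sub: "\<And>n. W n \<subseteq> E"
    and gen: "sets (region_field E) \<subseteq> sigma_sets (space M) (\<Union>n. sets (region_field (W n)))"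
  shows "(\<lambda>n. energy f (W n)) \<longlonglongrightarrow> energy f E"
proof -
  let ?p = "\<lambda>n. region_exp (W n) f"
  have Wmono: "W m \<subseteq> W n" if "m \<le> n" for m n using inc that by (simp add: incseq_def)
  have mono: "incseq (\<lambda>n. energy f (W n))"
    using Wmono by (auto simp: incseq_def intro!: energy_mono f fin)
  have "\<forall>n. energy f (W n) \<le> (\<integral>x. (f x)\<^sup>2 \<partial>M)" using energy_le[OF f] by simp
  then obtain l where "(\<lambda>n. energy f (W n)) \<longlonglongrightarrow> l"
    using incseq_convergent[OF mono] by blast
  then have Cauchy: "Cauchy (\<lambda>n. energy f (W n))" by (rule LIMSEQ_imp_Cauchy)
  have le: "(\<integral>x. (?p m x - ?p n x)\<^sup>2 \<partial>M) \<le> \<bar>energy f (W m) - energy f (W n)\<bar>" for m n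
  proof -
    have *: "(\<integral>x. (?p m x - ?p n x)\<^sup>2 \<partial>M) = energy f (W m) - energy f (W n)" if "n \<le> m" for m n
      using energy_increment[OF f fin(1) fin(1) Wmono[OF that]] .
    show ?thesis
    proof (cases "n \<le> m")
      case True
      then show ?thesis using *[OF True] by simp
    next
      case False
      have "(\<integral>x. (?p m x - ?p n x)\<^sup>2 \<partial>M) = (\<integral>x. (?p n x - ?p m x)\<^sup>2 \<partial>M)"
        by (simp add: power2_commute)
      then show ?thesis using *[of m n] False by simp
    qed
  qed
  obtain h where h: "h \<in> L2 M" "h \<in> borel_measurable (region_field E)"
    "(\<lambda>n. \<integral>x. (?p n x - h x)\<^sup>2 \<partial>M) \<longlonglongrightarrow> 0"
  proof (rule L2_complete[OF subalgebra_region_field])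
    show "?p n \<in> L2 M" for n by (rule region_exp_L2[OF f])
    show "?p n \<in> borel_measurable (region_field E)" for n by (rule region_exp_measurable_mono[OF sub])
    fix e :: real assume "0 < e"
    then have "\<exists>N. \<forall>m\<ge>N. \<forall>n\<ge>N. \<bar>energy f (W m) - energy f (W n)\<bar> < e"
      using CauchyD[OF Cauchy] by auto
    then show "\<exists>N. \<forall>m\<ge>N. \<forall>n\<ge>N. (\<integral>x. (?p m x - ?p n x)\<^sup>2 \<partial>M) < e"
      by (auto intro!: le_less_trans[OF le])
  qed blast
  have pL: "?p n \<in> L2 M" for n by (rule region_exp_L2[OF f])
  have conv: "(\<lambda>n. \<integral>x. u x * ?p n x \<partial>M) \<longlonglongrightarrow> (\<integral>x. u x * h x \<partial>M)" if u: "u \<in> L2 M" for u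
  proof -
    have "(\<lambda>n. (\<integral>x. u x * (?p n x - h x) \<partial>M)\<^sup>2) \<longlonglongrightarrow> 0"
    proof (rule tendsto_sandwich[of "\<lambda>_. 0"])
      show "\<forall>\<^sub>F n in sequentially. (\<integral>x. u x * (?p n x - h x) \<partial>M)\<^sup>2 \<le>
          (\<integral>x. (u x)\<^sup>2 \<partial>M) * (\<integral>x. (?p n x - h x)\<^sup>2 \<partial>M)"
        using L2_Cauchy_Schwarz[OF u L2_diff[OF pL h(1)]] by simp
      show "(\<lambda>n. (\<integral>x. (u x)\<^sup>2 \<partial>M) * (\<integral>x. (?p n x - h x)\<^sup>2 \<partial>M)) \<longlonglongrightarrow> 0"
        using tendsto_mult_left[OF h(3), of "\<integral>x. (u x)\<^sup>2 \<partial>M"] by simp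
    qed auto
    then have "(\<lambda>n. \<integral>x. u x * (?p n x - h x) \<partial>M) \<longlonglongrightarrow> 0" by simp
    moreover have "(\<integral>x. u x * (?p n x - h x) \<partial>M) = (\<integral>x. u x * ?p n x \<partial>M) - (\<integral>x. u x * h x \<partial>M)" for n
      using L2_mult_integrable[OF u pL] L2_mult_integrable[OF u h(1)]
      by (simp add: right_diff_distrib)
    ultimately show ?thesis by (simp add: LIM_zero_iff)
  qed
  interpret sigma_finite_subalgebra M "region_field E" by (rule sigma_finite_subalgebra_region_field)
  have "AE x in M. region_exp E f x = h x"
  proof (rule real_cond_exp_charact)
    show int: "integrable M f" "integrable M h" using f h by (auto intro: L2_integrable)
    show "h \<in> borel_measurable (region_field E)" by fact
    fix A assume A: "A \<in> sets (region_field E)"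
    let ?P = "\<Union>n. sets (region_field (W n))"
    show "(\<integral>x\<in>A. f x \<partial>M) = (\<integral>x\<in>A. h x \<partial>M)"
    proof (rule set_integral_eq_on_sigma_sets[OF _ _ _ int])
      show "?P \<subseteq> sets M" using region_field_sets by auto
      show "space M \<in> ?P" using sets.top[of "region_field (W 0)"] by auto
      show "Int_stable ?P"
      proof (rule Int_stableI)
        fix A B assume "A \<in> ?P" "B \<in> ?P"
        then obtain m n where "A \<in> sets (region_field (W m))" "B \<in> sets (region_field (W n))" by auto
        then have "A \<in> sets (region_field (W (max m n)))" "B \<in> sets (region_field (W (max m n)))"
          using region_field_mono[OF Wmono[of m "max m n"]] region_field_mono[OF Wmono[of n "max m n"]]
          by auto
        then show "A \<inter> B \<in> ?P" by blast
      qed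
      show "A \<in> sigma_sets (space M) ?P" using A gen by auto
      fix B assume "B \<in> ?P"
      then obtain n where B: "B \<in> sets (region_field (W n))" by auto
      \<comment> \<open>An event of the field at level \<open>n\<close> is tested correctly by every
        later projection, so the integrals are eventually constant.\<close>
      have "\<forall>\<^sub>F m in sequentially. (\<integral>x. indicator B x * ?p m x \<partial>M) = (\<integral>x\<in>B. f x \<partial>M)"
        using eventually_ge_at_top[of n]
      proof eventually_elim
        case (elim m)
        then have "B \<in> sets (region_field (W m))" using B region_field_mono[OF Wmono] by auto
        then show ?case using region_exp_set_integral[OF f] by (simp add: set_lebesgue_integral_def)
      qed
      then have "(\<lambda>m. \<integral>x. indicator B x * ?p m x \<partial>M) \<longlonglongrightarrow> (\<integral>x\<in>B. f x \<partial>M)"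
        by (rule tendsto_eventually)
      moreover have "(\<lambda>m. \<integral>x. indicator B x * ?p m x \<partial>M) \<longlonglongrightarrow> (\<integral>x. indicator B x * h x \<partial>M)"
        using B region_field_sets by (intro conv L2_indicator) auto
      ultimately show "(\<integral>x\<in>B. f x \<partial>M) = (\<integral>x\<in>B. h x \<partial>M)"
        using LIMSEQ_unique by (fastforce simp: set_lebesgue_integral_def)
    qed
  qed
  then have "energy f E = (\<integral>x. (h x)\<^sup>2 \<partial>M)"
    unfolding energy_def using h by (intro integral_cong_AE) auto
  also have "\<dots> = (\<integral>x. f x * h x \<partial>M)"
    using cond_exp_inner[OF subalgebra_region_field f h(1,2)] \<open>AE x in M. region_exp E f x = h x\<close> h(1) f
    by (subst (asm) integral_cong_AE[where g="\<lambda>x. (h x)\<^sup>2"]) (auto simp: power2_eq_square mult.commute)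
  finally have "energy f E = (\<integral>x. f x * h x \<partial>M)" .
  \<comment> \<open>Both energies are now inner products with the fixed function \<open>f\<close>,
    so \<open>conv\<close> applies.\<close>
  moreover have "energy f (W n) = (\<integral>x. f x * ?p n x \<partial>M)" for n
    using cond_exp_inner_cond_exp[OF subalgebra_region_field f f, of "W n"]
    by (simp add: energy_def power2_eq_square mult.commute)
  ultimately show ?thesis using conv[OF f] by simp
qed

end

section \<open>The hitting process\<close>

text \<open>Uniqueness in Moebius inversion over the subsets of a finite set.\<close>

lemma sum_Pow_eq_imp_eq:
  fixes a b :: "'b set \<Rightarrow> 'c :: cancel_comm_monoid_add"
  assumes "finite A" and "\<And>T. T \<subseteq> A \<Longrightarrow> (\<Sum>S\<in>Pow T. a S) = (\<Sum>S\<in>Pow T. b S)"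
  shows "a A = b A"
  using assms
proof (induction A rule: finite_psubset_induct)
  case (psubset A)
  have "(\<Sum>S\<in>Pow A - {A}. a S) = (\<Sum>S\<in>Pow A - {A}. b S)"
  proof (rule sum.cong)
    fix S assume "S \<in> Pow A - {A}"
    then show "a S = b S" by (intro psubset.IH psubset.prems) auto
  qed simp
  moreover have "a A + (\<Sum>S\<in>Pow A - {A}. a S) = b A + (\<Sum>S\<in>Pow A - {A}. b S)"
    using psubset.prems[of A] psubset.hyps
    by (simp add: sum.remove[symmetric, of "Pow A" A])
  ultimately show ?case by simp
qed

context continuous_factorization
begin

text \<open>The weight \<open>m S\<close> is the mass of the compact sets inside \<open>E\<close> which hit, among the members of \<open>A\<close>,
  exactly those in \<open>S\<close>. Splitting \<open>f\<close> along the projection for \<open>- J\<close> separates the sets missing \<open>J\<close> from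
  those hitting it; this is why the weights are nonnegative.\<close>

lemma hitting_weights_exist:
  assumes "finite A" "\<And>J. J \<in> A \<Longrightarrow> finite (frontier J)" "f \<in> L2 M" "finite (frontier E)"
  shows "\<exists>m. (\<forall>S. 0 \<le> m S) \<and> (\<forall>T\<subseteq>A. (\<Sum>S\<in>Pow T. m S) = energy f (E - \<Union>(A - T)))"
  using assms
proof (induction A arbitrary: f E)
  case empty
  then show ?case by (intro exI[of _ "\<lambda>_. energy f E"]) auto
next
  case (insert J A)
  let ?g = "\<lambda>x. f x - region_exp (- J) f x"
  have J: "finite (frontier J)" using insert.prems by simp
  have g: "?g \<in> L2 M" using insert.prems by (intro L2_diff region_exp_L2)
  have "finite (frontier (E - J))"
    using insert.prems by (intro finite_frontier_Diff) auto
  then obtain m1 where m1: "\<And>S. 0 \<le> m1 S"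
    "\<And>T. T \<subseteq> A \<Longrightarrow> (\<Sum>S\<in>Pow T. m1 S) = energy f (E - J - \<Union>(A - T))"
    using insert.IH[of f "E - J"] insert.prems by auto
  obtain m2 where m2: "\<And>S. 0 \<le> m2 S"
    "\<And>T. T \<subseteq> A \<Longrightarrow> (\<Sum>S\<in>Pow T. m2 S) = energy ?g (E - \<Union>(A - T))"
    using insert.IH[of ?g E] insert.prems g by auto
  define m where "m S = (if J \<in> S then m2 (S - {J}) else m1 S)" for S
  have "(\<Sum>S\<in>Pow T. m S) = energy f (E - \<Union>(insert J A - T))" if T: "T \<subseteq> insert J A" for T
  proof (cases "J \<in> T")
    case False
    then have TA: "T \<subseteq> A" using T by auto
    have "(\<Sum>S\<in>Pow T. m S) = (\<Sum>S\<in>Pow T. m1 S)"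
      using False by (intro sum.cong) (auto simp: m_def)
    also have "\<dots> = energy f (E - J - \<Union>(A - T))" using m1(2)[OF TA] .
    also have "E - J - \<Union>(A - T) = E - \<Union>(insert J A - T)" using False by auto
    finally show ?thesis .
  next
    case True
    define T' where "T' = T - {J}"
    have T': "T = insert J T'" "J \<notin> T'" "T' \<subseteq> A" using True T by (auto simp: T'_def)
    have finT: "finite T'" using T'(3) insert.hyps(1) by (rule finite_subset)
    let ?U = "\<Union>(A - T')"
    have finU: "finite (frontier (E - ?U))"
      using insert.hyps(1) insert.prems by (intro finite_frontier_Diff finite_frontier_Union) auto
    have inj: "inj_on (insert J) (Pow T')"
    proof (rule inj_onI)
      fix S S' assume "S \<in> Pow T'" "S' \<in> Pow T'" "insert J S = insert J S'"
      then show "S = S'" using T'(2) by (metis PowD insert_ident subsetD)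
    qed
    have "(\<Sum>S\<in>Pow T. m S) = (\<Sum>S\<in>Pow T'. m S) + (\<Sum>S\<in>insert J ` Pow T'. m S)"
      unfolding T'(1) Pow_insert using T'(2) finT by (intro sum.union_disjoint) auto
    also have "(\<Sum>S\<in>insert J ` Pow T'. m S) = (\<Sum>S\<in>Pow T'. m2 S)"
      unfolding sum.reindex[OF inj] o_def using T'(2)
      by (intro sum.cong) (auto simp: m_def intro!: arg_cong[where f=m2])
    also have "(\<Sum>S\<in>Pow T'. m S) = (\<Sum>S\<in>Pow T'. m1 S)"
      using T'(2) by (intro sum.cong) (auto simp: m_def)
    also have "(\<Sum>S\<in>Pow T'. m1 S) + (\<Sum>S\<in>Pow T'. m2 S) =
        energy f (E - J - ?U) + energy ?g (E - ?U)"
      using m1(2)[OF T'(3)] m2(2)[OF T'(3)] by simp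
    \<comment> \<open>The energy of \<open>?g\<close> omits precisely what the first summand
      counted, so the two add up to the energy on \<open>E - ?U\<close>.\<close>
    also have "energy ?g (E - ?U) = energy f (E - ?U) - energy f (- J \<inter> (E - ?U))"
      using insert.prems J finU by (intro energy_diff_region_exp) (auto simp: frontier_complement)
    also have "- J \<inter> (E - ?U) = E - J - ?U" by auto
    also have "insert J A - T = A - T'" using T' insert.hyps(2) by auto
    then have "E - ?U = E - \<Union>(insert J A - T)" by simp
    finally show ?thesis by simp
  qed
  then show ?case using m1(1) m2(1) by (intro exI[of _ m]) (auto simp: m_def)
qed

definition hitting_weight :: "('a \<Rightarrow> real) \<Rightarrow> real set set \<Rightarrow> real set set \<Rightarrow> real" where
  "hitting_weight f A = (SOME m. (\<forall>S. 0 \<le> m S) \<and> (\<forall>T\<subseteq>A. (\<Sum>S\<in>Pow T. m S) = energy f (- \<Union>(A - T))))"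

lemma hitting_weight:
  assumes "finite A" "\<And>J. J \<in> A \<Longrightarrow> finite (frontier J)" "f \<in> L2 M"
  shows "0 \<le> hitting_weight f A S"
    and "T \<subseteq> A \<Longrightarrow> (\<Sum>S\<in>Pow T. hitting_weight f A S) = energy f (- \<Union>(A - T))"
proof -
  have "\<exists>m. (\<forall>S. 0 \<le> m S) \<and> (\<forall>T\<subseteq>A. (\<Sum>S\<in>Pow T. m S) = energy f (- \<Union>(A - T)))"
    using hitting_weights_exist[OF assms, of UNIV] by (simp add: Compl_eq_Diff_UNIV)
  from someI_ex[OF this] show "0 \<le> hitting_weight f A S"
    "T \<subseteq> A \<Longrightarrow> (\<Sum>S\<in>Pow T. hitting_weight f A S) = energy f (- \<Union>(A - T))"
    unfolding hitting_weight_def by auto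
qed

text \<open>The weights are chosen separately for \<open>H\<close> and for \<open>J\<close>; they
  are nevertheless consistent, because their sums over power sets are prescribed energies and
  determine them.\<close>

lemma hitting_weight_restrict:
  assumes H: "finite H" "\<And>J. J \<in> H \<Longrightarrow> finite (frontier J)" and f: "f \<in> L2 M"
    and sub: "J \<subseteq> H" "T \<subseteq> J"
  shows "(\<Sum>S | S \<subseteq> H \<and> S \<inter> J = T. hitting_weight f H S) = hitting_weight f J T"
proof (rule sum_Pow_eq_imp_eq[where a="\<lambda>T. \<Sum>S | S \<subseteq> H \<and> S \<inter> J = T. hitting_weight f H S"])
  have finJ: "finite J" using sub(1) H(1) by (rule finite_subset)
  show "finite T" using sub(2) finJ by (rule finite_subset)
  fix T0 assume T0: "T0 \<subseteq> T"
  \<comment> \<open>The patterns with trace on \<open>J\<close> inside \<open>T0\<close> are the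
    subsets of \<open>?R\<close>, and the members of \<open>H\<close> left unhit by all of them are
    those of \<open>J - T0\<close>.\<close>
  let ?R = "T0 \<union> (H - J)"
  have finR: "finite ?R" "finite T0" using T0 sub H(1) finJ by (auto intro: finite_subset)
  have "(\<Sum>T'\<in>Pow T0. \<Sum>S | S \<subseteq> H \<and> S \<inter> J = T'. hitting_weight f H S) =
      (\<Sum>T'\<in>Pow T0. \<Sum>S | S \<in> Pow ?R \<and> S \<inter> J = T'. hitting_weight f H S)"
  proof (rule sum.cong[OF refl])
    fix T' assume "T' \<in> Pow T0"
    then have "S \<subseteq> H \<and> S \<inter> J = T' \<longleftrightarrow> S \<in> Pow ?R \<and> S \<inter> J = T'" for S
      using sub T0 by blast
    then show "(\<Sum>S | S \<subseteq> H \<and> S \<inter> J = T'. hitting_weight f H S) =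
        (\<Sum>S | S \<in> Pow ?R \<and> S \<inter> J = T'. hitting_weight f H S)" by simp
  qed
  also have "\<dots> = (\<Sum>S\<in>Pow ?R. hitting_weight f H S)"
    using finR by (intro sum.group) auto
  also have "\<dots> = energy f (- \<Union>(H - ?R))"
    using sub T0 by (intro hitting_weight(2) H f) auto
  also have "H - ?R = J - T0" using sub T0 by auto
  also have "energy f (- \<Union>(J - T0)) = (\<Sum>S\<in>Pow T0. hitting_weight f J S)"
    using sub T0 H(2) by (intro hitting_weight(2)[symmetric] finJ f) auto
  finally show "(\<Sum>T'\<in>Pow T0. \<Sum>S | S \<subseteq> H \<and> S \<inter> J = T'. hitting_weight f H S) =
      (\<Sum>S\<in>Pow T0. hitting_weight f J S)" .
qed

text \<open>Consistency of the weights is the hypothesis of Kolmogorov's theorem. The coordinates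
  take the values 0 and 1 but are regarded as real, in order to have a Polish state space; dividing
  by \<open>c\<close>, the energy of the whole line, makes the weights probabilities.\<close>

lemma hitting_process_exists:
  assumes f: "f \<in> L2 M" and c: "c = (\<integral>x. (f x)\<^sup>2 \<partial>M)" "0 < c"
  shows "\<exists>N :: (real set \<Rightarrow> real) measure. prob_space N \<and>
    sets N = sets (PiM {J. finite (frontier J)} (\<lambda>_. borel)) \<and>
    (\<forall>A. finite A \<and> (\<forall>J\<in>A. finite (frontier J)) \<longrightarrow>
      measure N {X \<in> space N. \<forall>J\<in>A. X J = 0} = energy f (- \<Union>A) / c)"
proof -
  let ?I = "{J :: real set. finite (frontier J)}"
  let ?w = "\<lambda>A S. ennreal (hitting_weight f A S / c)"
  let ?D = "\<lambda>A. point_measure (Pow A) (?w A)"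
  let ?ind = "\<lambda>A S. \<lambda>J\<in>A. indicator S J :: real"
  define P where "P A = distr (?D A) (PiM A (\<lambda>_. borel)) (?ind A)" for A
  have ind[measurable]: "?ind A \<in> ?D B \<rightarrow>\<^sub>M PiM A (\<lambda>_. borel)" for A B
    by (auto simp: measurable_def space_point_measure space_PiM sets_point_measure)
  have D_restrict: "distr (?D H) (count_space (Pow J)) (\<lambda>S. S \<inter> J) = ?D J"
    if sub: "J \<subseteq> H" and H: "finite H" "H \<subseteq> ?I" for J H
  proof (rule measure_eqI_finite)
    have finJ: "finite J" using sub H(1) by (rule finite_subset)
    then show "finite (Pow J)" by simp
    fix T assume "T \<in> Pow J"
    then have T: "T \<subseteq> J" by simp
    have w0: "0 \<le> hitting_weight f H S" for S
      using H f by (intro hitting_weight) auto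
    have "emeasure (distr (?D H) (count_space (Pow J)) (\<lambda>S. S \<inter> J)) {T} =
        emeasure (?D H) ((\<lambda>S. S \<inter> J) -` {T} \<inter> space (?D H))"
      using T by (intro emeasure_distr) (auto simp: measurable_def space_point_measure sets_point_measure)
    also have "(\<lambda>S. S \<inter> J) -` {T} \<inter> space (?D H) = {S. S \<subseteq> H \<and> S \<inter> J = T}"
      by (auto simp: space_point_measure)
    also have "emeasure (?D H) \<dots> = (\<Sum>S | S \<subseteq> H \<and> S \<inter> J = T. ?w H S)"
      using H by (intro emeasure_point_measure_finite) auto
    also have "\<dots> = ennreal (\<Sum>S | S \<subseteq> H \<and> S \<inter> J = T. hitting_weight f H S / c)"
      using w0 c by (intro sum_ennreal) auto
    also have "\<dots> = ?w J T"
    proof -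
      have "(\<Sum>S | S \<subseteq> H \<and> S \<inter> J = T. hitting_weight f H S) = hitting_weight f J T"
        using H(2) by (intro hitting_weight_restrict H(1) f sub T) auto
      then show ?thesis by (simp add: sum_divide_distrib[symmetric])
    qed
    also have "\<dots> = emeasure (?D J) {T}"
      using finJ T by (subst emeasure_point_measure_finite) auto
    finally show "emeasure (distr (?D H) (count_space (Pow J)) (\<lambda>S. S \<inter> J)) {T} = emeasure (?D J) {T}" .
  qed (auto simp: sets_point_measure)
  have projective: "P J = distr (P H) (PiM J (\<lambda>_. borel)) (\<lambda>x. restrict x J)"
    if sub: "J \<subseteq> H" and H: "finite H" "H \<subseteq> ?I" for J H
  proof -
    have "distr (P H) (PiM J (\<lambda>_. borel)) (\<lambda>x. restrict x J) =
        distr (?D H) (PiM J (\<lambda>_. borel)) ((\<lambda>x. restrict x J) \<circ> ?ind H)"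
      unfolding P_def using sub by (intro distr_distr ind measurable_restrict_subset)
    also have "(\<lambda>x. restrict x J) \<circ> ?ind H = ?ind J \<circ> (\<lambda>S. S \<inter> J)"
      using sub by (auto simp: fun_eq_iff indicator_def)
    also have "distr (?D H) (PiM J (\<lambda>_. borel)) (?ind J \<circ> (\<lambda>S. S \<inter> J)) =
        distr (distr (?D H) (count_space (Pow J)) (\<lambda>S. S \<inter> J)) (PiM J (\<lambda>_. borel)) (?ind J)"
      by (intro distr_distr[symmetric])
        (auto simp: measurable_def space_point_measure sets_point_measure space_PiM)
    also have "\<dots> = P J"
      unfolding D_restrict[OF sub H] P_def ..
    finally show ?thesis ..
  qed
  have prob: "prob_space (P J)" if J: "finite J" "J \<subseteq> ?I" for J
  proof -
    have w: "0 \<le> hitting_weight f J S" for S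
      using J f by (intro hitting_weight) auto
    have "emeasure (?D J) (space (?D J)) = (\<Sum>S\<in>Pow J. ?w J S)"
      using J by (subst emeasure_point_measure_finite) (auto simp: space_point_measure)
    also have "\<dots> = ennreal (\<Sum>S\<in>Pow J. hitting_weight f J S / c)"
      using w c by (intro sum_ennreal) auto
    also have "\<dots> = ennreal (energy f (- \<Union>(J - J)) / c)"
      using hitting_weight(2)[of J f J] J f by (simp add: sum_divide_distrib[symmetric] subset_eq)
    also have "\<dots> = 1" using energy_UNIV[OF f] c by simp
    finally have "prob_space (?D J)" by (rule prob_spaceI)
    then show ?thesis unfolding P_def by (intro prob_space.prob_space_distr ind)
  qed
  interpret polish_projective ?I P
    unfolding polish_projective_def by (rule projective_family.intro) (rule projective prob; assumption)+
  have "measure lim {X \<in> space lim. \<forall>J\<in>A. X J = 0} = energy f (- \<Union>A) / c"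
    if A: "finite A" "\<forall>J\<in>A. finite (frontier J)" for A
  proof -
    let ?Y = "{x \<in> space (PiM A (\<lambda>_. borel)). \<forall>J\<in>A. x J = (0::real)}"
    have AI: "A \<subseteq> ?I" using A by auto
    have Y: "?Y \<in> sets (PiM A (\<lambda>_. borel))" using A(1) by measurable
    have "{X \<in> space lim. \<forall>J\<in>A. X J = 0} = prod_emb ?I (\<lambda>_. borel) A ?Y"
      using AI by (auto simp: prod_emb_def space_PiM PiE_def extensional_def)
    then have "measure lim {X \<in> space lim. \<forall>J\<in>A. X J = 0} = measure (P A) ?Y"
      using measure_lim_emb[OF AI A(1) Y] by simp
    also have "\<dots> = measure (?D A) (?ind A -` ?Y \<inter> space (?D A))"
      unfolding P_def using Y by (intro measure_distr ind)
    \<comment> \<open>All coordinates vanish only for the empty hitting pattern, whose weight is the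
      energy off the union of \<open>A\<close>.\<close>
    also have "?ind A -` ?Y \<inter> space (?D A) = {{}}"
      by (auto simp: space_point_measure space_PiM indicator_def)
    also have "measure (?D A) {{}} = hitting_weight f A {} / c"
      using A(1) hitting_weight(1)[of A f "{}"] A f c
      by (simp add: measure_def emeasure_point_measure_finite)
    also have "hitting_weight f A {} = energy f (- \<Union>A)"
      using hitting_weight(2)[of A f "{}"] A f by simp
    finally show ?thesis .
  qed
  then show ?thesis
    using P.prob_space_axioms by (intro exI[of _ lim]) auto
qed

end

section \<open>Elementary sets\<close>

lemma finite_frontier_is_interval:
  fixes J :: "real set"
  assumes "is_interval J"
  shows "finite (frontier J)"
proof -
  have *: "finite (frontier {..b})" "finite (frontier {a..})" for a b :: real
    by (rule finite_subset[of _ "{b}"] finite_subset[of _ "{a}"];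
        auto simp: frontier_def interior_Iic interior_Ici)+
  have **: "finite (frontier {..<b})" "finite (frontier {a<..})" for a b :: real
    using *(2)[of b] *(1)[of a] frontier_complement[of "{b..}"] frontier_complement[of "{..a}"]
    by (simp_all add: Compl_atLeast Compl_atMost)
  from is_real_interval[OF assms] show ?thesis
    using * ** by (auto simp: greaterThanLessThan_def greaterThanAtMost_def atLeastLessThan_def
        atLeastAtMost_def intro: finite_frontier_Int)
qed

lemma finite_frontier_finite:
  fixes D :: "real set"
  assumes "finite D"
  shows "finite (frontier D)"
  using assms finite_imp_closed frontier_subset_closed finite_subset by metis

text \<open>The frontier points cut the line into intervals that lie inside or outside
  \<open>E\<close>. Those inside form a decomposition, and what they miss of \<open>E\<close>
  consists of frontier points.\<close>

lemma elementary_set_iff: "elementary_set E \<longleftrightarrow> finite (frontier E)"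
  and decomposition_exists: "finite (frontier E) \<Longrightarrow> \<exists>I. decomposes_into E I"
proof -
  have *: "elementary_set E \<and> (\<exists>I. decomposes_into E I)" if fin: "finite (frontier E)"
  proof -
    define C where "C = {-\<infinity>, \<infinity>} \<union> ereal ` frontier E"
    have C: "finite C" "-\<infinity> \<in> C" "\<infinity> \<in> C" using fin by (auto simp: C_def)
    define I where "I = {p \<in> cells C. open_interval p \<subseteq> E}"
    have finI: "finite I" using finite_cells[OF C(1)] by (simp add: I_def)
    have cover: "x \<in> \<Union>(open_interval ` I)" if x: "x \<in> E" "x \<notin> frontier E" for x
    proof -
      have "open (- frontier E)" by (simp add: open_Compl)
      then obtain e where e: "0 < e" "ball x e \<subseteq> - frontier E"
        using x(2) openE by blast
      have "C \<inter> {ereal (x - e)<..<ereal (x + e)} = {}"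
        using e by (auto simp: C_def ball_def dist_real_def subset_eq abs_less_iff)
      moreover have "ereal (x - e) < ereal (x + e)" using e by simp
      ultimately obtain a b where ab: "(a, b) \<in> cells C" "a \<le> ereal (x - e)" "ereal (x + e) \<le> b"
        using gap_in_cell[OF C] by blast
      have "a < ereal x" "ereal x < b"
        using ab(2,3) e(1) by (auto intro: order.strict_trans1[OF ab(2)] order.strict_trans2[OF _ ab(3)])
      then have x_in: "x \<in> open_interval (a, b)" by simp
      have "open_interval (a, b) \<inter> frontier E = {}"
        using ab(1) by (fastforce simp: cells_def C_def)
      then have "open_interval (a, b) \<subseteq> E"
        using open_interval_frontier_cases[of "(a, b)" E] x_in x(1) by blast
      then show ?thesis using ab(1) x_in by (auto simp: I_def simp del: open_interval_mem)
    qed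
    have "elementary_set E"
      unfolding elementary_set_def
    proof (intro exI conjI ballI)
      \<comment> \<open>The frontier points in \<open>E\<close> enter as degenerate
        intervals.\<close>
      let ?J = "open_interval ` I \<union> (\<lambda>x. {x}) ` (frontier E \<inter> E)"
      show "finite ?J" using finI fin by auto
      show "E = \<Union>?J" using cover by (auto simp: I_def simp del: open_interval_mem)
      fix J assume "J \<in> ?J"
      then show "is_interval J"
        using connected_open_interval is_interval_connected_1 by auto
    qed
    moreover have "decomposes_into E I"
      unfolding decomposes_into_def
    proof (intro conjI finI)
      show "\<forall>(s, t)\<in>I. s < t" by (auto simp: I_def cells_def)
      have "sym_diff E (\<Union>(open_interval ` I)) \<subseteq> frontier E"
        using cover by (auto simp: I_def simp del: open_interval_mem)
      then show "finite (sym_diff E (\<Union>(open_interval ` I)))" using fin by (rule finite_subset)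
      show "disjoint_family_on open_interval I"
        unfolding disjoint_family_on_def
      proof (intro ballI impI)
        fix p q assume pq: "p \<in> I" "q \<in> I" "p \<noteq> q"
        obtain a b a' b' where p: "p = (a, b)" "q = (a', b')" by force
        have cells: "(a, b) \<in> cells C" "(a', b') \<in> cells C" using pq p by (auto simp: I_def)
        then have "a \<noteq> a'" using cells_inj_fst pq(3) p by blast
        then have "b \<le> a' \<or> b' \<le> a" using cells_disjoint cells by (metis linorder_neqE)
        then show "open_interval p \<inter> open_interval q = {}"
          unfolding p by (auto dest: less_trans)
      qed
    qed
    ultimately show ?thesis by blast
  qed
  show "elementary_set E \<longleftrightarrow> finite (frontier E)"
    using * finite_frontier_is_interval by (auto simp: elementary_set_def intro!: finite_frontier_Union)
  show "finite (frontier E) \<Longrightarrow> \<exists>I. decomposes_into E I" using * by blast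
qed

section \<open>The Borel sigma-algebra of the space of compact sets\<close>

definition containment_sets :: "real set set set" where
  "containment_sets = {{K \<in> compacts. K \<subseteq> U} |U. open U \<and> finite (frontier U)}"

lemma containment_setsI: "open U \<Longrightarrow> finite (frontier U) \<Longrightarrow> {K \<in> compacts. K \<subseteq> U} \<in> containment_sets"
  by (auto simp: containment_sets_def)

lemma Int_stable_containment_sets: "Int_stable containment_sets"
proof (rule Int_stableI)
  fix A B assume "A \<in> containment_sets" "B \<in> containment_sets"
  then obtain U V where *: "A = {K \<in> compacts. K \<subseteq> U}" "B = {K \<in> compacts. K \<subseteq> V}"
    "open U" "open V" "finite (frontier U)" "finite (frontier V)"
    by (auto simp: containment_sets_def)
  then have "A \<inter> B = {K \<in> compacts. K \<subseteq> U \<inter> V}" by auto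
  then show "A \<inter> B \<in> containment_sets"
    using * containment_setsI[of "U \<inter> V"] by (simp add: open_Int finite_frontier_Int)
qed

lemma containment_sets_Pow: "containment_sets \<subseteq> Pow compacts"
  by (auto simp: containment_sets_def)

lemma sigma_algebra_containment: "sigma_algebra compacts (sigma_sets compacts containment_sets)"
  by (rule sigma_algebra_sigma_sets[OF containment_sets_Pow])

text \<open>\<open>E\<close> arises from its closure by removing finitely many points. The
  complement of these points is open, and the closure is a decreasing limit of open sets with finite
  frontier.\<close>

lemma containment_in_sigma_sets:
  assumes fin: "finite (frontier E)"
  shows "{K \<in> compacts. K \<subseteq> E} \<in> sigma_sets compacts containment_sets"
proof -
  interpret sigma_algebra compacts "sigma_sets compacts containment_sets"
    by (rule sigma_algebra_containment)
  let ?C = "closure E"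
  have finC: "finite (frontier ?C)"
    by (rule finite_subset[OF _ fin]) (use interior_mono[OF closure_subset[of E]] in \<open>auto simp: frontier_def\<close>)
  have finD: "finite (?C - E)"
    using fin closure_Un_frontier[of E] by (auto intro: finite_subset)
  \<comment> \<open>Balls are needed only around the finitely many frontier points of the closure;
    this keeps the frontier of \<open>U n\<close> finite.\<close>
  define U where "U n = ?C \<union> (\<Union>t\<in>frontier ?C. ball t (1 / Suc n))" for n
  have U: "open (U n)" "finite (frontier (U n))" for n
  proof -
    have "U n = interior ?C \<union> (\<Union>t\<in>frontier ?C. ball t (1 / Suc n))"
    proof -
      have "?C = interior ?C \<union> frontier ?C" using interior_subset[of ?C] by (auto simp: frontier_def)
      moreover have "frontier ?C \<subseteq> (\<Union>t\<in>frontier ?C. ball t (1 / Suc n))" by auto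
      ultimately show ?thesis unfolding U_def by blast
    qed
    then show "open (U n)" by auto
    have "finite (frontier (ball t (1 / Suc n)))" for t :: real
      by (intro finite_frontier_is_interval) (simp add: is_interval_ball_real)
    then show "finite (frontier (U n))"
      unfolding U_def using finC by (intro finite_frontier_Un finite_frontier_Union) auto
  qed
  have "(\<Inter>n. U n) = ?C"
  proof (intro subset_antisym subsetI)
    fix x assume x: "x \<in> (\<Inter>n. U n)"
    show "x \<in> ?C"
    proof (rule ccontr)
      assume "x \<notin> ?C"
      then obtain e where e: "0 < e" "ball x e \<subseteq> - ?C"
        using openE[of "- ?C" x] by auto
      obtain n where n: "1 / Suc n < e" using nat_approx_posE[OF e(1)] by auto
      obtain t where t: "t \<in> frontier ?C" "x \<in> ball t (1 / Suc n)"
        using x \<open>x \<notin> ?C\<close> by (auto simp: U_def)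
      have "t \<in> ?C" using t(1) by (simp add: frontier_def)
      moreover have "t \<in> ball x e" using t(2) n by (simp add: dist_commute)
      ultimately show False using e(2) by auto
    qed
  qed (auto simp: U_def)
  then have C_eq: "{K \<in> compacts. K \<subseteq> ?C} = (\<Inter>n. {K \<in> compacts. K \<subseteq> U n})" by auto
  have "{K \<in> compacts. K \<subseteq> ?C} \<in> sigma_sets compacts containment_sets"
    unfolding C_eq using U by (intro countable_INT) (auto intro!: containment_setsI)
  moreover have "{K \<in> compacts. K \<subseteq> - (?C - E)} \<in> sigma_sets compacts containment_sets"
    using finD finite_frontier_finite[OF finD] finite_imp_closed[OF finD]
    by (intro sigma_sets.Basic containment_setsI) (simp_all add: open_Compl frontier_complement del: Compl_Diff_eq)
  moreover have "{K \<in> compacts. K \<subseteq> E} = {K \<in> compacts. K \<subseteq> ?C} \<inter> {K \<in> compacts. K \<subseteq> - (?C - E)}"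
    using closure_subset[of E] by auto
  ultimately show ?thesis by auto
qed

text \<open>The floor identifies the half-open dyadic cell of a point, so that each level partitions
  the line and the parent of a cell is found by integer division by 2.\<close>

definition grid :: "nat \<Rightarrow> int set \<Rightarrow> real set" where
  "grid n R = {x. \<lfloor>2 ^ n * x\<rfloor> \<in> R}"

lemma grid_singleton: "grid n {j} = {real_of_int j / 2 ^ n ..< (real_of_int j + 1) / 2 ^ n}"
  by (auto simp: grid_def floor_eq_iff field_simps)

lemma finite_frontier_grid:
  assumes "finite R"
  shows "finite (frontier (grid n R))"
proof -
  have "grid n R = (\<Union>j\<in>R. grid n {j})" by (auto simp: grid_def)
  moreover have "finite (frontier (grid n {j}))" for j
    unfolding grid_singleton by (intro finite_frontier_is_interval) (simp add: is_interval_co)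
  ultimately show ?thesis using assms by (auto intro!: finite_frontier_Union)
qed

lemma same_cell_dist:
  fixes x y :: real
  assumes "\<lfloor>2 ^ n * x\<rfloor> = \<lfloor>2 ^ n * y\<rfloor>"
  shows "dist x y \<le> 1 / 2 ^ n"
proof -
  have "\<bar>2 ^ n * x - 2 ^ n * y\<bar> \<le> 1"
    using assms by linarith
  moreover have "2 ^ n * x - 2 ^ n * y = 2 ^ n * (x - y)" by (simp add: right_diff_distrib)
  ultimately have "2 ^ n * \<bar>x - y\<bar> \<le> 1" by (simp add: abs_mult)
  then show ?thesis by (simp add: dist_real_def field_simps)
qed

lemma finite_floor_image:
  assumes "bounded K"
  shows "finite ((\<lambda>x::real. \<lfloor>2 ^ n * x\<rfloor>) ` K)"
proof -
  obtain B where B: "\<And>x. x \<in> K \<Longrightarrow> \<bar>x\<bar> \<le> B" using assms by (auto simp: bounded_iff)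
  have "(\<lambda>x. \<lfloor>2 ^ n * x\<rfloor>) ` K \<subseteq> {\<lfloor>2 ^ n * (- B)\<rfloor>..\<lfloor>2 ^ n * B\<rfloor>}"
  proof clarify
    fix x assume "x \<in> K"
    then have "- B \<le> x" "x \<le> B" using B[of x] by auto
    then have "2 ^ n * (- B) \<le> 2 ^ n * x" "2 ^ n * x \<le> 2 ^ n * B"
      by (intro mult_left_mono; simp)+
    then show "\<lfloor>2 ^ n * x\<rfloor> \<in> {\<lfloor>2 ^ n * (- B)\<rfloor>..\<lfloor>2 ^ n * B\<rfloor>}"
      by (simp only: atLeastAtMost_iff floor_mono)
  qed
  then show ?thesis by (rule finite_subset) simp
qed

lemma hausdorff_dist_same_cells:
  assumes "(\<lambda>x. \<lfloor>2 ^ n * x\<rfloor>) ` K = (\<lambda>x. \<lfloor>2 ^ n * x\<rfloor>) ` L"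
  shows "hausdorff_dist K L \<le> 1 / 2 ^ n"
proof (cases "K = {}")
  case True
  then show ?thesis using assms by (simp add: hausdorff_dist_def)
next
  case False
  then have L: "L \<noteq> {}" using assms by auto
  have *: "infdist x B \<le> 1 / 2 ^ n" if x: "x \<in> A" "(\<lambda>x. \<lfloor>2 ^ n * x\<rfloor>) ` A \<subseteq> (\<lambda>x. \<lfloor>2 ^ n * x\<rfloor>) ` B"
    for x and A B :: "real set"
  proof -
    obtain y where "y \<in> B" "\<lfloor>2 ^ n * x\<rfloor> = \<lfloor>2 ^ n * y\<rfloor>" using x by blast
    then show ?thesis using infdist_le[of y B x] same_cell_dist[of n x y] by linarith
  qed
  have "(SUP x\<in>K. infdist x L) \<le> 1 / 2 ^ n" "(SUP y\<in>L. infdist y K) \<le> 1 / 2 ^ n"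
    using False L assms by (auto intro!: cSUP_least *)
  then show ?thesis using False L by (simp add: hausdorff_dist_def)
qed

lemma hausdorff_open_containment:
  assumes "open U"
  shows "hausdorff_open {K \<in> compacts. K \<subseteq> U}"
  unfolding hausdorff_open_def
proof (intro conjI ballI)
  fix K assume "K \<in> {K \<in> compacts. K \<subseteq> U}"
  then have K: "compact K" "K \<subseteq> U" by (auto simp: compacts_def)
  obtain e where e: "0 < e" "(\<Union>x\<in>K. cball x e) \<subseteq> U"
    using compact_subset_open_imp_cball_epsilon_subset[OF K(1) assms K(2)] by blast
  show "\<exists>e>0. \<forall>L\<in>compacts. hausdorff_dist K L < e \<longrightarrow> L \<in> {K \<in> compacts. K \<subseteq> U}"
  \<comment> \<open>The bound 1 excludes that exactly one of the two sets is empty.\<close>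
  proof (intro exI[of _ "min e 1"] conjI ballI impI)
    fix L assume L: "L \<in> compacts" "hausdorff_dist K L < min e 1"
    have "L \<subseteq> U"
    proof (cases "L = {} \<or> K = {}")
      case True
      then show ?thesis using L(2) by (auto simp: hausdorff_dist_def split: if_splits)
    next
      case False
      then have sup: "(SUP y\<in>L. infdist y K) < e" using L(2) by (simp add: hausdorff_dist_def)
      have "bdd_above ((\<lambda>y. infdist y K) ` L)"
        using L(1) by (intro bounded_imp_bdd_above compact_imp_bounded compact_continuous_image
            continuous_on_infdist continuous_on_id) (auto simp: compacts_def)
      show ?thesis
      proof
        fix y assume y: "y \<in> L"
        have "infdist y K < e"
          using cSUP_upper[OF y \<open>bdd_above _\<close>] sup by linarith
        moreover obtain x where "x \<in> K" "infdist y K = dist y x"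
          using infdist_attains_inf[OF compact_imp_closed[OF K(1)]] False by metis
        ultimately have "y \<in> cball x e" by (simp add: dist_commute)
        then show "y \<in> U" using e(2) \<open>x \<in> K\<close> by blast
      qed
    qed
    then show "L \<in> {K \<in> compacts. K \<subseteq> U}" using L(1) by simp
  qed (use e in simp)
qed auto

text \<open>Compact sets occupying the same cells of level \<open>n\<close> are within distance
  \<open>1 / 2 ^ n\<close>. There are only countably many such classes, and an open set is the union
  of the classes it contains.\<close>

lemma hausdorff_open_in_sigma_sets:
  assumes "hausdorff_open U"
  shows "U \<in> sigma_sets compacts containment_sets"
proof -
  interpret sigma_algebra compacts "sigma_sets compacts containment_sets"
    by (rule sigma_algebra_containment)
  define V where "V n R = {K \<in> compacts. (\<lambda>x. \<lfloor>2 ^ n * x\<rfloor>) ` K = R}" for n :: nat and R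
  have V: "V n R \<in> sigma_sets compacts containment_sets" if "finite R" for n R
  proof -
    \<comment> \<open>All occupied cells are among \<open>R\<close>, and none of the cells in
      \<open>R\<close> can be spared.\<close>
    have eq: "V n R = {K \<in> compacts. K \<subseteq> grid n R} - (\<Union>r\<in>R. {K \<in> compacts. K \<subseteq> grid n (R - {r})})"
      by (auto simp: V_def grid_def subset_eq image_iff)
    have "{K \<in> compacts. K \<subseteq> grid n R'} \<in> sigma_sets compacts containment_sets" if "R' \<subseteq> R" for R'
      using that \<open>finite R\<close> by (intro containment_in_sigma_sets finite_frontier_grid) (rule finite_subset)
    then show ?thesis unfolding eq using \<open>finite R\<close> by (intro Diff finite_UN) auto
  qed
  have "U = (\<Union>n. \<Union>R\<in>{R. finite R \<and> V n R \<subseteq> U}. V n R)"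
  proof (intro subset_antisym subsetI)
    fix K assume K: "K \<in> U"
    then have cK: "K \<in> compacts" using assms by (auto simp: hausdorff_open_def)
    obtain e where e: "0 < e" "\<And>L. L \<in> compacts \<Longrightarrow> hausdorff_dist K L < e \<Longrightarrow> L \<in> U"
      using assms K unfolding hausdorff_open_def by blast
    obtain n where n: "(1/2::real) ^ n < e" using real_arch_pow_inv[OF e(1), of "1/2"] by auto
    let ?R = "(\<lambda>x. \<lfloor>2 ^ n * x\<rfloor>) ` K"
    have "V n ?R \<subseteq> U"
    proof
      fix L assume "L \<in> V n ?R"
      then have "L \<in> compacts" "hausdorff_dist K L \<le> 1 / 2 ^ n"
        by (auto simp: V_def intro!: hausdorff_dist_same_cells)
      then show "L \<in> U" using n by (intro e(2)) (auto simp: power_divide)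
    qed
    moreover have "finite ?R" using cK by (intro finite_floor_image) (simp add: compacts_def compact_imp_bounded)
    moreover have "K \<in> V n ?R" using cK by (simp add: V_def)
    ultimately show "K \<in> (\<Union>n. \<Union>R\<in>{R. finite R \<and> V n R \<subseteq> U}. V n R)" by blast
  qed auto
  moreover have "(\<Union>n. \<Union>R\<in>{R. finite R \<and> V n R \<subseteq> U}. V n R) \<in> sigma_sets compacts containment_sets"
  proof (intro countable_nat_UN image_subsetI countable_UN'')
    show "countable {R. finite R \<and> V n R \<subseteq> U}" for n
      by (rule countable_subset[OF _ countable_Collect_finite]) auto
  qed (use V in auto)
  ultimately show ?thesis by simp
qed

lemma space_compacts_borel: "space compacts_borel = compacts"
  by (auto simp: compacts_borel_def space_measure_of_conv)

lemma sets_compacts_borel: "sets compacts_borel = sigma_sets compacts containment_sets"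
proof -
  have "sets compacts_borel = sigma_sets compacts (Collect hausdorff_open)"
    unfolding compacts_borel_def by (intro sets_measure_of) (auto simp: hausdorff_open_def)
  also have "\<dots> = sigma_sets compacts containment_sets"
  proof (rule sigma_sets_eqI)
    fix A assume "A \<in> containment_sets"
    then show "A \<in> sigma_sets compacts (Collect hausdorff_open)"
      using hausdorff_open_containment by (auto simp: containment_sets_def)
  qed (use hausdorff_open_in_sigma_sets in auto)
  finally show ?thesis .
qed

lemma containment_in_compacts_borel [measurable]:
  "finite (frontier E) \<Longrightarrow> {K \<in> compacts. K \<subseteq> E} \<in> sets compacts_borel"
  by (simp add: sets_compacts_borel containment_in_sigma_sets)

section \<open>The limit set of a coherent hitting process\<close>

text \<open>The process is indexed by half-open cells, which partition the line; the limit set is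
  assembled from closed ones for the sake of compactness.\<close>

definition closed_cell :: "nat \<Rightarrow> int \<Rightarrow> real set" where
  "closed_cell n j = {real_of_int j / 2 ^ n .. (real_of_int j + 1) / 2 ^ n}"

text \<open>The asymmetry matches the half-open cells: the complement \<open>[-m, m)\<close> is a
  union of dyadic cells of every level.\<close>

definition tail :: "nat \<Rightarrow> real set" where
  "tail m = {x. x < - real m \<or> real m \<le> x}"

lemma frontier_tail: "finite (frontier (tail m))"
proof -
  have "tail m = {..<- real m} \<union> {real m..}" by (auto simp: tail_def)
  moreover have "is_interval {..<- real m}" "is_interval {real m..}" by (auto simp: is_interval_1)
  ultimately show ?thesis
    by (simp add: finite_frontier_Un finite_frontier_is_interval)
qed

lemma tail_Suc: "tail (Suc m) \<subseteq> tail m"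
  by (auto simp: tail_def)

lemma floor_double_div: "\<lfloor>2 * y\<rfloor> div 2 = \<lfloor>y\<rfloor>" for y :: real
proof -
  have "\<lfloor>2 * y\<rfloor> = 2 * \<lfloor>y\<rfloor> \<or> \<lfloor>2 * y\<rfloor> = 2 * \<lfloor>y\<rfloor> + 1" by linarith
  then show ?thesis by auto
qed

lemma grid_Suc_subset: "grid (Suc n) {j} \<subseteq> grid n {j div 2}"
  using floor_double_div[of "2 ^ n * _"] by (auto simp: grid_def mult.assoc)

lemma closed_cell_Suc_subset: "closed_cell (Suc n) j \<subseteq> closed_cell n (j div 2)"
proof -
  define i where "i = j div 2"
  let ?i = "real_of_int i"
  have i: "2 * i \<le> j" "j \<le> 2 * i + 1" unfolding i_def by presburger+
  have "2 * ?i \<le> real_of_int j" using i(1) by linarith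
  moreover have "real_of_int j \<le> real_of_int (2 * i + 1)" using i(2) by (simp only: of_int_le_iff)
  then have "real_of_int j + 1 \<le> 2 * (?i + 1)" by simp
  ultimately have "2 * ?i / 2 ^ Suc n \<le> real_of_int j / 2 ^ Suc n"
    "(real_of_int j + 1) / 2 ^ Suc n \<le> 2 * (?i + 1) / 2 ^ Suc n"
    by (simp_all add: divide_right_mono del: power_Suc)
  moreover have "2 * x / 2 ^ Suc n = x / 2 ^ n" for x :: real by simp
  ultimately show ?thesis
    unfolding closed_cell_def i_def[symmetric] by (auto simp only: atLeastatMost_subset_iff)
qed

lemma grid_subset_closed_cell: "grid n {j} \<subseteq> closed_cell n j"
  by (auto simp: grid_singleton closed_cell_def)

lemma closed_cell_subset_cball:
  assumes "\<lfloor>2 ^ n * x\<rfloor> = j"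
  shows "closed_cell n j \<subseteq> cball x (1 / 2 ^ n)"
proof
  fix y assume y: "y \<in> closed_cell n j"
  have "x \<in> grid n {j}" using assms by (simp add: grid_def)
  then have "real_of_int j / 2 ^ n \<le> x" "x \<le> real_of_int j / 2 ^ n + 1 / 2 ^ n"
    by (auto simp: grid_singleton add_divide_distrib)
  moreover have "real_of_int j / 2 ^ n \<le> y" "y \<le> real_of_int j / 2 ^ n + 1 / 2 ^ n"
    using y by (auto simp: closed_cell_def add_divide_distrib)
  ultimately show "y \<in> cball x (1 / 2 ^ n)" by (simp add: dist_real_def abs_le_iff)
qed

lemma finite_cells_off_tail: "finite {j. \<not> grid n {j} \<subseteq> tail m}"
proof -
  have "{j. \<not> grid n {j} \<subseteq> tail m} \<subseteq> (\<lambda>x. \<lfloor>2 ^ n * x\<rfloor>) ` {- real m..real m}"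
    by (auto simp: grid_def tail_def not_less)
  then show ?thesis by (rule finite_subset) (intro finite_floor_image bounded_closed_interval)
qed

text \<open>In a hitting process \<open>X\<close>, the equation \<open>X J = 0\<close> says that the set \<open>J\<close> is not hit.\<close>

definition coherent :: "(real set \<Rightarrow> real) \<Rightarrow> bool" where
  "coherent X \<longleftrightarrow> (\<exists>m. X (tail m) = 0) \<and>
    (\<forall>m. X (tail m) = 0 \<longrightarrow> X (tail (Suc m)) = 0) \<and>
    (\<forall>m n j. grid n {j} \<subseteq> tail m \<longrightarrow> X (tail m) = 0 \<longrightarrow> X (grid n {j}) = 0) \<and>
    (\<forall>n j. X (grid n {j div 2}) = 0 \<longrightarrow> X (grid (Suc n) {j}) = 0)"

definition limit_set :: "(real set \<Rightarrow> real) \<Rightarrow> real set" where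
  "limit_set X = (\<Inter>n. \<Union>j\<in>{j. X (grid n {j}) \<noteq> 0}. closed_cell n j)"

text \<open>If none of these sets is hit, then level \<open>n\<close> certifies that the limit set
  lies in \<open>U\<close>. The tail takes care of the infinitely many remote cells, which keeps the
  family finite.\<close>

definition avoided :: "nat \<Rightarrow> real set \<Rightarrow> real set set" where
  "avoided n U = insert (tail n)
    ((\<lambda>j. grid n {j}) ` {j. \<not> grid n {j} \<subseteq> tail n \<and> \<not> closed_cell n j \<subseteq> U})"

lemma finite_avoided: "finite (avoided n U)"
proof -
  have "finite {j. \<not> grid n {j} \<subseteq> tail n \<and> \<not> closed_cell n j \<subseteq> U}"
    by (rule finite_subset[OF _ finite_cells_off_tail[of n n]]) auto
  then show ?thesis by (simp add: avoided_def)
qed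

lemma frontier_avoided: "J \<in> avoided n U \<Longrightarrow> finite (frontier J)"
  by (auto simp: avoided_def frontier_tail finite_frontier_grid)

lemma Compl_Union_avoided: "- \<Union>(avoided n U) = {x. x \<notin> tail n \<and> closed_cell n \<lfloor>2 ^ n * x\<rfloor> \<subseteq> U}"
  by (auto simp: avoided_def grid_def)

context
  fixes X assumes X: "coherent X"
begin

lemma coherent_tail_mono:
  assumes "X (tail m) = 0" "m \<le> n"
  shows "X (tail n) = 0"
  using assms(2,1) X by (induction n rule: dec_induct) (auto simp: coherent_def)

lemma compact_level_set: "compact (\<Union>j\<in>{j. X (grid n {j}) \<noteq> 0}. closed_cell n j)"
proof -
  obtain m where "X (tail m) = 0" using X by (auto simp: coherent_def)
  then have "{j. X (grid n {j}) \<noteq> 0} \<subseteq> {j. \<not> grid n {j} \<subseteq> tail m}"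
    using X by (auto simp: coherent_def)
  then have "finite {j. X (grid n {j}) \<noteq> 0}" using finite_cells_off_tail by (rule finite_subset)
  then show ?thesis by (auto simp: closed_cell_def intro!: compact_UN)
qed

lemma decseq_level_set: "decseq (\<lambda>n. \<Union>j\<in>{j. X (grid n {j}) \<noteq> 0}. closed_cell n j)"
proof (rule decseq_SucI, clarify)
  fix n j x assume "X (grid (Suc n) {j}) \<noteq> 0" "x \<in> closed_cell (Suc n) j"
  then have "X (grid n {j div 2}) \<noteq> 0" "x \<in> closed_cell n (j div 2)"
    using X closed_cell_Suc_subset by (auto simp: coherent_def)
  then show "x \<in> (\<Union>j\<in>{j. X (grid n {j}) \<noteq> 0}. closed_cell n j)" by blast
qed

lemma compact_limit_set: "compact (limit_set X)"
  unfolding limit_set_def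
  by (intro compact_Inter) (use compact_level_set in auto)

text \<open>The level sets minus \<open>U\<close> are nested and compact; if their intersection is
  empty, one of them is empty. Containment thus becomes a countable union of events depending on
  finitely many coordinates.\<close>

lemma limit_set_subset_iff:
  assumes U: "open U"
  shows "limit_set X \<subseteq> U \<longleftrightarrow> (\<exists>n. \<forall>J\<in>avoided n U. X J = 0)"
proof
  let ?L = "\<lambda>n. \<Union>j\<in>{j. X (grid n {j}) \<noteq> 0}. closed_cell n j"
  assume sub: "limit_set X \<subseteq> U"
  have "\<exists>n. ?L n - U = {}"
  proof (rule ccontr)
    assume "\<not> ?thesis"
    then have ne: "\<And>n. ?L n - U \<noteq> {}" by blast
    have "\<Inter>(range (\<lambda>n. ?L n - U)) \<noteq> {}"
    proof (rule compact_nest[OF _ ne])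
      show "compact (?L n - U)" for n by (intro compact_diff compact_level_set U)
      show "?L n - U \<subseteq> ?L m - U" if "m \<le> n" for m n
        using decseqD[OF decseq_level_set that] by blast
    qed
    then show False using sub by (auto simp: limit_set_def)
  qed
  then obtain n where n: "?L n \<subseteq> U" by auto
  obtain m where m: "X (tail m) = 0" using X by (auto simp: coherent_def)
  \<comment> \<open>At this level the tail is missed and the level set lies in
    \<open>U\<close>.\<close>
  let ?N = "max m n"
  have "?L ?N \<subseteq> U" using decseqD[OF decseq_level_set, of n ?N] n by auto
  then have "\<And>j. \<not> closed_cell ?N j \<subseteq> U \<Longrightarrow> X (grid ?N {j}) = 0" by blast
  moreover have "X (tail ?N) = 0" using m by (rule coherent_tail_mono) simp
  ultimately have "\<forall>J\<in>avoided ?N U. X J = 0" by (auto simp: avoided_def)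
  then show "\<exists>n. \<forall>J\<in>avoided n U. X J = 0" ..
next
  assume "\<exists>n. \<forall>J\<in>avoided n U. X J = 0"
  then obtain n where n: "X (tail n) = 0"
    "\<And>j. \<not> grid n {j} \<subseteq> tail n \<Longrightarrow> \<not> closed_cell n j \<subseteq> U \<Longrightarrow> X (grid n {j}) = 0"
    by (auto simp: avoided_def)
  show "limit_set X \<subseteq> U"
  proof
    fix x assume "x \<in> limit_set X"
    then obtain j where j: "X (grid n {j}) \<noteq> 0" "x \<in> closed_cell n j" by (auto simp: limit_set_def)
    moreover have "\<not> grid n {j} \<subseteq> tail n" using X n(1) j(1) by (auto simp: coherent_def)
    ultimately show "x \<in> U" using n(2) by blast
  qed
qed

lemma coherent_avoided_Suc:
  assumes "\<forall>J\<in>avoided n U. X J = 0"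
  shows "\<forall>J\<in>avoided (Suc n) U. X J = 0"
proof -
  have n: "X (tail n) = 0"
    "\<And>j. \<not> grid n {j} \<subseteq> tail n \<Longrightarrow> \<not> closed_cell n j \<subseteq> U \<Longrightarrow> X (grid n {j}) = 0"
    using assms by (auto simp: avoided_def)
  have "X (grid (Suc n) {j}) = 0" if "\<not> closed_cell (Suc n) j \<subseteq> U" for j
  proof -
    have "\<not> closed_cell n (j div 2) \<subseteq> U" using that closed_cell_Suc_subset by blast
    then have "X (grid n {j div 2}) = 0"
      using n X by (cases "grid n {j div 2} \<subseteq> tail n") (auto simp: coherent_def)
    then show ?thesis using X by (auto simp: coherent_def)
  qed
  moreover have "X (tail (Suc n)) = 0" using n(1) by (rule coherent_tail_mono) simp
  ultimately show ?thesis by (auto simp: avoided_def)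
qed

end

section \<open>Spectral measures\<close>

context continuous_factorization
begin

text \<open>Inner continuity enters here: the field of an open interval is generated by those of
  intervals whose closure it contains, so it suffices that the \<open>W n\<close> exhaust
  \<open>U\<close> on compact intervals.\<close>

lemma region_field_subset_sigma_sets:
  assumes "\<And>a b. a < b \<Longrightarrow> {a..b} \<subseteq> U \<Longrightarrow> \<exists>n::nat. {a<..<b} \<subseteq> W n"
  shows "sets (region_field U) \<subseteq> sigma_sets (space M) (\<Union>n. sets (region_field (W n)))"
proof -
  let ?X = "\<Union>n. sets (region_field (W n))"
  have X: "?X \<subseteq> sets M" using region_field_sets by auto
  have "null_sets M \<subseteq> ?X" using subfield_null_sets[OF subfield_region_field] by blast
  then have eq: "sigma_sets (space M) ?X = sets (generated_field M ?X)"
    by (simp add: sets_generated_field[OF X] Un_absorb1)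
  show ?thesis unfolding eq
  proof (intro region_field_subsetI subfield_generated_field X)
    fix s t assume st: "s < t" "open_interval (s, t) \<subseteq> U"
    have "inner_events s t \<subseteq> ?X"
    proof
      fix A assume "A \<in> inner_events s t"
      then obtain a b where ab: "a < b" "s < ereal a" "ereal b < t" "A \<in> sets (F a b)"
        by (elim inner_eventsE)
      have "{a..b} \<subseteq> open_interval (s, t)"
      proof
        fix x assume "x \<in> {a..b}"
        then have "ereal a \<le> ereal x" "ereal x \<le> ereal b" by auto
        then show "x \<in> open_interval (s, t)"
          using less_le_trans[OF ab(2)] le_less_trans[OF _ ab(3)] by simp
      qed
      then obtain n where "{a<..<b} \<subseteq> W n" using assms[OF ab(1)] st(2) by blast
      then have "open_interval (ereal a, ereal b) \<subseteq> W n" by auto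
      then have "sets (F a b) \<subseteq> sets (region_field (W n))"
        using extended_field_region_field[of "ereal a" "ereal b"] ab(1) by (simp add: extended_field_F)
      then show "A \<in> ?X" using ab(4) by blast
    qed
    then show "sets (extended_field M F s t) \<subseteq> sets (generated_field M ?X)"
      unfolding extended_field_eq[OF st(1)] by (intro generated_field_mono X)
  qed
qed

lemma energy_tail_tendsto:
  assumes "f \<in> L2 M"
  shows "(\<lambda>m. energy f (- tail m)) \<longlonglongrightarrow> energy f UNIV"
proof (rule energy_tendsto[OF assms])
  show "incseq (\<lambda>m. - tail m)" using tail_Suc by (intro incseq_SucI) auto
  show "sets (region_field UNIV) \<subseteq> sigma_sets (space M) (\<Union>m. sets (region_field (- tail m)))"
  proof (rule region_field_subset_sigma_sets)
    fix a b :: real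
    obtain m :: nat where m: "max \<bar>a\<bar> \<bar>b\<bar> \<le> real m" using real_arch_simple by blast
    then have "{a<..<b} \<subseteq> - tail m" by (auto simp: tail_def)
    then show "\<exists>m. {a<..<b} \<subseteq> - tail m" ..
  qed
qed (auto simp: frontier_complement frontier_tail)

lemma incseq_Compl_avoided: "incseq (\<lambda>n. - \<Union>(avoided n U))"
proof (rule incseq_SucI, rule subsetI)
  fix n x assume x: "x \<in> - \<Union>(avoided n U)"
  let ?j = "\<lfloor>2 ^ Suc n * x\<rfloor>"
  have "?j div 2 = \<lfloor>2 ^ n * x\<rfloor>" using floor_double_div[of "2 ^ n * x"] by (simp add: mult.assoc)
  then have "closed_cell (Suc n) ?j \<subseteq> U"
    using x closed_cell_Suc_subset[of n ?j] unfolding Compl_Union_avoided by auto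
  then show "x \<in> - \<Union>(avoided (Suc n) U)"
    using x tail_Suc[of n] unfolding Compl_Union_avoided by auto
qed

lemma energy_avoided_tendsto:
  assumes f: "f \<in> L2 M" and U: "open U" "finite (frontier U)"
  shows "(\<lambda>n. energy f (- \<Union>(avoided n U))) \<longlonglongrightarrow> energy f U"
proof (rule energy_tendsto[OF f])
  show "finite (frontier (- \<Union>(avoided n U)))" for n
    unfolding frontier_complement by (intro finite_frontier_Union finite_avoided frontier_avoided)
  show "finite (frontier U)" by fact
  show "incseq (\<lambda>n. - \<Union>(avoided n U))" by (rule incseq_Compl_avoided)
  show "- \<Union>(avoided n U) \<subseteq> U" for n
    unfolding Compl_Union_avoided using grid_subset_closed_cell[of n] by (fastforce simp: grid_def)
  show "sets (region_field U) \<subseteq> sigma_sets (space M) (\<Union>n. sets (region_field (- \<Union>(avoided n U))))"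
  proof (rule region_field_subset_sigma_sets)
    fix a b assume ab: "a < b" "{a..b} \<subseteq> U"
    obtain e where e: "0 < e" "(\<Union>x\<in>{a..b}. cball x e) \<subseteq> U"
      using compact_subset_open_imp_cball_epsilon_subset[OF compact_Icc U(1) ab(2)] by blast
    obtain n1 where n1: "(1/2::real) ^ n1 < e" using real_arch_pow_inv[OF e(1), of "1/2"] by auto
    obtain n2 :: nat where n2: "max \<bar>a\<bar> \<bar>b\<bar> \<le> real n2" using real_arch_simple by blast
    \<comment> \<open>\<open>n1\<close> makes the cells smaller than the distance to the complement
      of \<open>U\<close>, and \<open>n2\<close> moves the tail beyond \<open>a\<close> and
      \<open>b\<close>.\<close>
    let ?n = "max n1 n2"
    have "(1/2::real) ^ ?n \<le> (1/2) ^ n1" by (rule power_decreasing) auto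
    then have small: "1 / 2 ^ ?n \<le> e" using n1 by (simp add: power_one_over)
    have "{a<..<b} \<subseteq> - \<Union>(avoided ?n U)"
      unfolding Compl_Union_avoided
    proof (rule subsetI, rule CollectI, rule conjI)
      fix x assume x: "x \<in> {a<..<b}"
      show "x \<notin> tail ?n" using x n2 by (auto simp: tail_def)
      have "closed_cell ?n \<lfloor>2 ^ ?n * x\<rfloor> \<subseteq> cball x (1 / 2 ^ ?n)" by (rule closed_cell_subset_cball) simp
      also have "\<dots> \<subseteq> cball x e" using small by auto
      also have "\<dots> \<subseteq> U" using e(2) x by fastforce
      finally show "closed_cell ?n \<lfloor>2 ^ ?n * x\<rfloor> \<subseteq> U" .
    qed
    then show "\<exists>n. {a<..<b} \<subseteq> - \<Union>(avoided n U)" ..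
  qed
qed

text \<open>Although the process has uncountably many coordinates, coherence consists of countably
  many relations between cells and tails; each holds almost surely, so the limit set is available on
  almost every path.\<close>

lemma random_set_exists:
  assumes f: "f \<in> L2 M" and c: "c = (\<integral>x. (f x)\<^sup>2 \<partial>M)" "0 < c"
  shows "\<exists>\<mu>. prob_space \<mu> \<and> sets \<mu> = sets compacts_borel \<and>
    (\<forall>U. open U \<and> finite (frontier U) \<longrightarrow> measure \<mu> {K \<in> compacts. K \<subseteq> U} = energy f U / c)"
proof -
  from hitting_process_exists[OF assms] obtain N :: "(real set \<Rightarrow> real) measure" where
    "prob_space N \<and> sets N = sets (PiM {J. finite (frontier J)} (\<lambda>_. borel)) \<and>
    (\<forall>A. finite A \<and> (\<forall>J\<in>A. finite (frontier J)) \<longrightarrow>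
      measure N {X \<in> space N. \<forall>J\<in>A. X J = 0} = energy f (- \<Union>A) / c)" ..
  then have "prob_space N" and sets_N: "sets N = sets (PiM {J. finite (frontier J)} (\<lambda>_. borel))"
    and N: "\<And>A. finite A \<Longrightarrow> (\<And>J. J \<in> A \<Longrightarrow> finite (frontier J)) \<Longrightarrow>
      measure N {X \<in> space N. \<forall>J\<in>A. X J = 0} = energy f (- \<Union>A) / c"
    by simp_all
  interpret N: prob_space N by fact
  have coord: "(\<lambda>X. X J) \<in> borel_measurable N" if "finite (frontier J)" for J
    using that measurable_component_singleton[of J "{J. finite (frontier J)}" "\<lambda>_. borel"]
    unfolding measurable_cong_sets[OF sets_N refl] by simp
  have pred[measurable]: "Measurable.pred N (\<lambda>X. X (tail m) = 0)"
    "Measurable.pred N (\<lambda>X. X (grid n {j}) = 0)" for m n j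
    using coord[OF frontier_tail[of m]] coord[OF finite_frontier_grid[of "{j}" n]] by measurable
  have coherent[measurable]: "Measurable.pred N coherent"
    unfolding coherent_def by measurable
  have avoided[measurable]: "Measurable.pred N (\<lambda>X. \<forall>J\<in>avoided n U. X J = 0)" for n U
    using finite_avoided coord[OF frontier_avoided] by measurable
  \<comment> \<open>Missing \<open>J'\<close> in addition to \<open>J\<close> does not change the
    complement of the union, hence not the energy; so the exceptional event has probability
    zero.\<close>
  have sub: "AE X in N. X J = 0 \<longrightarrow> X J' = 0"
    if J: "finite (frontier J)" "finite (frontier J')" "J' \<subseteq> J" for J J'
  proof -
    have [measurable]: "(\<lambda>X. X J) \<in> borel_measurable N" "(\<lambda>X. X J') \<in> borel_measurable N"
      using J by (auto intro: coord)
    have "measure N {X \<in> space N. \<forall>L\<in>{J}. X L = 0} = energy f (- \<Union>{J}) / c"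
      using J by (intro N) auto
    moreover have "measure N {X \<in> space N. \<forall>L\<in>{J, J'}. X L = 0} = energy f (- \<Union>{J, J'}) / c"
      using J by (intro N) auto
    moreover have "- J \<inter> - J' = - J" using J(3) by auto
    ultimately have "measure N {X \<in> space N. X J = 0} = measure N {X \<in> space N. X J = 0 \<and> X J' = 0}" by simp
    moreover have "{X \<in> space N. X J = 0 \<and> X J' \<noteq> 0} =
        {X \<in> space N. X J = 0} - {X \<in> space N. X J = 0 \<and> X J' = 0}" by auto
    moreover have "measure N ({X \<in> space N. X J = 0} - {X \<in> space N. X J = 0 \<and> X J' = 0}) =
        measure N {X \<in> space N. X J = 0} - measure N {X \<in> space N. X J = 0 \<and> X J' = 0}"
      by (intro N.finite_measure_Diff) auto
    ultimately have "measure N {X \<in> space N. X J = 0 \<and> X J' \<noteq> 0} = 0" by simp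
    then have "AE X in N. \<not> (X J = 0 \<and> X J' \<noteq> 0)"
      by (subst AE_iff_measurable[OF _ refl]) (auto simp: N.emeasure_eq_measure)
    then show ?thesis by eventually_elim auto
  qed
  have "AE X in N. \<exists>m. X (tail m) = 0"
  proof -
    \<comment> \<open>The probability of missing \<open>tail m\<close> is the normalised energy on
      its complement, which tends to 1.\<close>
    let ?A = "{X \<in> space N. \<exists>m. X (tail m) = 0}"
    have le: "energy f (- tail m) / c \<le> measure N ?A" for m
    proof -
      have "energy f (- tail m) / c = measure N {X \<in> space N. \<forall>J\<in>{tail m}. X J = 0}"
        using N[of "{tail m}"] frontier_tail by simp
      also have "\<dots> \<le> measure N ?A" by (intro N.finite_measure_mono) auto
      finally show ?thesis .
    qed
    have "(\<lambda>m. energy f (- tail m) / c) \<longlonglongrightarrow> energy f UNIV / c"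
      using c(2) by (intro tendsto_divide energy_tail_tendsto f tendsto_const) auto
    then have "energy f UNIV / c \<le> measure N ?A"
      using le by (intro LIMSEQ_le_const2) auto
    then have "1 \<le> measure N ?A" using energy_UNIV[OF f] c by simp
    then have "measure N ?A = 1" using N.prob_le_1[of ?A] by linarith
    then show ?thesis using N.AE_prob_1[of ?A] by auto
  qed
  moreover have "AE X in N. \<forall>m. X (tail m) = 0 \<longrightarrow> X (tail (Suc m)) = 0"
    using tail_Suc by (auto simp: AE_all_countable intro!: sub frontier_tail)
  moreover have "AE X in N. \<forall>m n j. grid n {j} \<subseteq> tail m \<longrightarrow> X (tail m) = 0 \<longrightarrow> X (grid n {j}) = 0"
    unfolding AE_all_countable
    by (intro allI AE_impI sub frontier_tail finite_frontier_grid) auto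
  moreover have "AE X in N. \<forall>n j. X (grid n {j div 2}) = 0 \<longrightarrow> X (grid (Suc n) {j}) = 0"
    unfolding AE_all_countable
    by (intro allI sub grid_Suc_subset finite_frontier_grid) auto
  ultimately have AE_coherent: "AE X in N. coherent X"
    unfolding coherent_def by eventually_elim blast
  \<comment> \<open>The default \<open>{}\<close> is compact and contained in every
    \<open>U\<close>, hence the implication in \<kappa>_iff.\<close>
  define \<kappa> where "\<kappa> X = (if coherent X then limit_set X else {})" for X
  have \<kappa>_iff: "\<kappa> X \<subseteq> U \<longleftrightarrow> (coherent X \<longrightarrow> (\<exists>n. \<forall>J\<in>avoided n U. X J = 0))" if "open U" for X U
    using that by (auto simp: \<kappa>_def limit_set_subset_iff)
  have \<kappa>_compact: "\<kappa> X \<in> compacts" for X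
    by (simp add: \<kappa>_def compacts_def compact_limit_set)
  have vimage: "\<kappa> -` {K \<in> compacts. K \<subseteq> U} \<inter> space N =
      {X \<in> space N. coherent X \<longrightarrow> (\<exists>n. \<forall>J\<in>avoided n U. X J = 0)}" if "open U" for U
    using \<kappa>_iff[OF that] \<kappa>_compact by auto
  have \<kappa>_meas: "\<kappa> \<in> N \<rightarrow>\<^sub>M compacts_borel"
  proof (rule measurable_sigma_sets[OF sets_compacts_borel containment_sets_Pow])
    fix A assume "A \<in> containment_sets"
    then obtain U where U: "A = {K \<in> compacts. K \<subseteq> U}" "open U" by (auto simp: containment_sets_def)
    show "\<kappa> -` A \<inter> space N \<in> sets N"
      unfolding U(1) vimage[OF U(2)] by measurable
  qed (use \<kappa>_compact in auto)
  have "measure (distr N compacts_borel \<kappa>) {K \<in> compacts. K \<subseteq> U} = energy f U / c"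
    if U: "open U" "finite (frontier U)" for U
  proof -
    let ?B = "\<lambda>n. {X \<in> space N. coherent X \<and> (\<forall>J\<in>avoided n U. X J = 0)}"
    have "measure (distr N compacts_borel \<kappa>) {K \<in> compacts. K \<subseteq> U} =
        measure N {X \<in> space N. coherent X \<longrightarrow> (\<exists>n. \<forall>J\<in>avoided n U. X J = 0)}"
      using U vimage[OF U(1)] by (subst measure_distr[OF \<kappa>_meas]) auto
    also have "\<dots> = measure N (\<Union>n. ?B n)"
      using AE_coherent by (intro N.finite_measure_eq_AE) (auto elim: eventually_mono)
    finally have "measure (distr N compacts_borel \<kappa>) {K \<in> compacts. K \<subseteq> U} = measure N (\<Union>n. ?B n)" .
    moreover have "(\<lambda>n. measure N (?B n)) \<longlonglongrightarrow> measure N (\<Union>n. ?B n)"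
    proof (rule N.finite_Lim_measure_incseq)
      show "range ?B \<subseteq> sets N" by auto
      show "incseq ?B" using coherent_avoided_Suc by (intro incseq_SucI) blast
    qed
    ultimately have lim: "(\<lambda>n. measure N (?B n)) \<longlonglongrightarrow>
        measure (distr N compacts_borel \<kappa>) {K \<in> compacts. K \<subseteq> U}" by (simp only:)
    have "measure N (?B n) = energy f (- \<Union>(avoided n U)) / c" for n
    proof -
      have "measure N (?B n) = measure N {X \<in> space N. \<forall>J\<in>avoided n U. X J = 0}"
        using AE_coherent by (intro N.finite_measure_eq_AE) (auto elim: eventually_mono)
      also have "\<dots> = energy f (- \<Union>(avoided n U)) / c"
        by (intro N finite_avoided frontier_avoided)
      finally show ?thesis .
    qed
    then have "(\<lambda>n. measure N (?B n)) \<longlonglongrightarrow> energy f U / c"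
      using c(2) by (simp add: tendsto_divide energy_avoided_tendsto f U)
    then show ?thesis using lim LIMSEQ_unique by blast
  qed
  then show ?thesis
    using N.prob_space_distr[OF \<kappa>_meas] by (intro exI[of _ "distr N compacts_borel \<kappa>"]) auto
qed

text \<open>A point is almost surely not in \<open>K\<close>. So the finitely many frontier points
  may be dropped, and \<open>E\<close> replaced by its interior, without changing mass or
  energy.\<close>

lemma containment_measure_extend:
  assumes f: "f \<in> L2 M" and \<mu>: "finite_measure \<mu>" "sets \<mu> = sets compacts_borel"
    and eq: "\<And>U. open U \<Longrightarrow> finite (frontier U) \<Longrightarrow> measure \<mu> {K \<in> compacts. K \<subseteq> U} = energy f U"
    and E: "finite (frontier E)"
  shows "measure \<mu> {K \<in> compacts. K \<subseteq> E} = energy f E"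
proof -
  interpret finite_measure \<mu> by fact
  have sp: "space \<mu> = compacts"
    using sets_eq_imp_space_eq[OF \<mu>(2)] space_compacts_borel by simp
  have ms: "{K \<in> compacts. K \<subseteq> E} \<in> sets \<mu>" if "finite (frontier E)" for E
    using containment_in_compacts_borel[OF that] \<mu>(2) by simp
  have point: "AE K in \<mu>. t \<notin> K" for t
  proof -
    have fr: "finite (frontier (- {t}))" "open (- {t})"
      by (auto simp: frontier_complement finite_frontier_finite)
    have "compacts - {K \<in> compacts. K \<subseteq> - {t}} = {K \<in> space \<mu>. \<not> t \<notin> K}" using sp by auto
    moreover have "measure \<mu> (space \<mu> - {K \<in> compacts. K \<subseteq> - {t}}) = 0"
      using eq[of UNIV] eq[OF fr(2,1)] energy_cong_finite[of UNIV "- {t}" f]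
      by (subst finite_measure_compl[OF ms[OF fr(1)]]) (simp add: sp)
    ultimately have "emeasure \<mu> {K \<in> space \<mu>. \<not> t \<notin> K} = 0" by (simp add: emeasure_eq_measure sp)
    moreover have "{K \<in> space \<mu>. \<not> t \<notin> K} = space \<mu> - {K \<in> compacts. K \<subseteq> - {t}}" using sp by auto
    then have "{K \<in> space \<mu>. \<not> t \<notin> K} \<in> sets \<mu>" using ms[OF fr(1)] by simp
    ultimately show ?thesis by (subst AE_iff_measurable[OF _ refl])
  qed
  have fi: "finite (frontier (interior E))"
    using E by (rule finite_subset[rotated])
      (use closure_mono[OF interior_subset[of E]] in \<open>auto simp: frontier_def\<close>)
  have "AE K in \<mu>. \<forall>t\<in>frontier E. t \<notin> K"
    using E point by (simp add: AE_ball_countable countable_finite)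
  then have "measure \<mu> {K \<in> compacts. K \<subseteq> E} = measure \<mu> {K \<in> compacts. K \<subseteq> interior E}"
  proof (intro finite_measure_eq_AE ms E fi, eventually_elim)
    case (elim K)
    have "E \<subseteq> interior E \<union> frontier E" using closure_subset[of E] by (auto simp: frontier_def)
    then show ?case using elim interior_subset[of E] by blast
  qed
  also have "\<dots> = energy f (interior E)" using fi by (intro eq) auto
  also have "\<dots> = energy f E"
  proof (rule energy_cong_finite)
    have "sym_diff (interior E) E \<subseteq> frontier E"
      using closure_subset[of E] interior_subset[of E] by (auto simp: frontier_def)
    then show "finite (sym_diff (interior E) E)" using E by (rule finite_subset)
  qed
  finally show ?thesis .
qed

lemma is_spectral_measure_iff:
  "is_spectral_measure M F f \<mu> \<longleftrightarrow> finite_measure \<mu> \<and> sets \<mu> = sets compacts_borel \<and>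
    (\<forall>E. finite (frontier E) \<longrightarrow> measure \<mu> {K \<in> compacts. K \<subseteq> E} = energy f E)"
proof -
  have "space \<mu> = compacts" if "sets \<mu> = sets compacts_borel"
    using sets_eq_imp_space_eq[OF that] space_compacts_borel by simp
  moreover have "(\<forall>E I. elementary_set E \<and> decomposes_into E I \<longrightarrow>
        measure \<mu> {K \<in> compacts. K \<subseteq> E} =
        (\<integral>x. (real_cond_exp M (elementary_field M F I) f x)\<^sup>2 \<partial>M)) \<longleftrightarrow>
      (\<forall>E. finite (frontier E) \<longrightarrow> measure \<mu> {K \<in> compacts. K \<subseteq> E} = energy f E)"
    (is "?L \<longleftrightarrow> ?R")
  proof
    assume L: ?L
    show ?R
    proof (intro allI impI)
      fix E :: "real set" assume E: "finite (frontier E)"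
      obtain I where I: "decomposes_into E I" using decomposition_exists[OF E] ..
      show "measure \<mu> {K \<in> compacts. K \<subseteq> E} = energy f E"
        using L E I by (simp add: elementary_set_iff energy_def elementary_field_eq_region_field)
    qed
  next
    assume ?R
    then show ?L
      by (auto simp: elementary_set_iff energy_def elementary_field_eq_region_field)
  qed
  ultimately show ?thesis unfolding is_spectral_measure_def by blast
qed

lemma is_spectral_measure_exists:
  assumes f: "f \<in> L2 M"
  shows "\<exists>\<mu>. is_spectral_measure M F f \<mu>"
proof (cases "(\<integral>x. (f x)\<^sup>2 \<partial>M) = 0")
  \<comment> \<open>A function of norm zero cannot be normalised to give a probability measure; the
    null measure serves instead.\<close>
  case True
  then have "energy f E = 0" for E
    using energy_le[OF f, of E] energy_nonneg[of f E] by simp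
  moreover have "finite_measure (null_measure compacts_borel)" by (rule finite_measureI) simp
  ultimately have "is_spectral_measure M F f (null_measure compacts_borel)"
    by (simp add: is_spectral_measure_iff)
  then show ?thesis ..
next
  case False
  define c where "c = (\<integral>x. (f x)\<^sup>2 \<partial>M)"
  have "0 \<le> c" by (simp add: c_def)
  then have c: "0 < c" using False unfolding c_def by linarith
  obtain \<mu> where \<mu>: "prob_space \<mu>" "sets \<mu> = sets compacts_borel"
    "\<And>U. open U \<Longrightarrow> finite (frontier U) \<Longrightarrow> measure \<mu> {K \<in> compacts. K \<subseteq> U} = energy f U / c"
    using random_set_exists[OF f c_def c] by blast
  interpret \<mu>: prob_space \<mu> by fact
  let ?\<nu> = "scale_measure (ennreal c) \<mu>"
  have fin: "finite_measure ?\<nu>"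
    by (rule finite_measureI) (simp add: space_scale_measure \<mu>.emeasure_space_1)
  have "measure ?\<nu> {K \<in> compacts. K \<subseteq> E} = energy f E" if "finite (frontier E)" for E
  proof (rule containment_measure_extend[OF f fin _ _ that])
    show "measure ?\<nu> {K \<in> compacts. K \<subseteq> U} = energy f U" if "open U" "finite (frontier U)" for U
      using \<mu>(3)[OF that] c by (simp add: measure_def enn2real_mult)
  qed (simp add: \<mu>(2))
  then have "is_spectral_measure M F f ?\<nu>"
    using fin \<mu>(2) by (simp add: is_spectral_measure_iff)
  then show ?thesis ..
qed

end

text \<open>A Dynkin class argument for linear combinations of measures. It transfers every linear
  relation between energies to the masses of arbitrary Borel sets, uniqueness being the relation
  with coefficients 1 and -1.\<close>

lemma containment_linear_relation:
  fixes \<mu> :: "'i \<Rightarrow> real set measure" and a :: "'i \<Rightarrow> real"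
  assumes I: "finite I" and fin: "\<And>i. i \<in> I \<Longrightarrow> finite_measure (\<mu> i)"
    and sets: "\<And>i. i \<in> I \<Longrightarrow> sets (\<mu> i) = sets compacts_borel"
    and rel: "\<And>U. open U \<Longrightarrow> finite (frontier U) \<Longrightarrow> (\<Sum>i\<in>I. a i * measure (\<mu> i) {K \<in> compacts. K \<subseteq> U}) = 0"
    and S: "S \<in> sets compacts_borel"
  shows "(\<Sum>i\<in>I. a i * measure (\<mu> i) S) = 0"
proof -
  have sp: "space (\<mu> i) = compacts" if "i \<in> I" for i
    using sets_eq_imp_space_eq[OF sets[OF that]] space_compacts_borel by simp
  have "S \<in> sigma_sets compacts containment_sets" using S by (simp add: sets_compacts_borel)
  from Int_stable_containment_sets containment_sets_Pow this show ?thesis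
  proof (induction rule: sigma_sets_induct_disjoint)
    case (basic A)
    then show ?case using rel by (auto simp: containment_sets_def)
  next
    case empty
    then show ?case by simp
  next
    case (compl A)
    have total: "(\<Sum>i\<in>I. a i * measure (\<mu> i) compacts) = 0" using rel[of UNIV] by simp
    have "(\<Sum>i\<in>I. a i * measure (\<mu> i) (compacts - A)) =
        (\<Sum>i\<in>I. a i * measure (\<mu> i) compacts - a i * measure (\<mu> i) A)"
    proof (rule sum.cong[OF refl])
      fix i assume i: "i \<in> I"
      have "A \<in> sets (\<mu> i)" using compl(1) sets[OF i] by (simp add: sets_compacts_borel)
      then show "a i * measure (\<mu> i) (compacts - A) = a i * measure (\<mu> i) compacts - a i * measure (\<mu> i) A"
        using finite_measure.finite_measure_compl[OF fin[OF i]] sp[OF i] by (simp add: right_diff_distrib)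
    qed
    then show ?case using total compl(2) by (simp add: sum_subtractf)
  next
    case (union A)
    have "(\<lambda>k. a i * measure (\<mu> i) (A k)) sums (a i * measure (\<mu> i) (\<Union>k. A k))" if i: "i \<in> I" for i
    proof (intro sums_mult finite_measure.finite_measure_UNION[OF fin[OF i]])
      show "range A \<subseteq> sets (\<mu> i)" using union(2) sets[OF i] by (simp add: sets_compacts_borel)
    qed (rule union(1))
    then have "(\<lambda>k. \<Sum>i\<in>I. a i * measure (\<mu> i) (A k)) sums (\<Sum>i\<in>I. a i * measure (\<mu> i) (\<Union>k. A k))"
      by (rule sums_sum)
    then have "(\<lambda>k. 0) sums (\<Sum>i\<in>I. a i * measure (\<mu> i) (\<Union>k. A k))"
      using union(3) by simp
    then show ?case using sums_unique2[OF sums_zero] by metis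
  qed
qed

context continuous_factorization
begin

section \<open>Uniqueness, and the choice of the spectral measure\<close>

lemma is_spectral_measure_unique:
  assumes "is_spectral_measure M F f \<mu>" "is_spectral_measure M F f \<nu>"
  shows "\<mu> = \<nu>"
proof -
  have *: "finite_measure \<mu>" "finite_measure \<nu>" "sets \<mu> = sets compacts_borel" "sets \<nu> = sets compacts_borel"
    "\<And>E. finite (frontier E) \<Longrightarrow> measure \<mu> {K \<in> compacts. K \<subseteq> E} = measure \<nu> {K \<in> compacts. K \<subseteq> E}"
    using assms by (auto simp: is_spectral_measure_iff)
  show ?thesis
  proof (rule measure_eqI)
    show "sets \<mu> = sets \<nu>" using * by simp
    fix S assume S: "S \<in> sets \<mu>"
    have "(\<Sum>b\<in>UNIV. (if b then 1 else - 1) * measure (if b then \<mu> else \<nu>) S) = 0"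
    proof (rule containment_linear_relation)
      show "S \<in> sets compacts_borel" using S *(3) by simp
      show "(\<Sum>b\<in>UNIV. (if b then 1 else - 1) * measure (if b then \<mu> else \<nu>) {K \<in> compacts. K \<subseteq> U}) = 0"
        if "finite (frontier U)" for U
        using *(5)[OF that] by (simp add: UNIV_bool)
    qed (use *(1-4) in simp_all)
    then have "measure \<mu> S = measure \<nu> S" by (simp add: UNIV_bool)
    then show "emeasure \<mu> S = emeasure \<nu> S"
      using *(1,2) by (simp add: finite_measure.emeasure_eq_measure)
  qed
qed

lemma is_spectral_measure_spectral_measure:
  assumes "f \<in> L2 M"
  shows "is_spectral_measure M F f (spectral_measure M F f)"
  unfolding spectral_measure_def
proof (rule theI')
  show "\<exists>!\<mu>. is_spectral_measure M F f \<mu>"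
    using is_spectral_measure_exists[OF assms] is_spectral_measure_unique[of f] by (intro ex_ex1I)
qed

end

section \<open>Counting points by dyadic cells\<close>

definition dyadic_cells :: "nat \<Rightarrow> real set \<Rightarrow> int set" where
  "dyadic_cells n K = (\<lambda>x. \<lfloor>2 ^ n * x\<rfloor>) ` K"

lemma subset_grid_iff: "K \<subseteq> grid n R \<longleftrightarrow> dyadic_cells n K \<subseteq> R"
  by (auto simp: grid_def dyadic_cells_def)

lemma finite_dyadic_cells: "K \<in> compacts \<Longrightarrow> finite (dyadic_cells n K)"
  unfolding dyadic_cells_def by (intro finite_floor_image) (simp add: compacts_def compact_imp_bounded)

lemma eventually_card_dyadic_cells:
  assumes "finite B"
  shows "\<forall>\<^sub>F n in sequentially. card (dyadic_cells n B) = card B"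
proof -
  have "\<forall>\<^sub>F n in sequentially. \<lfloor>2 ^ n * x\<rfloor> \<noteq> \<lfloor>2 ^ n * y\<rfloor>" if ne: "x \<noteq> y" for x y :: real
  proof -
    obtain N where N: "(1/2::real) ^ N < dist x y"
      using real_arch_pow_inv[of "dist x y" "1/2"] ne by auto
    show ?thesis
      using eventually_ge_at_top[of N]
    proof eventually_elim
      case (elim n)
      have "(1/2::real) ^ n \<le> (1/2) ^ N" using elim by (intro power_decreasing) auto
      then show ?case using same_cell_dist[of n x y] N by (auto simp: power_one_over)
    qed
  qed
  then have "\<forall>\<^sub>F n in sequentially. \<forall>x\<in>B. \<forall>y\<in>B. x \<noteq> y \<longrightarrow> \<lfloor>2 ^ n * x\<rfloor> \<noteq> \<lfloor>2 ^ n * y\<rfloor>"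
    using assms by (intro eventually_ball_finite ballI) auto
  then show ?thesis
    by eventually_elim (auto simp: dyadic_cells_def intro!: card_image inj_onI)
qed

lemma eventually_card_dyadic_cells_ge:
  assumes K: "K \<in> compacts" and "infinite K"
  shows "\<forall>\<^sub>F n in sequentially. m \<le> card (dyadic_cells n K)"
proof -
  obtain B where B: "B \<subseteq> K" "finite B" "card B = m"
    using infinite_arbitrarily_large[OF \<open>infinite K\<close>] by blast
  show ?thesis
    using eventually_card_dyadic_cells[OF B(2)]
  proof eventually_elim
    case (elim n)
    have "card (dyadic_cells n B) \<le> card (dyadic_cells n K)"
      using B(1) by (intro card_mono finite_dyadic_cells K) (auto simp: dyadic_cells_def)
    then show ?case using elim B(3) by simp
  qed
qed

text \<open>Every finite subset is eventually separated by the cells, so a bound on the numbers of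
  occupied cells bounds the number of points. This makes finiteness a countable combination of
  conditions.\<close>

lemma finite_iff_card_dyadic_cells:
  assumes "K \<in> compacts"
  shows "finite K \<longleftrightarrow> (\<exists>m. \<forall>n. card (dyadic_cells n K) \<le> m)"
proof
  assume "finite K"
  then have "\<forall>n. card (dyadic_cells n K) \<le> card K"
    unfolding dyadic_cells_def by (auto intro: card_image_le)
  then show "\<exists>m. \<forall>n. card (dyadic_cells n K) \<le> m" ..
next
  assume "\<exists>m. \<forall>n. card (dyadic_cells n K) \<le> m"
  then obtain m where m: "\<And>n. card (dyadic_cells n K) \<le> m" by blast
  show "finite K"
  proof (rule ccontr)
    assume "infinite K"
    from eventually_card_dyadic_cells_ge[OF assms this, of "Suc m"]
    obtain n where "Suc m \<le> card (dyadic_cells n K)" by (auto simp: eventually_sequentially)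
    then show False using m[of n] by simp
  qed
qed

definition finite_compacts :: "real set set" where
  "finite_compacts = {K \<in> compacts. finite K}"

definition infinite_compacts :: "real set set" where
  "infinite_compacts = {K \<in> compacts. infinite K}"

text \<open>At most \<open>m\<close> cells are occupied if and only if some set of at most
  \<open>m\<close> cells contains \<open>K\<close>; there are countably many candidates.\<close>

lemma finite_compacts_sets [measurable]: "finite_compacts \<in> sets compacts_borel"
proof -
  have card: "{K \<in> compacts. card (dyadic_cells n K) \<le> m} \<in> sets compacts_borel" for n m
  proof -
    let ?R = "{R :: int set. finite R \<and> card R \<le> m}"
    have "{K \<in> compacts. card (dyadic_cells n K) \<le> m} = (\<Union>R\<in>?R. {K \<in> compacts. K \<subseteq> grid n R})"
    proof (intro subset_antisym subsetI)
      fix K assume "K \<in> (\<Union>R\<in>?R. {K \<in> compacts. K \<subseteq> grid n R})"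
      then obtain R where "finite R" "card R \<le> m" "K \<in> compacts" "dyadic_cells n K \<subseteq> R"
        by (auto simp: subset_grid_iff)
      then show "K \<in> {K \<in> compacts. card (dyadic_cells n K) \<le> m}"
        using card_mono[of R "dyadic_cells n K"] by auto
    qed (auto simp: subset_grid_iff intro!: finite_dyadic_cells)
    also have "\<dots> \<in> sets compacts_borel"
    proof (rule sets.countable_UN'')
      show "countable ?R" by (rule countable_subset[OF _ countable_Collect_finite]) auto
    qed (auto intro!: containment_in_compacts_borel finite_frontier_grid)
    finally show ?thesis .
  qed
  have "finite_compacts = (\<Union>m. \<Inter>n. {K \<in> compacts. card (dyadic_cells n K) \<le> m})"
    using finite_iff_card_dyadic_cells by (auto simp: finite_compacts_def)
  also have "\<dots> \<in> sets compacts_borel"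
    using card by (intro sets.countable_UN sets.countable_INT image_subsetI) auto
  finally show ?thesis .
qed

lemma infinite_compacts_eq: "infinite_compacts = compacts - finite_compacts"
  by (auto simp: infinite_compacts_def finite_compacts_def)

lemma compacts_sets [measurable]: "compacts \<in> sets compacts_borel"
  using sets.top[of compacts_borel] by (simp add: space_compacts_borel)

lemma infinite_compacts_sets [measurable]: "infinite_compacts \<in> sets compacts_borel"
  unfolding infinite_compacts_eq by measurable

text \<open>Keep each of the cells in \<open>A\<close> independently with probability \<open>\<rho>\<close>: the left-hand side is the
  probability that all cells in \<open>k\<close> are kept.\<close>

lemma sum_Pow_retention:
  fixes \<rho> :: real
  assumes "finite A" "finite k"
  shows "(\<Sum>R\<in>Pow A. \<rho> ^ card R * (1 - \<rho>) ^ card (A - R) * (if k \<subseteq> R then 1 else 0)) =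
    (if k \<subseteq> A then \<rho> ^ card k else 0)"
proof (cases "k \<subseteq> A")
  case False
  then have "(\<Sum>R\<in>Pow A. \<rho> ^ card R * (1 - \<rho>) ^ card (A - R) * (if k \<subseteq> R then 1 else 0)) = 0"
    by (intro sum.neutral) auto
  then show ?thesis using False by simp
next
  case True
  \<comment> \<open>Discarding a cell of \<open>k\<close> costs the factor zero. This absorbs the
    indicator of \<open>k \<subseteq> R\<close> into the product, which can then be factorised over
    the cells.\<close>
  let ?y = "\<lambda>a. if a \<in> k then 0 else 1 - \<rho>"
  have "(\<Sum>R\<in>Pow A. \<rho> ^ card R * (1 - \<rho>) ^ card (A - R) * (if k \<subseteq> R then 1 else 0)) =
      (\<Sum>R\<in>Pow A. (\<Prod>a\<in>R. \<rho>) * (\<Prod>a\<in>A - R. ?y a))"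
  proof (rule sum.cong[OF refl])
    fix R assume R: "R \<in> Pow A"
    show "\<rho> ^ card R * (1 - \<rho>) ^ card (A - R) * (if k \<subseteq> R then 1 else 0) =
        (\<Prod>a\<in>R. \<rho>) * (\<Prod>a\<in>A - R. ?y a)"
    proof (cases "k \<subseteq> R")
      case True
      then have "(\<Prod>a\<in>A - R. ?y a) = (\<Prod>a\<in>A - R. 1 - \<rho>)" by (intro prod.cong) auto
      then show ?thesis using True by simp
    next
      case False
      then obtain a where "a \<in> k" "a \<in> A - R" using \<open>k \<subseteq> A\<close> by auto
      then have "(\<Prod>a\<in>A - R. ?y a) = 0" using assms(1) by (auto intro!: prod_zero)
      then show ?thesis using False by simp
    qed
  qed
  also have "\<dots> = (\<Prod>a\<in>A. \<rho> + ?y a)" by (rule prod_add[OF assms(1), symmetric])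
  also have "\<dots> = (\<Prod>a\<in>A. if a \<in> k then \<rho> else 1)" by (intro prod.cong) auto
  also have "\<dots> = \<rho> ^ card (A \<inter> k)"
    using assms(1) by (simp add: prod.inter_restrict[symmetric])
  also have "A \<inter> k = k" using True by auto
  finally show ?thesis using True by simp
qed

section \<open>The mass of the spectral measure on Borel sets\<close>

context continuous_factorization
begin

definition spectral_mass :: "('a \<Rightarrow> real) \<Rightarrow> real set set \<Rightarrow> real" where
  "spectral_mass f S = measure (spectral_measure M F f) S"

lemma spectral_mass_nonneg [simp]: "0 \<le> spectral_mass f S"
  by (simp add: spectral_mass_def)

lemma
  assumes "f \<in> L2 M"
  shows finite_spectral_measure: "finite_measure (spectral_measure M F f)"
    and sets_spectral_measure: "sets (spectral_measure M F f) = sets compacts_borel"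
    and spectral_mass_containment:
      "finite (frontier E) \<Longrightarrow> spectral_mass f {K \<in> compacts. K \<subseteq> E} = energy f E"
  using is_spectral_measure_spectral_measure[OF assms]
  by (auto simp: is_spectral_measure_iff spectral_mass_def)

lemma space_spectral_measure: "f \<in> L2 M \<Longrightarrow> space (spectral_measure M F f) = compacts"
  using sets_eq_imp_space_eq[OF sets_spectral_measure] space_compacts_borel by simp

lemma spectral_mass_compacts: "f \<in> L2 M \<Longrightarrow> spectral_mass f compacts = (\<integral>x. (f x)\<^sup>2 \<partial>M)"
  using spectral_mass_containment[of f UNIV] energy_UNIV by simp

lemma spectral_mass_le: "f \<in> L2 M \<Longrightarrow> spectral_mass f S \<le> (\<integral>x. (f x)\<^sup>2 \<partial>M)"
  using finite_measure.bounded_measure[OF finite_spectral_measure, of f S]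
  by (simp add: spectral_mass_compacts[symmetric] spectral_mass_def space_spectral_measure)

lemma spectral_mass_mono:
  assumes "f \<in> L2 M" "S \<subseteq> T" "T \<in> sets compacts_borel"
  shows "spectral_mass f S \<le> spectral_mass f T"
  unfolding spectral_mass_def
  using assms by (intro finite_measure.finite_measure_mono finite_spectral_measure)
    (simp_all add: sets_spectral_measure)

lemma spectral_mass_compl:
  assumes "f \<in> L2 M" "S \<in> sets compacts_borel"
  shows "spectral_mass f (compacts - S) = (\<integral>x. (f x)\<^sup>2 \<partial>M) - spectral_mass f S"
  using finite_measure.finite_measure_compl[OF finite_spectral_measure[OF assms(1)], of S] assms
  by (simp add: sets_spectral_measure space_spectral_measure spectral_mass_compacts[symmetric] spectral_mass_def)

lemma spectral_mass_UN_null: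
  assumes f: "f \<in> L2 M" and S: "\<And>i::nat. S i \<in> sets compacts_borel" "\<And>i. spectral_mass f (S i) = 0"
  shows "spectral_mass f (\<Union>i. S i) = 0"
proof -
  have "S i \<in> null_sets (spectral_measure M F f)" for i
    using S[of i] finite_measure.emeasure_eq_measure[OF finite_spectral_measure[OF f]]
    by (simp add: null_sets_def sets_spectral_measure[OF f] spectral_mass_def)
  then have "(\<Union>i. S i) \<in> null_sets (spectral_measure M F f)" by auto
  then show ?thesis by (auto simp: spectral_mass_def measure_def dest: null_setsD1)
qed

text \<open>The identity for energies, carried from containment events to Borel sets as a relation
  between four measures.\<close>

lemma spectral_mass_parallelogram:
  assumes f: "f \<in> L2 M" and g: "g \<in> L2 M" and c: "c \<noteq> 0" and S: "S \<in> sets compacts_borel"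
  shows "spectral_mass (\<lambda>x. f x + g x) S + spectral_mass (\<lambda>x. c * f x - g x / c) S =
    (1 + c\<^sup>2) * spectral_mass f S + (1 + 1 / c\<^sup>2) * spectral_mass g S"
proof -
  define h where "h i = [\<lambda>x. f x + g x, \<lambda>x. c * f x - g x / c, f, g] ! i" for i
  define a where "a i = [1, 1, - (1 + c\<^sup>2), - (1 + 1 / c\<^sup>2)] ! i" for i
  have four: "{..<4::nat} = {0, 1, 2, 3}" by auto
  have h: "h i \<in> L2 M" if "i \<in> {..<4}" for i
    using that f g L2_add[OF f g] L2_diff[OF L2_cmult[OF f, of c] L2_cmult[OF g, of "1 / c"]]
    unfolding four by (auto simp: h_def)
  have sum4: "(\<Sum>i<4. a i * u (h i)) = u (\<lambda>x. f x + g x) + u (\<lambda>x. c * f x - g x / c) -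
      (1 + c\<^sup>2) * u f - (1 + 1 / c\<^sup>2) * u g" for u :: "('a \<Rightarrow> real) \<Rightarrow> real"
    unfolding four by (simp add: h_def a_def algebra_simps)
  have "(\<Sum>i<4. a i * measure (spectral_measure M F (h i)) S) = 0"
  proof (rule containment_linear_relation[OF _ _ _ _ S])
    fix U :: "real set" assume U: "finite (frontier U)"
    have "(\<Sum>i<4. a i * measure (spectral_measure M F (h i)) {K \<in> compacts. K \<subseteq> U}) =
        (\<Sum>i<4. a i * energy (h i) U)"
      using spectral_mass_containment[OF h U] by (intro sum.cong) (auto simp: spectral_mass_def)
    also have "\<dots> = 0"
      using energy_parallelogram[OF f g c, of U] by (simp add: sum4[of "\<lambda>h. energy h U"])
    finally show "(\<Sum>i<4. a i * measure (spectral_measure M F (h i)) {K \<in> compacts. K \<subseteq> U}) = 0" .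
  qed (use h finite_spectral_measure sets_spectral_measure in auto)
  then show ?thesis
    using sum4[of "\<lambda>h. spectral_mass h S"] by (simp add: spectral_mass_def)
qed

lemma spectral_mass_add_le:
  assumes "f \<in> L2 M" "g \<in> L2 M" "c \<noteq> 0" "S \<in> sets compacts_borel"
  shows "spectral_mass (\<lambda>x. f x + g x) S \<le> (1 + c\<^sup>2) * spectral_mass f S + (1 + 1 / c\<^sup>2) * spectral_mass g S"
  using spectral_mass_parallelogram[OF assms] spectral_mass_nonneg[of "\<lambda>x. c * f x - g x / c" S] by linarith

lemma spectral_mass_cmult:
  assumes f: "f \<in> L2 M" and S: "S \<in> sets compacts_borel"
  shows "spectral_mass (\<lambda>x. c * f x) S = c\<^sup>2 * spectral_mass f S"
proof -
  let ?h = "\<lambda>b. if b then (\<lambda>x. c * f x) else f" and ?a = "\<lambda>b. if b then 1 else - c\<^sup>2"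
  have h: "?h b \<in> L2 M" for b using f L2_cmult[OF f, of c] by simp
  have "(\<Sum>b\<in>UNIV. ?a b * measure (spectral_measure M F (?h b)) S) = 0"
  proof (rule containment_linear_relation[OF _ _ _ _ S])
    fix U :: "real set" assume U: "finite (frontier U)"
    have "energy (\<lambda>x. c * f x) U = (\<integral>x. (c * region_exp U f x)\<^sup>2 \<partial>M)"
      unfolding energy_def
    proof (rule integral_cong_AE)
      interpret sigma_finite_subalgebra M "region_field U" by (rule sigma_finite_subalgebra_region_field)
      have "AE x in M. region_exp U (\<lambda>x. c * f x) x = c * region_exp U f x"
        by (rule real_cond_exp_cmult[OF L2_integrable[OF f]])
      then show "AE x in M. (region_exp U (\<lambda>x. c * f x) x)\<^sup>2 = (c * region_exp U f x)\<^sup>2"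
        by eventually_elim simp
    qed simp_all
    then have "energy (\<lambda>x. c * f x) U = c\<^sup>2 * energy f U"
      by (simp add: power_mult_distrib energy_def)
    then show "(\<Sum>b\<in>UNIV. ?a b * measure (spectral_measure M F (?h b)) {K \<in> compacts. K \<subseteq> U}) = 0"
      using spectral_mass_containment[OF f U] spectral_mass_containment[OF L2_cmult[OF f, of c] U]
      by (simp add: UNIV_bool spectral_mass_def)
  qed (use finite_spectral_measure[OF h] sets_spectral_measure[OF h] in auto)
  then show ?thesis by (simp add: UNIV_bool spectral_mass_def)
qed

lemma spectral_mass_uminus:
  "f \<in> L2 M \<Longrightarrow> S \<in> sets compacts_borel \<Longrightarrow> spectral_mass (\<lambda>x. - f x) S = spectral_mass f S"
  using spectral_mass_cmult[of f S "-1"] by simp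

text \<open>In \<open>spectral_mass_add_le\<close> the large factor multiplies zero, so
  \<open>c\<close> may tend to infinity.\<close>

lemma spectral_mass_add_null:
  assumes f: "f \<in> L2 M" and g: "g \<in> L2 M" and S: "S \<in> sets compacts_borel" and null: "spectral_mass f S = 0"
  shows "spectral_mass (\<lambda>x. f x + g x) S = spectral_mass g S"
proof (rule antisym)
  have le: "spectral_mass (\<lambda>x. u x + g x) S \<le> spectral_mass g S"
    if u: "u \<in> L2 M" "spectral_mass u S = 0" and g: "g \<in> L2 M" for u g
  proof (rule LIMSEQ_le_const)
    have "(\<lambda>n. 1 / real (Suc n)) \<longlonglongrightarrow> 0"
      using LIMSEQ_inverse_real_of_nat by (simp add: inverse_eq_divide)
    then have "(\<lambda>n. (1 + (1 / real (Suc n))\<^sup>2) * spectral_mass g S) \<longlonglongrightarrow> (1 + 0\<^sup>2) * spectral_mass g S"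
      by (intro tendsto_intros)
    then show "(\<lambda>n. (1 + (1 / real (Suc n))\<^sup>2) * spectral_mass g S) \<longlonglongrightarrow> spectral_mass g S" by simp
    show "\<exists>N. \<forall>n\<ge>N. spectral_mass (\<lambda>x. u x + g x) S \<le> (1 + (1 / real (Suc n))\<^sup>2) * spectral_mass g S"
      using spectral_mass_add_le[OF u(1) g _ S] u(2)
      by (auto simp: power_divide simp del: of_nat_Suc)
  qed
  show "spectral_mass (\<lambda>x. f x + g x) S \<le> spectral_mass g S" using f null g by (rule le)
  \<comment> \<open>The reverse inequality is the same estimate with \<open>f x + g x\<close> as
    second summand, the null part being removed again.\<close>
  have "spectral_mass (\<lambda>x. - f x + (f x + g x)) S \<le> spectral_mass (\<lambda>x. f x + g x) S"
    using L2_cmult[OF f, of "-1"] spectral_mass_uminus[OF f S] null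
    by (intro le L2_add f g) auto
  then show "spectral_mass g S \<le> spectral_mass (\<lambda>x. f x + g x) S" by simp
qed

lemma spectral_mass_diff_null:
  assumes f: "f \<in> L2 M" and g: "g \<in> L2 M" and S: "S \<in> sets compacts_borel" and null: "spectral_mass f S = 0"
  shows "spectral_mass (\<lambda>x. g x - f x) S = spectral_mass g S"
  using spectral_mass_add_null[OF L2_cmult[OF f, of "-1"] g S] spectral_mass_uminus[OF f S] null
  by (simp add: add.commute)

lemma spectral_mass_sum_null:
  assumes "finite I" "\<And>i. i \<in> I \<Longrightarrow> f i \<in> L2 M" "\<And>i. i \<in> I \<Longrightarrow> spectral_mass (f i) S = 0"
    and S: "S \<in> sets compacts_borel"
  shows "spectral_mass (\<lambda>x. \<Sum>i\<in>I. f i x) S = 0"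
  using assms(1-3)
proof (induction I rule: finite_induct)
  case empty
  have "spectral_mass (\<lambda>x. 0) S \<le> 0" using spectral_mass_le[OF L2_const[of 0], of S] by simp
  then have "spectral_mass (\<lambda>x. 0) S = 0" using spectral_mass_nonneg[of "\<lambda>x. 0" S] by linarith
  then show ?case by simp
next
  case (insert i I)
  then show ?case using spectral_mass_add_null[of "f i" "\<lambda>x. \<Sum>i\<in>I. f i x" S] S by (simp add: L2_sum)
qed

text \<open>Functions without mass on \<open>S\<close> form a closed class: subtracting such an
  \<open>H n\<close> leaves the mass of \<open>h\<close> unchanged, while the mass of the difference
  is at most its squared norm.\<close>

lemma spectral_mass_limit_null:
  assumes h: "h \<in> L2 M" and H: "\<And>n. H n \<in> L2 M" and lim: "(\<lambda>n. \<integral>x. (H n x - h x)\<^sup>2 \<partial>M) \<longlonglongrightarrow> 0"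
    and S: "S \<in> sets compacts_borel" and null: "\<And>n. n \<ge> n0 \<Longrightarrow> spectral_mass (H n) S = 0"
  shows "spectral_mass h S = 0"
proof -
  have "spectral_mass h S \<le> (\<integral>x. (H n x - h x)\<^sup>2 \<partial>M)" if "n \<ge> n0" for n
  proof -
    have "spectral_mass h S = spectral_mass (\<lambda>x. h x - H n x) S"
      using spectral_mass_diff_null[OF H h S null[OF that]] by simp
    also have "\<dots> \<le> (\<integral>x. (h x - H n x)\<^sup>2 \<partial>M)"
      by (intro spectral_mass_le L2_diff h H)
    finally show ?thesis by (simp add: power2_commute)
  qed
  then have "spectral_mass h S \<le> 0"
    by (intro LIMSEQ_le_const[OF lim]) auto
  then show ?thesis using spectral_mass_nonneg[of h S] by simp
qed

text \<open>In the sum, \<open>f\<close> is negligible on \<open>S\<close> and \<open>g\<close> off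
  \<open>S\<close>. So the masses, and with them the squared norms, add up, which forces the inner
  product to vanish.\<close>

lemma spectral_orthogonal:
  assumes f: "f \<in> L2 M" and g: "g \<in> L2 M" and S: "S \<in> sets compacts_borel"
    and null: "spectral_mass f S = 0" "spectral_mass g (compacts - S) = 0"
  shows "(\<integral>x. f x * g x \<partial>M) = 0"
proof -
  have Sc: "compacts - S \<in> sets compacts_borel" using S by measurable
  have *: "(\<integral>x. (f x + u x)\<^sup>2 \<partial>M) = (\<integral>x. (f x)\<^sup>2 \<partial>M) + (\<integral>x. (u x)\<^sup>2 \<partial>M)"
    if u: "u \<in> L2 M" "spectral_mass u (compacts - S) = 0" for u
  proof -
    have "spectral_mass (\<lambda>x. f x + u x) S = spectral_mass u S"
      by (rule spectral_mass_add_null[OF f u(1) S null(1)])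
    moreover have "spectral_mass (\<lambda>x. u x + f x) (compacts - S) = spectral_mass f (compacts - S)"
      by (rule spectral_mass_add_null[OF u(1) f Sc u(2)])
    ultimately show ?thesis
      using spectral_mass_compl[OF L2_add[OF f u(1)] S] spectral_mass_compl[OF f S] spectral_mass_compl[OF u(1) S]
        u(2) null(1) by (simp add: add.commute)
  qed
  have "(\<integral>x. (f x + g x)\<^sup>2 \<partial>M) = (\<integral>x. (f x)\<^sup>2 + (g x)\<^sup>2 + 2 * (f x * g x) \<partial>M)"
    by (intro Bochner_Integration.integral_cong) (auto simp: power2_sum algebra_simps)
  also have "\<dots> = (\<integral>x. (f x)\<^sup>2 \<partial>M) + (\<integral>x. (g x)\<^sup>2 \<partial>M) + 2 * (\<integral>x. f x * g x \<partial>M)"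
    using f g L2_mult_integrable[OF f g] by (simp add: L2_square_integrable)
  finally show ?thesis using *[OF g null(2)] by simp
qed

text \<open>This is the spectral theorem for the commuting projections \<open>region_exp U\<close>; for
  \<open>S = {K \<in> compacts. K \<subseteq> U}\<close> the part of \<open>g\<close> living on \<open>S\<close> is \<open>region_exp U g\<close>.\<close>

lemma spectral_projection:
  assumes g: "g \<in> L2 M" and S: "S \<in> sets compacts_borel"
  shows "\<exists>h\<in>L2 M. spectral_mass h (compacts - S) = 0 \<and> spectral_mass (\<lambda>x. g x - h x) S = 0"
proof -
  have "S \<in> sigma_sets compacts containment_sets" using S by (simp add: sets_compacts_borel)
  from Int_stable_containment_sets containment_sets_Pow this show ?thesis
  proof (induction rule: sigma_sets_induct_disjoint)
    case (basic A)
    then obtain U where U: "A = {K \<in> compacts. K \<subseteq> U}" "finite (frontier U)"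
      by (auto simp: containment_sets_def)
    have A: "A \<in> sets compacts_borel" using U by (simp add: containment_in_compacts_borel)
    let ?h = "region_exp U g"
    have h: "?h \<in> L2 M" by (rule region_exp_L2[OF g])
    have "spectral_mass ?h A = spectral_mass ?h compacts"
      using spectral_mass_containment[OF h U(2)] spectral_mass_containment[OF h, of UNIV]
        energy_region_exp[OF g U(2) U(2)] energy_region_exp[OF g U(2), of UNIV]
      by (simp add: U(1))
    then have "spectral_mass ?h (compacts - A) = 0"
      using spectral_mass_compl[OF h A] spectral_mass_compacts[OF h] by simp
    moreover have "spectral_mass (\<lambda>x. g x - ?h x) A = 0"
      using spectral_mass_containment[OF L2_diff[OF g h] U(2)] energy_diff_region_exp[OF g U(2) U(2)]
      by (simp add: U(1))
    ultimately show ?case using h by blast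
  next
    case empty
    have "spectral_mass (\<lambda>x. 0) compacts = 0" using spectral_mass_compacts[OF L2_const[of 0]] by simp
    moreover have "spectral_mass (\<lambda>x. g x - 0) {} = 0" by (simp add: spectral_mass_def)
    ultimately show ?case using L2_const[of 0] by (intro bexI[of _ "\<lambda>_. 0"]) simp_all
  next
    case (compl A)
    then obtain h where h: "h \<in> L2 M" "spectral_mass h (compacts - A) = 0"
      "spectral_mass (\<lambda>x. g x - h x) A = 0" by blast
    have "compacts - (compacts - A) = A"
      using compl(1) sigma_sets_into_sp[OF containment_sets_Pow] by blast
    then show ?case using h L2_diff[OF g h(1)] by (intro bexI[of _ "\<lambda>x. g x - h x"]) auto
  next
    case (union A)
    have A: "A i \<in> sets compacts_borel" for i using union(2) by (auto simp: sets_compacts_borel)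
    have disj: "A i \<inter> A j = {}" if "i \<noteq> j" for i j using union(1) that by (auto simp: disjoint_family_on_def)
    have Asub: "A i \<subseteq> compacts" for i using sets.sets_into_space[OF A] by (simp add: space_compacts_borel)
    have A_off: "A j \<subseteq> compacts - A i" if "i \<noteq> j" for i j using Asub[of j] disj[OF that] by blast
    obtain h where h: "\<And>i. h i \<in> L2 M" "\<And>i. spectral_mass (h i) (compacts - A i) = 0"
      "\<And>i. spectral_mass (\<lambda>x. g x - h i x) (A i) = 0"
      using union(3) by metis
    have h0: "spectral_mass (h i) T = 0" if "T \<subseteq> compacts - A i" for i T
    proof -
      have "compacts - A i \<in> sets compacts_borel" using A by measurable
      then have "spectral_mass (h i) T \<le> spectral_mass (h i) (compacts - A i)"
        by (rule spectral_mass_mono[OF h(1) that])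
      then show ?thesis using h(2)[of i] spectral_mass_nonneg[of "h i" T] by simp
    qed
    define H where "H n x = (\<Sum>i<n. h i x)" for n :: nat and x
    have H: "H n \<in> L2 M" for n unfolding H_def[abs_def] by (intro L2_sum h)
    \<comment> \<open>On \<open>A j\<close> only the summand \<open>h j\<close> counts, since the
      other summands carry no mass there.\<close>
    have gH: "spectral_mass (\<lambda>x. g x - H n x) (A j) = 0" if "j < n" for j n
    proof -
      have "spectral_mass (\<lambda>x. \<Sum>i\<in>{..<n} - {j}. h i x) (A j) = 0"
        using disj Asub by (intro spectral_mass_sum_null h0 h A) blast+
      moreover have "(\<lambda>x. \<Sum>i\<in>{..<n} - {j}. h i x) \<in> L2 M" by (intro L2_sum h)
      ultimately have "spectral_mass (\<lambda>x. (g x - h j x) - (\<Sum>i\<in>{..<n} - {j}. h i x)) (A j) = 0"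
        using spectral_mass_diff_null[OF _ L2_diff[OF g h(1)] A] h(3)[of j] by simp
      moreover have "(g x - h j x) - (\<Sum>i\<in>{..<n} - {j}. h i x) = g x - H n x" for x
        using that by (simp add: H_def sum.remove[of "{..<n}" j])
      ultimately show ?thesis by simp
    qed
    define s where "s n = spectral_mass g (\<Union>i<n. A i)" for n :: nat
    \<comment> \<open>The increment lives on the pieces from \<open>m\<close> to \<open>n\<close>,
      where it differs from \<open>g\<close> by functions without mass; so its squared norm is the
      mass of \<open>g\<close> on these pieces.\<close>
    have increment: "(\<integral>x. (H n x - H m x)\<^sup>2 \<partial>M) = s n - s m" if mn: "m \<le> n" for m n
    proof -
      let ?T = "\<Union>i\<in>{m..<n}. A i"
      have T: "?T \<in> sets compacts_borel" using A by auto
      have Hd: "H n x - H m x = (\<Sum>i\<in>{m..<n}. h i x)" for x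
        using mn by (simp add: H_def sum_diff_nat_ivl[of 0 m n] lessThan_atLeast0)
      have HL: "(\<lambda>x. H n x - H m x) \<in> L2 M" by (intro L2_diff H)
      have "spectral_mass (\<lambda>x. H n x - H m x) (compacts - ?T) = 0"
        unfolding Hd using T by (intro spectral_mass_sum_null h0 h) auto
      then have "(\<integral>x. (H n x - H m x)\<^sup>2 \<partial>M) = spectral_mass (\<lambda>x. H n x - H m x) ?T"
        using spectral_mass_compl[OF HL T] by simp
      also have "\<dots> = spectral_mass (\<lambda>x. (g x - H m x) - (g x - H n x)) ?T" by simp
      also have "\<dots> = spectral_mass (\<lambda>x. g x - H m x) ?T"
      proof (intro spectral_mass_diff_null L2_diff g H T)
        let ?f = "\<lambda>x. g x - H n x"
        have "spectral_mass ?f ?T \<le> (\<Sum>i\<in>{m..<n}. spectral_mass ?f (A i))"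
          unfolding spectral_mass_def
          using A sets_spectral_measure[OF L2_diff[OF g H]]
          by (intro finite_measure.finite_measure_subadditive_finite finite_spectral_measure L2_diff g H) auto
        also have "\<dots> = 0" using gH by (intro sum.neutral) auto
        finally show "spectral_mass ?f ?T = 0" using spectral_mass_nonneg[of ?f ?T] by linarith
      qed
      also have "\<dots> = spectral_mass g ?T"
      proof (intro spectral_mass_diff_null H g T)
        have "?T \<subseteq> compacts - A i" if "i < m" for i
          using that by (intro UN_least A_off) auto
        then show "spectral_mass (H m) ?T = 0"
          unfolding H_def[abs_def] by (intro spectral_mass_sum_null h0 h T) auto
      qed
      also have "?T = (\<Union>i<n. A i) - (\<Union>i<m. A i)"
      proof -
        have "{..<n} = {..<m} \<union> {m..<n}" using mn by auto
        then have "(\<Union>i<n. A i) = (\<Union>i<m. A i) \<union> ?T" by (simp only: UN_Un)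
        moreover have "(\<Union>i<m. A i) \<inter> ?T = {}"
        proof (rule equals0I)
          fix K assume "K \<in> (\<Union>i<m. A i) \<inter> ?T"
          then obtain i j where "i < m" "m \<le> j" "K \<in> A i" "K \<in> A j" by auto
          then show False using disj[of i j] by auto
        qed
        ultimately show ?thesis by blast
      qed
      also have "spectral_mass g \<dots> = s n - s m"
        unfolding s_def spectral_mass_def
        using A mn sets_spectral_measure[OF g]
        by (intro finite_measure.finite_measure_Diff finite_spectral_measure g) (auto simp: UN_mono)
      finally show ?thesis .
    qed
    have "incseq s"
      unfolding s_def incseq_def using A by (intro allI impI spectral_mass_mono g UN_mono) auto
    moreover have "\<forall>n. s n \<le> (\<integral>x. (g x)\<^sup>2 \<partial>M)" unfolding s_def by (intro allI spectral_mass_le g)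
    ultimately obtain l where "s \<longlonglongrightarrow> l" using incseq_convergent by blast
    then have Cauchy: "Cauchy s" by (rule LIMSEQ_imp_Cauchy)
    have le: "(\<integral>x. (H m x - H n x)\<^sup>2 \<partial>M) \<le> \<bar>s m - s n\<bar>" for m n
    proof (cases "n \<le> m")
      case True
      then show ?thesis using increment[OF True] by simp
    next
      case False
      then have "(\<integral>x. (H n x - H m x)\<^sup>2 \<partial>M) = s n - s m" by (intro increment) simp
      then show ?thesis by (simp add: power2_commute)
    qed
    obtain k where k: "k \<in> L2 M" "(\<lambda>n. \<integral>x. (H n x - k x)\<^sup>2 \<partial>M) \<longlonglongrightarrow> 0"
    proof (rule L2_complete[of M H])
      show "subalgebra M M" by (simp add: subalgebra_def)
      show "H n \<in> borel_measurable M" for n using H[of n] by (rule L2_measurable)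
      fix e :: real assume "0 < e"
      then have "\<exists>N. \<forall>m\<ge>N. \<forall>n\<ge>N. \<bar>s m - s n\<bar> < e" using CauchyD[OF Cauchy] by auto
      then show "\<exists>N. \<forall>m\<ge>N. \<forall>n\<ge>N. (\<integral>x. (H m x - H n x)\<^sup>2 \<partial>M) < e"
        by (auto intro!: le_less_trans[OF le])
    qed (use H that in auto)
    let ?B = "\<Union>i. A i"
    have B: "compacts - ?B \<in> sets compacts_borel" using A by auto
    have "spectral_mass (H n) (compacts - ?B) = 0" for n
      unfolding H_def[abs_def] by (intro spectral_mass_sum_null h0 h B) auto
    then have "spectral_mass k (compacts - ?B) = 0"
      by (rule spectral_mass_limit_null[OF k(1) H k(2) B, of 0])
    \<comment> \<open>The remainders have no mass on \<open>A j\<close> from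
      \<open>n = Suc j\<close> on, because \<open>H n\<close> sums the indices below
      \<open>n\<close>.\<close>
    moreover have "spectral_mass (\<lambda>x. g x - k x) (A j) = 0" for j
    proof (rule spectral_mass_limit_null[where H="\<lambda>n x. g x - H n x" and ?n0.0="Suc j",
          OF L2_diff[OF g k(1)] L2_diff[OF g H] _ A])
      have "(g x - H n x - (g x - k x))\<^sup>2 = (H n x - k x)\<^sup>2" for n x
        by (simp add: power2_commute)
      then show "(\<lambda>n. \<integral>x. (g x - H n x - (g x - k x))\<^sup>2 \<partial>M) \<longlonglongrightarrow> 0" using k(2) by simp
    qed (use gH in auto)
    then have "spectral_mass (\<lambda>x. g x - k x) ?B = 0"
      by (intro spectral_mass_UN_null L2_diff g k A)
    ultimately show ?case using k(1) by blast
  qed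
qed

section \<open>Stable and sensitive functions\<close>

lemma stable_rv_iff:
  assumes f: "f \<in> L2 M"
  shows "stable_rv M F f \<longleftrightarrow> spectral_mass f infinite_compacts = 0"
proof -
  have "{K \<in> space (spectral_measure M F f). \<not> finite K} = infinite_compacts"
    by (simp add: infinite_compacts_def space_spectral_measure[OF f])
  then show ?thesis
    unfolding stable_rv_def spectral_mass_def
    using finite_measure.emeasure_eq_measure[OF finite_spectral_measure[OF f]]
    by (subst AE_iff_measurable[of infinite_compacts]) (auto simp: sets_spectral_measure[OF f])
qed

lemma sensitive_rv_iff:
  assumes f: "f \<in> L2 M"
  shows "sensitive_rv M F f \<longleftrightarrow> spectral_mass f finite_compacts = 0"
proof -
  have "{K \<in> space (spectral_measure M F f). \<not> infinite K} = finite_compacts"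
    by (simp add: finite_compacts_def space_spectral_measure[OF f])
  then show ?thesis
    unfolding sensitive_rv_def spectral_mass_def
    using finite_measure.emeasure_eq_measure[OF finite_spectral_measure[OF f]]
    by (subst AE_iff_measurable[of finite_compacts]) (auto simp: sets_spectral_measure[OF f])
qed

text \<open>The average of the energy over a random union of dyadic cells, each of the cells in \<open>[-n, n)\<close>
  being kept independently with probability \<open>\<rho>\<close>, tends to the integral of \<open>\<rho> ^ card K\<close> over
  the finite \<open>K\<close>.\<close>

lemma retention_limit:
  fixes \<rho> :: real
  assumes f: "f \<in> L2 M" and \<rho>: "0 \<le> \<rho>" "\<rho> < 1"
  defines "A \<equiv> \<lambda>n. {- (int n * 2 ^ n)..<int n * 2 ^ n}"
  defines "\<psi> \<equiv> \<lambda>K::real set. if finite K then \<rho> ^ card K else 0"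
  shows "\<psi> \<in> borel_measurable (spectral_measure M F f)"
    and "(\<lambda>n. \<Sum>R\<in>Pow (A n). \<rho> ^ card R * (1 - \<rho>) ^ card (A n - R) * energy f (grid n R)) \<longlonglongrightarrow>
      (\<integral>K. \<psi> K \<partial>spectral_measure M F f)"
proof -
  let ?\<mu> = "spectral_measure M F f"
  interpret \<mu>: finite_measure ?\<mu> by (rule finite_spectral_measure[OF f])
  let ?w = "\<lambda>n R. \<rho> ^ card R * (1 - \<rho>) ^ card (A n - R)"
  let ?C = "\<lambda>n R. {K \<in> compacts. K \<subseteq> grid n R}"
  \<comment> \<open>A finite average of containment indicators: its integral is the average of
    energies, and its value at \<open>K\<close> involves only the number of occupied cells.\<close>
  define \<phi> where "\<phi> n K = (\<Sum>R\<in>Pow (A n). ?w n R * indicator (?C n R) K)" for n K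
  have finA: "finite (A n)" for n by (simp add: A_def)
  have C: "?C n R \<in> sets ?\<mu>" if "R \<in> Pow (A n)" for n R
    using that finite_subset[OF _ finA] sets_spectral_measure[OF f]
    by (auto intro!: containment_in_compacts_borel finite_frontier_grid)
  have \<phi>_meas: "\<phi> n \<in> borel_measurable ?\<mu>" for n
    unfolding \<phi>_def[abs_def] using C by (intro borel_measurable_sum borel_measurable_times) auto
  have \<phi>_eq: "\<phi> n K = (if dyadic_cells n K \<subseteq> A n then \<rho> ^ card (dyadic_cells n K) else 0)"
    if "K \<in> compacts" for n K
  proof -
    have "\<phi> n K = (\<Sum>R\<in>Pow (A n). ?w n R * (if dyadic_cells n K \<subseteq> R then 1 else 0))"
      unfolding \<phi>_def using that by (intro sum.cong) (auto simp: subset_grid_iff)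
    then show ?thesis by (simp add: sum_Pow_retention finA finite_dyadic_cells[OF that])
  qed
  have \<phi>_lim: "(\<lambda>n. \<phi> n K) \<longlonglongrightarrow> \<psi> K" if K: "K \<in> compacts" for K
  proof (cases "finite K")
    case True
    obtain B where "\<forall>x\<in>K. norm x \<le> B"
      using finite_imp_bounded[OF True] unfolding bounded_iff ..
    then have B: "\<And>x. x \<in> K \<Longrightarrow> \<bar>x\<bar> \<le> B" by simp
    obtain N :: nat where N: "B < real N" using reals_Archimedean2 by blast
    have "\<forall>\<^sub>F n in sequentially. \<phi> n K = \<psi> K"
      using eventually_ge_at_top[of N] eventually_card_dyadic_cells[OF True]
    proof eventually_elim
      case (elim n)
      have "dyadic_cells n K \<subseteq> A n"
      proof
        fix j assume "j \<in> dyadic_cells n K"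
        then obtain x where x: "x \<in> K" "j = \<lfloor>2 ^ n * x\<rfloor>" by (auto simp: dyadic_cells_def)
        have "- real n \<le> x" "x < real n" using B[OF x(1)] N elim(1) by linarith+
        then have "2 ^ n * (- real n) \<le> 2 ^ n * x" "2 ^ n * x < 2 ^ n * real n" by (auto simp only: mult_le_cancel_left_pos mult_less_cancel_left_pos zero_less_power zero_less_numeral)
        then have "real_of_int (- (int n * 2 ^ n)) \<le> 2 ^ n * x" "2 ^ n * x < real_of_int (int n * 2 ^ n)"
          by (simp_all add: mult.commute)
        then show "j \<in> A n" unfolding x(2) A_def by (simp only: atLeastLessThan_iff le_floor_iff floor_less_iff)
      qed
      then show ?case using \<phi>_eq[OF K] elim(2) True by (simp add: \<psi>_def)
    qed
    then show ?thesis by (rule tendsto_eventually)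
  next
    case False
    \<comment> \<open>An infinite set occupies more and more cells, and \<rho> is strictly below
      1.\<close>
    have "(\<lambda>n. \<rho> ^ card (dyadic_cells n K)) \<longlonglongrightarrow> 0"
    proof (rule filterlim_compose[of "\<lambda>m. \<rho> ^ m"])
      show "(\<lambda>m. \<rho> ^ m) \<longlonglongrightarrow> 0" using \<rho> by (intro LIMSEQ_power_zero) simp
      show "filterlim (\<lambda>n. card (dyadic_cells n K)) at_top sequentially"
        unfolding filterlim_at_top using eventually_card_dyadic_cells_ge[OF K False] by blast
    qed
    then have "(\<lambda>n. \<phi> n K) \<longlonglongrightarrow> 0"
      by (rule tendsto_sandwich[OF _ _ tendsto_const, rotated 2]) (use \<rho> in \<open>auto simp: \<phi>_eq[OF K]\<close>)
    then show ?thesis using False by (simp add: \<psi>_def)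
  qed
  show \<psi>_meas: "\<psi> \<in> borel_measurable ?\<mu>"
    by (rule borel_measurable_LIMSEQ_real[where u=\<phi>, OF _ \<phi>_meas]) (simp add: \<phi>_lim space_spectral_measure[OF f])
  have "(\<lambda>n. \<integral>K. \<phi> n K \<partial>?\<mu>) \<longlonglongrightarrow> (\<integral>K. \<psi> K \<partial>?\<mu>)"
  proof (rule integral_dominated_convergence[where w="\<lambda>_. 1"])
    show "AE K in ?\<mu>. (\<lambda>n. \<phi> n K) \<longlonglongrightarrow> \<psi> K"
      using \<phi>_lim by (intro AE_I2) (simp add: space_spectral_measure[OF f])
    show "AE K in ?\<mu>. norm (\<phi> n K) \<le> 1" for n
      using \<rho> by (intro AE_I2) (auto simp: \<phi>_eq space_spectral_measure[OF f] intro!: power_le_one)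
  qed (use \<psi>_meas \<phi>_meas in auto)
  moreover have "(\<integral>K. \<phi> n K \<partial>?\<mu>) = (\<Sum>R\<in>Pow (A n). ?w n R * energy f (grid n R))" for n
  proof -
    have "(\<integral>K. \<phi> n K \<partial>?\<mu>) = (\<Sum>R\<in>Pow (A n). \<integral>K. ?w n R * indicator (?C n R) K \<partial>?\<mu>)"
      unfolding \<phi>_def using C
      by (intro Bochner_Integration.integral_sum integrable_mult_right integrable_real_indicator)
        (auto simp: \<mu>.emeasure_eq_measure)
    also have "\<dots> = (\<Sum>R\<in>Pow (A n). ?w n R * energy f (grid n R))"
    proof (rule sum.cong[OF refl])
      fix R assume R: "R \<in> Pow (A n)"
      have "finite (frontier (grid n R))"
        using R finite_subset[OF _ finA] by (intro finite_frontier_grid) auto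
      then have "measure ?\<mu> (?C n R) = energy f (grid n R)"
        using spectral_mass_containment[OF f] by (simp add: spectral_mass_def)
      moreover have "?C n R \<inter> space ?\<mu> = ?C n R" by (auto simp: space_spectral_measure[OF f])
      ultimately show "(\<integral>K. ?w n R * indicator (?C n R) K \<partial>?\<mu>) = ?w n R * energy f (grid n R)"
        by simp
    qed
    finally show ?thesis .
  qed
  ultimately show "(\<lambda>n. \<Sum>R\<in>Pow (A n). ?w n R * energy f (grid n R)) \<longlonglongrightarrow> (\<integral>K. \<psi> K \<partial>?\<mu>)"
    by simp
qed

text \<open>The retention weights are nonnegative, so the energy inequality holds for the averages
  and for their limits as the cells shrink. Only then does \<rho> tend to 1, where the integrand
  becomes the indicator of the finite sets; the order of the two limits matters.\<close>

lemma spectral_mass_abs_finite_compacts: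
  assumes f: "f \<in> L2 M"
  shows "spectral_mass f finite_compacts \<le> spectral_mass (\<lambda>x. \<bar>f x\<bar>) finite_compacts"
proof -
  \<comment> \<open>These values stay strictly below 1, as \<open>retention_limit\<close> demands,
    and increase to 1.\<close>
  define \<rho> where "\<rho> m = 1 - 1 / real (Suc m)" for m
  define \<psi> where "\<psi> m K = (if finite K then \<rho> m ^ card K else 0)" for m and K :: "real set"
  have \<rho>: "0 \<le> \<rho> m" "\<rho> m < 1" "\<rho> m \<le> 1" for m by (auto simp: \<rho>_def)
  have le: "(\<integral>K. \<psi> m K \<partial>spectral_measure M F f) \<le> (\<integral>K. \<psi> m K \<partial>spectral_measure M F (\<lambda>x. \<bar>f x\<bar>))" for m
    unfolding \<psi>_def
  proof (rule LIMSEQ_le[OF retention_limit(2)[OF f \<rho>(1,2)] retention_limit(2)[OF L2_abs[OF f] \<rho>(1,2)]])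
    show "\<exists>N. \<forall>n\<ge>N. (\<Sum>R\<in>Pow {- (int n * 2 ^ n)..<int n * 2 ^ n}.
        \<rho> m ^ card R * (1 - \<rho> m) ^ card ({- (int n * 2 ^ n)..<int n * 2 ^ n} - R) * energy f (grid n R)) \<le>
      (\<Sum>R\<in>Pow {- (int n * 2 ^ n)..<int n * 2 ^ n}.
        \<rho> m ^ card R * (1 - \<rho> m) ^ card ({- (int n * 2 ^ n)..<int n * 2 ^ n} - R) *
        energy (\<lambda>x. \<bar>f x\<bar>) (grid n R))"
      using \<rho> by (intro exI allI impI sum_mono mult_left_mono energy_abs f) auto
  qed
  have "(\<lambda>m. 1 / real (Suc m)) \<longlonglongrightarrow> 0"
    using LIMSEQ_inverse_real_of_nat by (simp add: inverse_eq_divide)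
  then have \<rho>_lim: "\<rho> \<longlonglongrightarrow> 1"
    unfolding \<rho>_def[abs_def] using tendsto_diff[OF tendsto_const, of _ 0 sequentially "1::real"] by fastforce
  have lim: "(\<lambda>m. \<integral>K. \<psi> m K \<partial>spectral_measure M F g) \<longlonglongrightarrow> spectral_mass g finite_compacts" if g: "g \<in> L2 M" for g
  proof -
    let ?\<mu> = "spectral_measure M F g"
    interpret \<mu>: finite_measure ?\<mu> by (rule finite_spectral_measure[OF g])
    have fc: "finite_compacts \<in> sets ?\<mu>" by (simp add: sets_spectral_measure[OF g])
    have "(\<lambda>m. \<integral>K. \<psi> m K \<partial>?\<mu>) \<longlonglongrightarrow> (\<integral>K. indicator finite_compacts K \<partial>?\<mu>)"
    proof (rule integral_dominated_convergence[where w="\<lambda>_. 1"])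
      show "\<psi> m \<in> borel_measurable ?\<mu>" for m
        unfolding \<psi>_def[abs_def] by (rule retention_limit(1)[OF g \<rho>(1,2)])
      show "AE K in ?\<mu>. (\<lambda>m. \<psi> m K) \<longlonglongrightarrow> indicator finite_compacts K"
      proof (intro AE_I2)
        fix K assume "K \<in> space ?\<mu>"
        then have K: "K \<in> compacts" by (simp add: space_spectral_measure[OF g])
        have "(\<lambda>m. \<rho> m ^ card K) \<longlonglongrightarrow> 1 ^ card K" by (intro tendsto_power \<rho>_lim)
        then show "(\<lambda>m. \<psi> m K) \<longlonglongrightarrow> indicator finite_compacts K"
          using K by (cases "finite K") (auto simp: \<psi>_def finite_compacts_def)
      qed
      show "AE K in ?\<mu>. norm (\<psi> m K) \<le> 1" for m
        using \<rho> by (intro AE_I2) (auto simp: \<psi>_def intro!: power_le_one)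
    qed (use fc in auto)
    moreover have "finite_compacts \<inter> space ?\<mu> = finite_compacts"
      using sets.sets_into_space[OF fc] by auto
    ultimately show ?thesis by (simp add: spectral_mass_def)
  qed
  show ?thesis
    by (rule LIMSEQ_le[OF lim[OF f] lim[OF L2_abs[OF f]]]) (use le in auto)
qed

lemma spectral_mass_infinite_compacts:
  "f \<in> L2 M \<Longrightarrow> spectral_mass f infinite_compacts = (\<integral>x. (f x)\<^sup>2 \<partial>M) - spectral_mass f finite_compacts"
  unfolding infinite_compacts_eq by (rule spectral_mass_compl) measurable

section \<open>The closed linear sublattice of stable functions\<close>

definition stable_space :: "('a \<Rightarrow> real) set" where
  "stable_space = {f \<in> L2 M. spectral_mass f infinite_compacts = 0}"

lemma stable_space_L2: "f \<in> stable_space \<Longrightarrow> f \<in> L2 M"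
  by (simp add: stable_space_def)

lemma stable_space_add: "f \<in> stable_space \<Longrightarrow> g \<in> stable_space \<Longrightarrow> (\<lambda>x. f x + g x) \<in> stable_space"
  by (auto simp: stable_space_def L2_add spectral_mass_add_null)

lemma stable_space_cmult: "f \<in> stable_space \<Longrightarrow> (\<lambda>x. c * f x) \<in> stable_space"
  by (auto simp: stable_space_def L2_cmult spectral_mass_cmult)

lemma stable_space_diff: "f \<in> stable_space \<Longrightarrow> g \<in> stable_space \<Longrightarrow> (\<lambda>x. f x - g x) \<in> stable_space"
  using stable_space_add[OF _ stable_space_cmult[of g "-1"], of f] by simp

text \<open>Passing to the absolute value preserves the total mass and does not decrease the finite
  part, so the infinite part remains zero.\<close>

lemma stable_space_abs:
  assumes "f \<in> stable_space"
  shows "(\<lambda>x. \<bar>f x\<bar>) \<in> stable_space"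
proof -
  have f: "f \<in> L2 M" "spectral_mass f infinite_compacts = 0" using assms by (auto simp: stable_space_def)
  have "spectral_mass (\<lambda>x. \<bar>f x\<bar>) infinite_compacts \<le> 0"
    using spectral_mass_infinite_compacts[OF f(1)] spectral_mass_infinite_compacts[OF L2_abs[OF f(1)]]
      spectral_mass_abs_finite_compacts[OF f(1)] f(2) by simp
  then have "spectral_mass (\<lambda>x. \<bar>f x\<bar>) infinite_compacts = 0"
    using spectral_mass_nonneg[of "\<lambda>x. \<bar>f x\<bar>" infinite_compacts] by linarith
  then show ?thesis using f(1) by (simp add: stable_space_def L2_abs)
qed

lemma stable_space_max:
  assumes "f \<in> stable_space" "g \<in> stable_space"
  shows "(\<lambda>x. max (f x) (g x)) \<in> stable_space"
proof -
  have "(\<lambda>x. (1/2) * ((f x + g x) + \<bar>f x - g x\<bar>)) \<in> stable_space"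
    using assms by (intro stable_space_cmult stable_space_add stable_space_abs stable_space_diff)
  moreover have "(1/2) * ((f x + g x) + \<bar>f x - g x\<bar>) = max (f x) (g x)" for x by simp
  ultimately show ?thesis by simp
qed

text \<open>The spectral measure of a constant is concentrated at the empty set, because the empty
  region already has the full energy.\<close>

lemma stable_space_const: "(\<lambda>_. c) \<in> stable_space"
proof -
  have "spectral_mass (\<lambda>_. c) {K \<in> compacts. K \<subseteq> {}} = c\<^sup>2"
    by (subst spectral_mass_containment) (auto simp: L2_const energy_const)
  also have "{K \<in> compacts. K \<subseteq> {}} = {{}}" by (auto simp: compacts_def)
  finally have "spectral_mass (\<lambda>_. c) {{}} = c\<^sup>2" .
  moreover have "spectral_mass (\<lambda>_. c) {{}} \<le> spectral_mass (\<lambda>_. c) finite_compacts"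
    by (intro spectral_mass_mono L2_const finite_compacts_sets) (auto simp: finite_compacts_def compacts_def)
  ultimately have "spectral_mass (\<lambda>_. c) infinite_compacts \<le> 0"
    using spectral_mass_infinite_compacts[OF L2_const[of c]] by (simp add: prob_space)
  then have "spectral_mass (\<lambda>_. c) infinite_compacts = 0"
    using spectral_mass_nonneg[of "\<lambda>_. c" infinite_compacts] by linarith
  then show ?thesis by (simp add: stable_space_def L2_const)
qed

lemma stable_space_min:
  assumes "f \<in> stable_space" "g \<in> stable_space"
  shows "(\<lambda>x. min (f x) (g x)) \<in> stable_space"
proof -
  have "(\<lambda>x. (f x + g x) - max (f x) (g x)) \<in> stable_space"
    using assms by (intro stable_space_diff stable_space_add stable_space_max)
  moreover have "(f x + g x) - max (f x) (g x) = min (f x) (g x)" for x by simp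
  ultimately show ?thesis by simp
qed

lemma stable_space_sum:
  assumes "finite I" "\<And>i. i \<in> I \<Longrightarrow> f i \<in> stable_space"
  shows "(\<lambda>x. \<Sum>i\<in>I. f i x) \<in> stable_space"
  using assms by (induction I rule: finite_induct) (auto intro: stable_space_const stable_space_add)

text \<open>Domination upgrades pointwise to L2 convergence. As only points of
  \<open>space M\<close> matter, constant sequences also permit changing a function outside
  \<open>space M\<close>.\<close>

lemma stable_space_dominated_limit:
  assumes h: "\<And>n. h n \<in> stable_space" and g: "g \<in> L2 M" and [measurable]: "f \<in> borel_measurable M"
    and bound: "\<And>n x. x \<in> space M \<Longrightarrow> \<bar>h n x\<bar> \<le> \<bar>g x\<bar>"
    and lim: "\<And>x. x \<in> space M \<Longrightarrow> (\<lambda>n. h n x) \<longlonglongrightarrow> f x"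
  shows "f \<in> stable_space"
proof -
  have hL: "h n \<in> L2 M" for n using h by (rule stable_space_L2)
  have fb: "\<bar>f x\<bar> \<le> \<bar>g x\<bar>" if "x \<in> space M" for x
    using tendsto_rabs[OF lim[OF that]] bound[OF that] by (intro LIMSEQ_le_const2) auto
  have f: "f \<in> L2 M" by (rule L2_bounded_by[OF g _ fb]) simp_all
  have "(\<lambda>n. \<integral>x. (h n x - f x)\<^sup>2 \<partial>M) \<longlonglongrightarrow> (\<integral>x. 0 \<partial>M)"
  proof (rule integral_dominated_convergence[where w="\<lambda>x. 4 * (g x)\<^sup>2"])
    show "integrable M (\<lambda>x. 4 * (g x)\<^sup>2)" using g by (simp add: L2_square_integrable)
    show "AE x in M. (\<lambda>n. (h n x - f x)\<^sup>2) \<longlonglongrightarrow> 0"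
    proof (intro AE_I2)
      fix x assume "x \<in> space M"
      then have "(\<lambda>n. (h n x - f x)\<^sup>2) \<longlonglongrightarrow> (f x - f x)\<^sup>2" by (intro tendsto_intros lim)
      then show "(\<lambda>n. (h n x - f x)\<^sup>2) \<longlonglongrightarrow> 0" by simp
    qed
    show "AE x in M. norm ((h n x - f x)\<^sup>2) \<le> 4 * (g x)\<^sup>2" for n
    proof (intro AE_I2)
      fix x assume x: "x \<in> space M"
      have "\<bar>h n x - f x\<bar> \<le> \<bar>2 * g x\<bar>" using bound[OF x, of n] fb[OF x] by linarith
      then have "(h n x - f x)\<^sup>2 \<le> (2 * g x)\<^sup>2" by (simp only: abs_le_square_iff)
      then show "norm ((h n x - f x)\<^sup>2) \<le> 4 * (g x)\<^sup>2" by (simp add: power_mult_distrib)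
    qed
  qed (use L2_measurable[OF hL] in auto)
  then have "(\<lambda>n. \<integral>x. (h n x - f x)\<^sup>2 \<partial>M) \<longlonglongrightarrow> 0" by simp
  then have "spectral_mass f infinite_compacts = 0"
    by (rule spectral_mass_limit_null[OF f hL _ infinite_compacts_sets, where ?n0.0=0])
      (use h in \<open>auto simp: stable_space_def\<close>)
  then show ?thesis using f by (simp add: stable_space_def)
qed

section \<open>The sigma-field of stable events\<close>

definition stable_field :: "'a measure" where
  "stable_field = sigma (space M) {A \<in> sets M. indicator A \<in> stable_space}"

lemma sets_stable_field: "sets stable_field = {A \<in> sets M. indicator A \<in> stable_space}"
proof -
  let ?A = "{A \<in> sets M. (indicator A :: 'a \<Rightarrow> real) \<in> stable_space}"
  have "sigma_algebra (space M) ?A"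
    unfolding sigma_algebra_iff2
  proof (intro conjI ballI allI impI)
    show "?A \<subseteq> Pow (space M)" using sets.sets_into_space by auto
    have "(\<lambda>x. 0) = (indicator {} :: 'a \<Rightarrow> real)" by (simp add: fun_eq_iff)
    then show "{} \<in> ?A" using stable_space_const[of 0] by simp
  next
    fix A assume A: "A \<in> ?A"
    then have "(\<lambda>x. 1 - indicator A x :: real) \<in> stable_space"
      by (intro stable_space_diff stable_space_const) simp
    then have "(indicator (space M - A) :: 'a \<Rightarrow> real) \<in> stable_space"
    \<comment> \<open>The two functions disagree outside \<open>space M\<close>; the constant
      sequence bridges this.\<close>
    proof (rule stable_space_dominated_limit[where h="\<lambda>_ x. 1 - indicator A x", OF _ L2_const[of 1]])
      show "(indicator (space M - A) :: 'a \<Rightarrow> real) \<in> borel_measurable M"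
        using A by (intro borel_measurable_indicator sets.compl_sets) simp
      show "\<bar>1 - indicator A x\<bar> \<le> \<bar>1 :: real\<bar>" for x by (simp add: indicator_def)
      fix x assume "x \<in> space M"
      then have "indicator (space M - A) x = (1 - indicator A x :: real)" by (simp add: indicator_def)
      then show "(\<lambda>_::nat. 1 - indicator A x :: real) \<longlonglongrightarrow> indicator (space M - A) x" by simp
    qed
    then show "space M - A \<in> ?A" using A by (simp add: sets.compl_sets)
  next
    fix A :: "nat \<Rightarrow> 'a set" assume "range A \<subseteq> ?A"
    then have A: "\<And>i. A i \<in> sets M" "\<And>i. (indicator (A i) :: 'a \<Rightarrow> real) \<in> stable_space" by auto
    have fin: "(indicator (\<Union>i<n. A i) :: 'a \<Rightarrow> real) \<in> stable_space" for n
    proof (induction n)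
      case 0
      have "(\<lambda>x. 0) = (indicator {} :: 'a \<Rightarrow> real)" by (simp add: fun_eq_iff)
      then show ?case using stable_space_const[of 0] by simp
    next
      case (Suc n)
      have "(\<lambda>x. max (indicator (\<Union>i<n. A i) x) (indicator (A n) x)) =
          (indicator (\<Union>i<Suc n. A i) :: 'a \<Rightarrow> real)"
        by (auto simp: fun_eq_iff indicator_def less_Suc_eq)
      then show ?case using stable_space_max[OF Suc A(2)[of n]] by simp
    qed
    have "(indicator (\<Union>i. A i) :: 'a \<Rightarrow> real) \<in> stable_space"
    proof (rule stable_space_dominated_limit[where h="\<lambda>n. indicator (\<Union>i<n. A i)", OF fin L2_const[of 1]])
      show "(indicator (\<Union>i. A i) :: 'a \<Rightarrow> real) \<in> borel_measurable M"
        using A(1) by (intro borel_measurable_indicator sets.countable_UN) auto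
      show "\<bar>indicator (\<Union>i<n. A i) x\<bar> \<le> \<bar>1 :: real\<bar>" for n x by (simp add: indicator_def)
      show "(\<lambda>n. indicator (\<Union>i<n. A i) x :: real) \<longlonglongrightarrow> indicator (\<Union>i. A i) x" for x
        by (rule LIMSEQ_indicator_UN)
    qed
    then show "(\<Union>i. A i) \<in> ?A" using A(1) by auto
  qed
  then show ?thesis
    unfolding stable_field_def by (rule sigma_algebra.sets_measure_of_eq)
qed

lemma space_stable_field [simp]: "space stable_field = space M"
  by (simp add: stable_field_def space_measure_of_conv)

text \<open>The indicator of a null event has norm zero, hence no spectral mass at all.\<close>

lemma subfield_stable_field: "subfield M stable_field"
proof -
  have "indicator A \<in> stable_space" if A: "A \<in> null_sets M" for A
  proof -
    have L: "(indicator A :: 'a \<Rightarrow> real) \<in> L2 M" using A by (intro L2_indicator) auto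
    have "(\<integral>x. (indicator A x :: real)\<^sup>2 \<partial>M) = 0"
      using A AE_not_in[OF A] by (subst integral_cong_AE[where g="\<lambda>_. 0"]) (auto simp: indicator_def)
    then have "spectral_mass (indicator A) infinite_compacts = 0"
      using spectral_mass_le[OF L, of infinite_compacts] spectral_mass_nonneg[of "indicator A" infinite_compacts] by linarith
    then show ?thesis using L by (simp add: stable_space_def)
  qed
  then show ?thesis
    by (auto simp: subfield_def subalgebra_def sets_stable_field)
qed

lemma stable_space_measurable:
  assumes f: "f \<in> stable_space"
  shows "f \<in> borel_measurable stable_field"
proof (rule borel_measurableI_greater)
  fix a
  have fM[measurable]: "f \<in> borel_measurable M" using stable_space_L2[OF f] by (rule L2_measurable)
  let ?A = "{x \<in> space M. a < f x}"
  \<comment> \<open>Only lattice and linear operations are used; on \<open>space M\<close> these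
    functions increase to the indicator of \<open>?A\<close>.\<close>
  define h where "h n x = min (real n * max (f x - a) 0) 1" for n x
  have A: "?A \<in> sets M" by measurable
  have h: "h n \<in> stable_space" for n
    unfolding h_def[abs_def]
    by (intro stable_space_min stable_space_cmult stable_space_max stable_space_diff stable_space_const f)
  have "(indicator ?A :: 'a \<Rightarrow> real) \<in> stable_space"
  proof (rule stable_space_dominated_limit[OF h L2_const[of 1]])
    show "(indicator ?A :: 'a \<Rightarrow> real) \<in> borel_measurable M" using A by simp
    show "\<bar>h n x\<bar> \<le> \<bar>1\<bar>" for n x by (auto simp: h_def min_def)
    fix x assume x: "x \<in> space M"
    show "(\<lambda>n. h n x) \<longlonglongrightarrow> indicator ?A x"
    proof (cases "a < f x")
      case True
      obtain N where N: "1 < real N * (f x - a)" using reals_Archimedean3[of "f x - a"] True by auto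
      have "\<forall>\<^sub>F n in sequentially. h n x = 1"
        using eventually_ge_at_top[of N]
      proof eventually_elim
        case (elim n)
        have "real N * (f x - a) \<le> real n * (f x - a)" using elim True by (intro mult_right_mono) auto
        then have "1 \<le> real n * (f x - a)" using N by linarith
        then show ?case using True by (simp add: h_def)
      qed
      then show ?thesis using True x by (intro tendsto_eventually) simp
    next
      case False
      then have "h n x = 0" for n by (simp add: h_def)
      then show ?thesis using False by simp
    qed
  qed
  then show "{x \<in> space stable_field. a < f x} \<in> sets stable_field"
    using A by (simp add: sets_stable_field)
qed

lemma measurable_stable_space:
  assumes f: "f \<in> L2 M" and meas: "f \<in> borel_measurable stable_field"
  shows "f \<in> stable_space"
proof -
  from borel_measurable_implies_sequence_metric[OF meas, of 0]
  obtain h where "(\<forall>i. simple_function stable_field (h i)) \<and>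
    (\<forall>x\<in>space stable_field. (\<lambda>i. h i x) \<longlonglongrightarrow> f x) \<and>
    (\<forall>i. \<forall>x\<in>space stable_field. dist (h i x) 0 \<le> 2 * dist (f x) 0)" ..
  then have h: "\<And>i. simple_function stable_field (h i)"
    "\<And>x. x \<in> space M \<Longrightarrow> (\<lambda>i. h i x) \<longlonglongrightarrow> f x"
    "\<And>i x. x \<in> space M \<Longrightarrow> \<bar>h i x\<bar> \<le> \<bar>2 * f x\<bar>"
    by (simp_all add: abs_mult)
  \<comment> \<open>\<open>h i\<close> is uncontrolled outside \<open>space M\<close>. Its
    representation by indicators agrees with it on \<open>space M\<close> and is visibly a linear
    combination of stable functions.\<close>
  define s where "s i x = (\<Sum>y\<in>h i ` space M. y * indicator (h i -` {y} \<inter> space M) x)" for i x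
  have s_eq: "s i x = h i x" if x: "x \<in> space M" for i x
  proof -
    have "h i x = (\<Sum>y\<in>h i ` space stable_field. indicator (h i -` {y} \<inter> space stable_field) x *\<^sub>R y)"
      using x by (intro simple_function_indicator_representation_banach[OF h(1)]) simp
    also have "\<dots> = s i x" unfolding s_def by (simp add: mult.commute)
    finally show ?thesis ..
  qed
  have "s i \<in> stable_space" for i
    unfolding s_def[abs_def]
  proof (intro stable_space_sum stable_space_cmult)
    show "finite (h i ` space M)" using simple_functionD(1)[OF h(1)[of i]] by simp
    fix y
    have "h i -` {y} \<inter> space M \<in> sets stable_field" using simple_functionD(2)[OF h(1)[of i]] by simp
    then show "(indicator (h i -` {y} \<inter> space M) :: 'a \<Rightarrow> real) \<in> stable_space"
      by (simp add: sets_stable_field)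
  qed
  then show ?thesis
    by (rule stable_space_dominated_limit[where h=s, OF _ L2_cmult[OF f, of 2] L2_measurable[OF f]])
      (simp_all add: s_eq h)
qed

section \<open>The two equivalences\<close>

lemma stable_rv_iff_measurable:
  assumes "f \<in> L2 M"
  shows "stable_rv M F f \<longleftrightarrow> f \<in> borel_measurable stable_field"
proof -
  have "stable_rv M F f \<longleftrightarrow> f \<in> stable_space"
    using assms by (simp add: stable_rv_iff stable_space_def)
  then show ?thesis
    using stable_space_measurable[of f] measurable_stable_space[OF assms] by blast
qed

lemma finite_compacts_eq: "finite_compacts = compacts - infinite_compacts"
  by (auto simp: infinite_compacts_def finite_compacts_def)

text \<open>A sensitive function is orthogonal to the indicators of stable events, so its
  conditional expectation vanishes. Conversely, the stable part of \<open>f\<close> is orthogonal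
  both to \<open>f\<close> and to the sensitive part, hence to itself.\<close>

lemma sensitive_rv_iff_cond_exp:
  assumes f: "f \<in> L2 M"
  shows "sensitive_rv M F f \<longleftrightarrow> (AE x in M. real_cond_exp M stable_field f x = 0)"
proof -
  have sub: "subalgebra M stable_field" by (rule subfield_subalgebra[OF subfield_stable_field])
  interpret sigma_finite_subalgebra M stable_field
    by (rule finite_measure_subalgebra_is_sigma_finite) (unfold_locales, rule sub)
  show ?thesis
  proof
    assume "sensitive_rv M F f"
    then have null: "spectral_mass f finite_compacts = 0" by (simp add: sensitive_rv_iff[OF f])
    show "AE x in M. real_cond_exp M stable_field f x = 0"
    proof (rule real_cond_exp_charact)
      fix A assume "A \<in> sets stable_field"
      then have A: "(indicator A :: 'a \<Rightarrow> real) \<in> L2 M" "spectral_mass (indicator A) infinite_compacts = 0"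
        by (auto simp: sets_stable_field stable_space_def)
      have "(\<integral>x. f x * indicator A x \<partial>M) = 0"
        using spectral_orthogonal[OF f A(1) finite_compacts_sets null] A(2)
        by (simp add: infinite_compacts_eq)
      then show "(\<integral>x\<in>A. f x \<partial>M) = (\<integral>x\<in>A. 0 \<partial>M)"
        by (simp add: set_lebesgue_integral_def mult.commute)
    qed (use L2_integrable[OF f] in auto)
  next
    assume zero: "AE x in M. real_cond_exp M stable_field f x = 0"
    \<comment> \<open>\<open>h\<close> is the sensitive part of \<open>f\<close>, and the difference
      \<open>?u\<close> its stable part.\<close>
    obtain h where h: "h \<in> L2 M" "spectral_mass h (compacts - infinite_compacts) = 0"
      "spectral_mass (\<lambda>x. f x - h x) infinite_compacts = 0"
      using spectral_projection[OF f infinite_compacts_sets] by blast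
    let ?u = "\<lambda>x. f x - h x"
    have u: "?u \<in> L2 M" using f h(1) by (rule L2_diff)
    then have "?u \<in> stable_space" using h(3) by (simp add: stable_space_def)
    then have "?u \<in> borel_measurable stable_field" by (rule stable_space_measurable)
    then have "(\<integral>x. ?u x * f x \<partial>M) = (\<integral>x. ?u x * real_cond_exp M stable_field f x \<partial>M)"
      by (rule cond_exp_inner[OF sub f u, symmetric])
    also have "\<dots> = (\<integral>x. 0 \<partial>M)"
      using zero u f by (intro integral_cong_AE) auto
    finally have "(\<integral>x. ?u x * f x \<partial>M) = 0" by simp
    moreover have "(\<integral>x. ?u x * h x \<partial>M) = 0"
      by (rule spectral_orthogonal[OF u h(1) infinite_compacts_sets h(3,2)])
    moreover have "(\<integral>x. (?u x)\<^sup>2 \<partial>M) = (\<integral>x. ?u x * f x - ?u x * h x \<partial>M)"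
      by (simp add: power2_eq_square right_diff_distrib)
    ultimately have "(\<integral>x. (?u x)\<^sup>2 \<partial>M) = 0"
      using L2_mult_integrable[OF u f] L2_mult_integrable[OF u h(1)] by simp
    then have "spectral_mass ?u finite_compacts = 0"
      using spectral_mass_le[OF u, of finite_compacts] spectral_mass_nonneg[of ?u finite_compacts] by linarith
    then have "spectral_mass (\<lambda>x. ?u x + h x) finite_compacts = spectral_mass h finite_compacts"
      by (intro spectral_mass_add_null u h finite_compacts_sets)
    then show "sensitive_rv M F f"
      using h(2) by (simp add: sensitive_rv_iff[OF f] finite_compacts_eq[symmetric])
  qed
qed

end

theorem theorem5p2p11:
  fixes M :: "'a measure" and F :: "real \<Rightarrow> real \<Rightarrow> 'a measure"
  assumes "continuous_factorization M F"
  shows "\<exists>Fstable. subfield M Fstable \<and>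
    (\<forall>f\<in>L2 M.
      (stable_rv M F f \<longleftrightarrow> f \<in> borel_measurable Fstable) \<and>
      (sensitive_rv M F f \<longleftrightarrow> (AE x in M. real_cond_exp M Fstable f x = 0)))"
proof -
  interpret continuous_factorization M F by fact
  show ?thesis
    using subfield_stable_field stable_rv_iff_measurable sensitive_rv_iff_cond_exp
    by (intro exI[of _ stable_field]) blast
qed

end
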